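(* Let $p\neq2$ be a prime number, and let $\chi$ be an even Dirichlet character of odd conductor $f$. Then for $s\in\mathbb{C}_p$ with $|s|<p^{(p-2)/(p-1)}$, $$(1-\chi(2)\langle2\rangle^{1-s})\,L_p(s,\chi)=\lim_{n\to\infty}\frac12\sum_{\substack{a=1\\ p\nmid a}}^{fp^n}(-1)^{a+1}\chi\omega^{-1}(a)\frac{1}{\langle a\rangle^{s}}.$$ For $\chi=\omega^{1-i}$ and odd $i=1,\dots,p-2$, one obtains the branches of the $p$-adic zeta function: $$\zeta_{p,i}(s)=L_p(s,\omega^{1-i})=\frac{1}{1-\omega(2)^{1-i}\langle2\rangle^{1-s}}\cdot\lim_{n\to\infty}\frac12\sum_{\substack{a=1\\ p\nmid a}}^{p^n}(-1)^{a+1}\omega(a)^{-i}\frac{1}{\langle a\rangle^{s}}.$$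
   Context: $|\cdot|$ is the absolute value on $\mathbb{C}_p$ with $|p|=1/p$, and limits are taken in $\mathbb{C}_p$. Dirichlet characters are primitive and take values in $\mathbb{C}_p$ (via a fixed embedding of $\overline{\mathbb{Q}}$), with $\chi(a)=0$ if $(a,f)>1$. $\omega$ is the Teichmüller character of conductor $p$: for $p\nmid a$, $\omega(a)$ is the $(p-1)$-st root of unity in $\mathbb{Z}_p$ with $\omega(a)\equiv a \bmod p$; $\omega^0$ is the trivial character of conductor $1$. For $p\nmid a$, $\langle a\rangle=a/\omega(a)\in 1+p\mathbb{Z}_p$, $\chi\omega^{-1}(a)=\chi(a)\omega(a)^{-1}$, and $\langle a\rangle^{s}=\sum_{j\ge0}\binom{s}{j}(\langle a\rangle-1)^j$ for $|s|<p^{(p-2)/(p-1)}$. The $p$-adic $L$-function $L_p(s,\chi)$ is the meromorphic function (analytic if $\chi\ne1$) on $\{s\in\mathbb{C}_p: |s|<p^{(p-2)/(p-1)}\}$ given explicitly, for any positive multiple $F$ of $p$ and $f$, by $L_p(s,\chi)=\frac1F\frac1{s-1}\sum_{1\le a\le F,\,p\nmid a}\chi(a)\langle a\rangle^{1-s}\sum_{j\ge0}\binom{1-s}{j}(F/a)^jB_j$, where $B_j$ are the Bernoulli numbers ($B_1=-1/2$). The $p$-adic zeta functions are $\zeta_{p,i}(s)=L_p(s,\omega^{1-i})$. *)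

theory Defs
  imports "HOL-Analysis.Analysis" "HOL-Number_Theory.Cong"
begin

text \<open>
  The absolute value is the distance to 0.  The library's \<open>norm\<close> cannot be
  used, as its type constraint asks for a real vector space.
\<close>

definition pabs :: "'a::{field_char_0, complete_space} \<Rightarrow> real" where
  "pabs x = dist x 0"

text \<open>
  The field of \<open>p\<close>-adic complex numbers is described up to isometric isomorphism: a complete,
  algebraically closed field of characteristic 0 with a multiplicative ultrametric absolute value
  normalised by \<open>pabs p = 1/p\<close>, in which the elements algebraic over the closure of the
  rationals (that is, over \<open>\<rat>\<^sub>p\<close>) are dense.  Completeness and algebraic closedness are in the
  sort.
\<close>

definition is_padic_complex ::
    "nat \<Rightarrow> 'a::{alg_closed_field, field_char_0, complete_space} itself \<Rightarrow> bool" where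
  "is_padic_complex p T \<longleftrightarrow>
     prime p \<and>
     (\<forall>x y :: 'a. dist x y = pabs (x - y)) \<and>
     (\<forall>x y :: 'a. pabs (x * y) = pabs x * pabs y) \<and>
     (\<forall>x y :: 'a. pabs (x + y) \<le> max (pabs x) (pabs y)) \<and>
     pabs (of_nat p :: 'a) = 1 / real p \<and>
     closure {x :: 'a. \<exists>q. q \<noteq> 0 \<and> (\<forall>k. coeff q k \<in> closure \<rat>) \<and> poly q x = 0} = UNIV"

definition padic_ints :: "'a::{field_char_0, complete_space} set" where
  "padic_ints = closure \<int>"

definition padic_disc :: "nat \<Rightarrow> 'a::{field_char_0, complete_space} set" where
  "padic_disc p = {s. pabs s < real p powr ((real p - 2) / (real p - 1))}"

text \<open>
  Dirichlet characters of conductor \<open>f\<close>, i.e. primitive characters modulo \<open>f\<close>, as functions on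
  the integers.  The last condition says that the character is not induced from a proper divisor
  of \<open>f\<close>.  Nonzero values are roots of unity, so taking values in the field \<open>'a\<close> directly
  makes an embedding of the algebraic numbers unnecessary.  The trivial character (\<open>f = 1\<close>) is
  constantly 1, also at 0.
\<close>

definition dirichlet_char :: "nat \<Rightarrow> (int \<Rightarrow> 'a::field_char_0) \<Rightarrow> bool" where
  "dirichlet_char f \<psi> \<longleftrightarrow>
     f > 0 \<and>
     (\<forall>a b. \<psi> (a * b) = \<psi> a * \<psi> b) \<and>
     (\<forall>a. \<psi> (a + int f) = \<psi> a) \<and>
     (\<forall>a. \<psi> a = 0 \<longleftrightarrow> \<not> coprime a (int f)) \<and>
     (\<forall>d. d dvd f \<and> (\<forall>a. coprime a (int f) \<and> [a = 1] (mod int d) \<longrightarrow> \<psi> a = 1) \<longrightarrow> d = f)"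

definition teich :: "nat \<Rightarrow> int \<Rightarrow> 'a::{field_char_0, complete_space}" where
  "teich p a =
     (if int p dvd a then 0
      else (THE w. w \<in> padic_ints \<and> w ^ (p - 1) = 1 \<and>
                   (\<exists>z \<in> padic_ints. w - of_int a = of_nat p * z)))"

text \<open>
  Powers of the Teichmueller character as primitive characters: trivial powers have conductor 1,
  hence take the value 1 at multiples of \<open>p\<close> as well.
\<close>

definition teich_char :: "nat \<Rightarrow> int \<Rightarrow> int \<Rightarrow> 'a::{field_char_0, complete_space}" where
  "teich_char p k a =
     (if int (p - 1) dvd k then 1 else if int p dvd a then 0 else teich p a powi k)"

definition angle :: "nat \<Rightarrow> int \<Rightarrow> 'a::{field_char_0, complete_space}" where
  "angle p a = of_int a / teich p a"

definition padic_pow :: "'a::{field_char_0, complete_space} \<Rightarrow> 'a \<Rightarrow> 'a" where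
  "padic_pow x s = (\<Sum>j. (s gchoose j) * (x - 1) ^ j)"

definition bernoulli :: "nat \<Rightarrow> rat" where
  "bernoulli j = fact j * fps_nth (fps_X / (fps_exp 1 - 1)) j"

text \<open>
  The explicit formula for the \<open>p\<close>-adic \<open>L\<close>-function, in terms of a positive common multiple
  \<open>F\<close> of \<open>p\<close> and the conductor (the result does not depend on the choice of \<open>F\<close>).  The formula
  has an apparent singularity at \<open>s = 1\<close>; there the value of the analytic continuation is
  the limit.  For the trivial character \<open>s = 1\<close> is a pole and the value is meaningless.
\<close>

definition padic_L_formula ::
    "nat \<Rightarrow> nat \<Rightarrow> (int \<Rightarrow> 'a) \<Rightarrow> 'a::{field_char_0, complete_space} \<Rightarrow> 'a" where
  "padic_L_formula p F \<psi> s =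
     1 / of_nat F * (1 / (s - 1)) *
     (\<Sum>a | a \<in> {1..F} \<and> \<not> p dvd a.
        \<psi> (int a) * padic_pow (angle p (int a)) (1 - s) *
        (\<Sum>j. ((1 - s) gchoose j) * (of_nat F / of_nat a) ^ j * of_rat (bernoulli j)))"

definition padic_L ::
    "nat \<Rightarrow> nat \<Rightarrow> (int \<Rightarrow> 'a) \<Rightarrow> 'a::{field_char_0, complete_space} \<Rightarrow> 'a" where
  "padic_L p F \<psi> s =
     (if s = 1 then Lim (at 1) (padic_L_formula p F \<psi>) else padic_L_formula p F \<psi> s)"

definition padic_zeta ::
    "nat \<Rightarrow> nat \<Rightarrow> nat \<Rightarrow> 'a::{field_char_0, complete_space} \<Rightarrow> 'a" where
  "padic_zeta p F i s = padic_L p F (teich_char p (1 - int i)) s"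

definition alternating_sum ::
    "nat \<Rightarrow> nat \<Rightarrow> (int \<Rightarrow> 'a) \<Rightarrow> 'a::{field_char_0, complete_space} \<Rightarrow> 'a" where
  "alternating_sum p N g s =
     1 / 2 * (\<Sum>a | a \<in> {1..N} \<and> \<not> p dvd a.
       (-1) ^ (a + 1) * g (int a) * (1 / padic_pow (angle p (int a)) s))"

end

(*
  Put t = 1 - s and g(a) = psi(a) <a>^t, extended by 0 to the multiples of p.  Expanding <a + Fx>^t
  binomially and using that the means of x^j over x < p^n tend to B_j, one sees that
  (s - 1) L_p(s, psi) is the Volkenborn integral V of g, the limit of the means of g over
  1 <= a <= N for N = F p^n; a Taylor expansion of g modulo N^2 shows that F does not matter.

  Let N be odd.  The doubling a -> 2a maps {1..N} onto the even numbers up to 2N, and those above N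
  are N + c with c odd, where g(N + c) is g(c) + t N g(c)/c modulo N^2.  Hence g(2) - 1 times the
  mean of g is t times the sum of g(c)/c over the odd c <= N, up to O(N).  As the sum of g(c)/c over
  all c <= N tends to 0, this gives (g(2) - 1) V = t A with A the limit of the alternating sums.

  The alternating sums are Lipschitz in s uniformly in n, so both sides may be compared at s = 1 by
  continuity; for nontrivial psi the formula for L_p has a limit at s = 1 because the sum of psi(a)
  over 1 <= a <= F prime to p vanishes.
*)
theory Submission
  imports Defs "HOL-Computational_Algebra.Computational_Algebra" "HOL-Number_Theory.Residues"
begin

text \<open>The radius p^((p-2)/(p-1)) equals p / \<open>kap\<close> with \<open>kap\<close> =
  p^(1/(p-1)), the growth rate of 1/|n!|. For |x - 1| <= 1/p the j-th term of the binomial series of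
  x^t is at most (max(1,|t|) * \<open>kap\<close> / p)^j, so the series converges geometrically on
  the whole disc. All estimates are ultrametric: a sum is bounded by its largest term, so errors do
  not grow with the number of summands. What does cost is the division by N in a mean, which
  multiplies an error by 1/|N|. Hence g is expanded modulo N^2 wherever means occur, while a
  first-order bound suffices for the convergence of the alternating sums, which are not divided by
  N. The first-order coefficient t g(c)/c is, up to the factor t, again a function of the same type,
  belonging to psi omega^(-1) and the exponent t - 1 = -s; this is where the summands of the theorem
  come from. The expansion of g(c + N) rests on the law (xy)^t = x^t y^t, which for powers defined
  by series has to be proved by interpolation from natural exponents.\<close>

locale padic_field =
  fixes p :: nat and T :: "'a::{field_char_0, complete_space} itself"
  assumes prime_p: "prime p" and p_neq_2: "p \<noteq> 2"
    and dist_pabs: "dist x y = pabs (x - y :: 'a)"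
    and pabs_mult: "pabs (x * y :: 'a) = pabs x * pabs y"
    and pabs_add_max: "pabs (x + y :: 'a) \<le> max (pabs x) (pabs y)"
    and pabs_p: "pabs (of_nat p :: 'a) = 1 / real p"
begin

section \<open>The absolute value on the field and on the integers\<close>

lemma p_ge_3: "p \<ge> 3"
  using prime_ge_2_nat[OF prime_p] p_neq_2 by simp

lemma odd_p: "odd p"
  using prime_p p_neq_2 prime_odd_nat p_ge_3 by auto

lemma pabs_0 [simp]: "pabs (0 :: 'a) = 0"
  by (simp add: pabs_def)

lemma pabs_nonneg [simp]: "pabs (x :: 'a) \<ge> 0"
  by (simp add: pabs_def)

lemma pabs_eq_0_iff [simp]: "pabs (x :: 'a) = 0 \<longleftrightarrow> x = 0"
  by (simp add: pabs_def)

lemma pabs_pos_iff [simp]: "pabs (x :: 'a) > 0 \<longleftrightarrow> x \<noteq> 0"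
  by (simp add: pabs_def)

lemma pabs_1 [simp]: "pabs (1 :: 'a) = 1"
proof -
  have "pabs (1 :: 'a) * pabs (1 :: 'a) = pabs (1 :: 'a)" by (simp flip: pabs_mult)
  then show ?thesis by simp
qed

lemma pabs_minus [simp]: "pabs (- x :: 'a) = pabs x"
proof -
  have "pabs (- x) = dist 0 x" by (simp add: dist_pabs)
  then show ?thesis by (simp add: pabs_def dist_commute)
qed

lemma pabs_minus_commute: "pabs (x - y :: 'a) = pabs (y - x)"
  using pabs_minus[of "x - y"] by simp

lemma pabs_diff_max: "pabs (x - y :: 'a) \<le> max (pabs x) (pabs y)"
  using pabs_add_max[of x "-y"] by simp

lemma pabs_triangle: "pabs (x + y :: 'a) \<le> pabs x + pabs y"
  using pabs_add_max[of x y] pabs_nonneg[of x] pabs_nonneg[of y] by linarith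

lemma pabs_add_le: "pabs (x :: 'a) \<le> B \<Longrightarrow> pabs y \<le> B \<Longrightarrow> pabs (x + y) \<le> B"
  using pabs_add_max[of x y] by linarith

lemma pabs_diff_le: "pabs (x :: 'a) \<le> B \<Longrightarrow> pabs y \<le> B \<Longrightarrow> pabs (x - y) \<le> B"
  using pabs_diff_max[of x y] by linarith

lemma pabs_power: "pabs (x ^ n :: 'a) = pabs x ^ n"
  by (induction n) (simp_all add: pabs_mult)

lemma pabs_inverse: "pabs (inverse x :: 'a) = inverse (pabs x)"
proof (cases "x = 0")
  case False
  then have "pabs x * pabs (inverse x) = 1" by (simp flip: pabs_mult)
  then show ?thesis using inverse_unique by metis
qed simp

lemma pabs_divide: "pabs (x / y :: 'a) = pabs x / pabs y"
  by (simp add: divide_inverse pabs_mult pabs_inverse)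

lemma pabs_prod: "pabs (\<Prod>i\<in>A. f i :: 'a) = (\<Prod>i\<in>A. pabs (f i))"
  by (induction A rule: infinite_finite_induct) (simp_all add: pabs_mult)

lemma pabs_sum_le:
  assumes "\<And>i. i \<in> A \<Longrightarrow> pabs (f i :: 'a) \<le> B" "B \<ge> 0"
  shows "pabs (\<Sum>i\<in>A. f i) \<le> B"
  using assms(1) by (induction A rule: infinite_finite_induct) (auto intro!: pabs_add_le simp: assms(2))

lemma pabs_of_nat_le_1 [simp]: "pabs (of_nat n :: 'a) \<le> 1"
  by (induction n) (auto intro!: pabs_add_le)

lemma pabs_of_int_le_1 [simp]: "pabs (of_int n :: 'a) \<le> 1"
  by (cases n) (auto simp del: of_nat_Suc)

text \<open>Ultrametric triangles are isosceles: a strictly dominant summand determines the size of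
  the sum.\<close>

lemma pabs_eqI: "pabs (x - y :: 'a) < pabs y \<Longrightarrow> pabs x = pabs y"
  using pabs_add_max[of "x - y" y] pabs_diff_max[of x "x - y"] by simp

lemma pabs_of_int_dvd:
  assumes "int p dvd a"
  shows "pabs (of_int a :: 'a) \<le> 1 / real p"
proof -
  obtain k where "a = int p * k" using assms by blast
  then have "pabs (of_int a :: 'a) = 1 / real p * pabs (of_int k :: 'a)"
    by (simp add: pabs_mult pabs_p)
  then show ?thesis using mult_left_mono[of "pabs (of_int k :: 'a)" 1 "1 / real p"] by simp
qed

lemma pabs_of_nat_dvd: "p dvd n \<Longrightarrow> pabs (of_nat n :: 'a) \<le> 1 / real p"
  using pabs_of_int_dvd[of "int n"] by simp

text \<open>By Bezout 1 = a u + p v. Here p v is too small to reach absolute value 1, so a u must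
  reach it.\<close>

lemma pabs_of_int_unit:
  assumes "\<not> int p dvd a"
  shows "pabs (of_int a :: 'a) = 1"
proof -
  have "coprime a (int p)"
    using assms prime_p prime_imp_coprime[of "int p" a] by (simp add: coprime_commute)
  then obtain u v where uv: "a * u + int p * v = 1"
    by (metis bezout_int coprime_imp_gcd_eq_1 mult.commute)
  have "1 = pabs (of_int (a * u + int p * v) :: 'a)" using uv by simp
  also have "\<dots> \<le> max (pabs (of_int (a * u) :: 'a)) (pabs (of_int (int p * v) :: 'a))"
    using pabs_add_max by simp
  finally have "1 \<le> max (pabs (of_int (a * u) :: 'a)) (pabs (of_int (int p * v) :: 'a))" .
  moreover have "pabs (of_int (int p * v) :: 'a) < 1"
  proof -
    have "1 / real p < 1" using p_ge_3 by simp
    then show ?thesis using pabs_of_int_dvd[of "int p * v"] by simp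
  qed
  ultimately have "1 \<le> pabs (of_int (a * u) :: 'a)" by linarith
  also have "\<dots> \<le> pabs (of_int a :: 'a)"
    using mult_left_mono[of "pabs (of_int u :: 'a)" 1 "pabs (of_int a :: 'a)"] by (simp add: pabs_mult)
  finally show ?thesis using pabs_of_int_le_1[of a] by linarith
qed

lemma pabs_of_nat_unit: "\<not> p dvd n \<Longrightarrow> pabs (of_nat n :: 'a) = 1"
  using pabs_of_int_unit[of "int n"] by simp

text \<open>Each factor p that is split off divides both |n| and n by p or more. In later series a
  denominator k + 1 therefore costs only a factor linear in k.\<close>

lemma pabs_of_nat_ge: "n > 0 \<Longrightarrow> pabs (of_nat n :: 'a) \<ge> 1 / real n"
proof (induction n rule: less_induct)
  case (less n)
  show ?case
  proof (cases "p dvd n")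
    case True
    then obtain m where m: "n = p * m" by blast
    with less.prems p_ge_3 have "m > 0" "m < n" by auto
    then have "1 / real m \<le> pabs (of_nat m :: 'a)" using less.IH by blast
    then show ?thesis using p_ge_3 by (simp add: m pabs_mult pabs_p field_simps)
  next
    case False
    then show ?thesis using less.prems by (simp add: pabs_of_nat_unit)
  qed
qed

lemma pabs_two [simp]: "pabs (2 :: 'a) = 1"
proof -
  have "\<not> p dvd 2" using p_ge_3 dvd_imp_le[of p 2] by auto
  then show ?thesis using pabs_of_nat_unit[of 2] by simp
qed

subsection \<open>Limits and series\<close>

lemma tendsto_pabs_iff: "(f \<longlongrightarrow> (l :: 'a)) G \<longleftrightarrow> ((\<lambda>x. pabs (f x - l)) \<longlongrightarrow> 0) G"
  by (subst tendsto_dist_iff) (simp add: dist_pabs)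

lemma tendsto_pabs_bound:
  assumes "eventually (\<lambda>x. pabs (f x - l :: 'a) \<le> g x) G" "(g \<longlongrightarrow> 0) G"
  shows "(f \<longlongrightarrow> l) G"
  unfolding tendsto_pabs_iff
  by (rule tendsto_sandwich[OF _ assms(1) tendsto_const assms(2)]) simp

lemma tendsto_add_padic:
  assumes "(f \<longlongrightarrow> (a :: 'a)) G" "(g \<longlongrightarrow> b) G"
  shows "((\<lambda>x. f x + g x) \<longlongrightarrow> a + b) G"
proof (rule tendsto_pabs_bound)
  show "((\<lambda>x. pabs (f x - a) + pabs (g x - b)) \<longlongrightarrow> 0) G"
    using assms unfolding tendsto_pabs_iff by (intro tendsto_add_zero)
  have "pabs (f x + g x - (a + b)) \<le> pabs (f x - a) + pabs (g x - b)" for x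
    using pabs_triangle[of "f x - a" "g x - b"] by (simp add: add_diff_add)
  then show "\<forall>\<^sub>F x in G. pabs (f x + g x - (a + b)) \<le> pabs (f x - a) + pabs (g x - b)" by simp
qed

lemma tendsto_pabs:
  assumes "(f \<longlongrightarrow> (a :: 'a)) G"
  shows "((\<lambda>x. pabs (f x)) \<longlongrightarrow> pabs a) G"
  unfolding pabs_def by (intro tendsto_dist assms tendsto_const)

lemma tendsto_mult_padic:
  assumes "(f \<longlongrightarrow> (a :: 'a)) G" "(g \<longlongrightarrow> b) G"
  shows "((\<lambda>x. f x * g x) \<longlongrightarrow> a * b) G"
proof (rule tendsto_pabs_bound)
  have "((\<lambda>x. pabs (f x) * pabs (g x - b) + pabs (f x - a) * pabs b) \<longlongrightarrow> pabs a * 0 + 0 * pabs b) G"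
    using assms tendsto_pabs[OF assms(1)] unfolding tendsto_pabs_iff by (intro tendsto_intros)
  then show "((\<lambda>x. pabs (f x) * pabs (g x - b) + pabs (f x - a) * pabs b) \<longlongrightarrow> 0) G" by simp
  have "pabs (f x * g x - a * b) \<le> pabs (f x) * pabs (g x - b) + pabs (f x - a) * pabs b" for x
  proof -
    have "f x * g x - a * b = f x * (g x - b) + (f x - a) * b" by (simp add: algebra_simps)
    then show ?thesis
      using pabs_triangle[of "f x * (g x - b)" "(f x - a) * b"] by (simp add: pabs_mult)
  qed
  then show "\<forall>\<^sub>F x in G. pabs (f x * g x - a * b) \<le> pabs (f x) * pabs (g x - b) + pabs (f x - a) * pabs b"
    by simp
qed

lemma tendsto_cmult_padic: "(f \<longlongrightarrow> (a :: 'a)) G \<Longrightarrow> ((\<lambda>x. c * f x) \<longlongrightarrow> c * a) G"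
  by (intro tendsto_mult_padic tendsto_const)

lemma tendsto_minus_padic: "(f \<longlongrightarrow> (a :: 'a)) G \<Longrightarrow> ((\<lambda>x. - f x) \<longlongrightarrow> - a) G"
  using tendsto_cmult_padic[of f a G "-1"] by simp

lemma tendsto_diff_padic:
  "(f \<longlongrightarrow> (a :: 'a)) G \<Longrightarrow> (g \<longlongrightarrow> b) G \<Longrightarrow> ((\<lambda>x. f x - g x) \<longlongrightarrow> a - b) G"
  using tendsto_add_padic[of f a G "\<lambda>x. - g x" "- b"] tendsto_minus_padic[of g b G] by simp

lemma tendsto_sum_padic:
  "(\<And>i. i \<in> I \<Longrightarrow> ((\<lambda>x. f i x) \<longlongrightarrow> (a i :: 'a)) G) \<Longrightarrow> ((\<lambda>x. \<Sum>i\<in>I. f i x) \<longlongrightarrow> (\<Sum>i\<in>I. a i)) G"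
  by (induction I rule: infinite_finite_induct) (simp_all add: tendsto_add_padic)

lemma pabs_lim_le:
  assumes "X \<longlonglongrightarrow> (l :: 'a)" "\<And>n. n \<ge> m \<Longrightarrow> pabs (X n) \<le> B"
  shows "pabs l \<le> B"
  by (rule LIMSEQ_le_const2[OF tendsto_pabs[OF assms(1)]]) (use assms(2) in blast)

text \<open>X (N + k) - X N is no larger than the largest of its consecutive differences, so null
  differences already make X a Cauchy sequence.\<close>

lemma convergent_padic:
  assumes "(\<lambda>n. pabs (X (Suc n) - X n :: 'a)) \<longlonglongrightarrow> 0"
  shows "convergent X"
proof (rule Cauchy_convergent, rule metric_CauchyI)
  fix e :: real assume "e > 0"
  then obtain N where N: "\<And>n. n \<ge> N \<Longrightarrow> pabs (X (Suc n) - X n) < e"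
    using order_tendstoD(2)[OF assms, of e] by (auto simp: eventually_sequentially)
  have *: "pabs (X (N + k) - X N) < e" for k
  proof (induction k)
    case (Suc k)
    have "X (N + Suc k) - X N = (X (Suc (N + k)) - X (N + k)) + (X (N + k) - X N)" by simp
    then show ?case using Suc N[of "N + k"] pabs_add_max[of "X (Suc (N + k)) - X (N + k)" "X (N + k) - X N"]
      by simp
  qed (use \<open>e > 0\<close> in simp)
  show "\<exists>M. \<forall>m\<ge>M. \<forall>n\<ge>M. dist (X m) (X n) < e"
  proof (intro exI allI impI)
    fix m n assume "m \<ge> N" "n \<ge> N"
    then have "pabs (X m - X N) < e" "pabs (X n - X N) < e" using *[of "m - N"] *[of "n - N"] by simp_all
    then show "dist (X m) (X n) < e"
      using pabs_diff_max[of "X m - X N" "X n - X N"] by (simp add: dist_pabs)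
  qed
qed

lemma summable_padic:
  assumes "(\<lambda>n. pabs (f n :: 'a)) \<longlonglongrightarrow> 0"
  shows "summable f"
proof -
  have "convergent (\<lambda>n. \<Sum>i<n. f i)" by (rule convergent_padic) (simp add: assms)
  then show ?thesis unfolding summable_def sums_def convergent_def .
qed

lemma summable_padic_geometric:
  assumes "\<And>n. pabs (f n :: 'a) \<le> C * \<rho> ^ n" "0 \<le> \<rho>" "\<rho> < 1"
  shows "summable f"
proof (rule summable_padic, rule tendsto_sandwich[OF _ _ tendsto_const])
  show "(\<lambda>n. C * \<rho> ^ n) \<longlonglongrightarrow> 0"
    using assms(2,3) by (intro tendsto_mult_right_zero LIMSEQ_realpow_zero)
qed (use assms in auto)

lemma sums_cmult_padic: "f sums (a :: 'a) \<Longrightarrow> (\<lambda>n. c * f n) sums (c * a)"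
  unfolding sums_def by (drule tendsto_cmult_padic[where c = c]) (simp add: sum_distrib_left)

lemma sums_add_padic: "f sums (a :: 'a) \<Longrightarrow> g sums b \<Longrightarrow> (\<lambda>n. f n + g n) sums (a + b)"
  unfolding sums_def by (simp add: sum.distrib tendsto_add_padic)

lemma sums_diff_padic: "f sums (a :: 'a) \<Longrightarrow> g sums b \<Longrightarrow> (\<lambda>n. f n - g n) sums (a - b)"
  unfolding sums_def by (simp add: sum_subtractf tendsto_diff_padic)

lemma sums_sum_padic:
  "(\<And>i. i \<in> I \<Longrightarrow> (\<lambda>n. f i n) sums (a i :: 'a)) \<Longrightarrow> (\<lambda>n. \<Sum>i\<in>I. f i n) sums (\<Sum>i\<in>I. a i)"
  by (induction I rule: infinite_finite_induct) (simp_all add: sums_add_padic)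

lemma sums_shift_padic:
  assumes "(\<lambda>n. f (Suc n)) sums (a :: 'a)"
  shows "f sums (f 0 + a)"
proof -
  have "(\<lambda>n. f 0 + (\<Sum>i<n. f (Suc i))) \<longlonglongrightarrow> f 0 + a"
    using assms unfolding sums_def by (intro tendsto_add_padic tendsto_const)
  then have "(\<lambda>n. \<Sum>i<Suc n. f i) \<longlonglongrightarrow> f 0 + a"
    by (simp only: sum.lessThan_Suc_shift)
  then show ?thesis unfolding sums_def by (rule LIMSEQ_imp_Suc)
qed

lemma pabs_sums_le:
  assumes "f sums (a :: 'a)" "\<And>n. pabs (f n) \<le> B"
  shows "pabs a \<le> B"
proof -
  have "B \<ge> 0" using assms(2)[of 0] pabs_nonneg[of "f 0"] by linarith
  then show ?thesis
    by (intro pabs_lim_le[OF assms(1)[unfolded sums_def], where m = 0] pabs_sum_le[OF assms(2)])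
qed

text \<open>The points x + p^n differ from x and tend to it. This makes limits at 1 unique, on which
  the value of \<open>padic_L\<close> at 1, a \<open>Lim\<close>, depends.\<close>

lemma islimpt_padic: "\<not> trivial_limit (at (x :: 'a))"
proof -
  have "x islimpt UNIV"
    unfolding islimpt_approachable
  proof (intro allI impI)
    fix e :: real assume "e > 0"
    have "1 / real p < 1" using p_ge_3 by simp
    with \<open>e > 0\<close> obtain n where "(1 / real p) ^ n < e" using real_arch_pow_inv by blast
    then show "\<exists>x'\<in>UNIV. x' \<noteq> x \<and> dist x' x < e"
      using p_ge_3 by (intro bexI[of _ "x + of_nat p ^ n"]) (auto simp: dist_pabs pabs_power pabs_p)
  qed
  then show ?thesis by (simp add: trivial_limit_within)
qed

section \<open>Factorials and the disc of convergence\<close>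

definition kap :: real where "kap = real p powr (1 / (real p - 1))"

lemma kap_gt_1: "kap > 1"
  unfolding kap_def using p_ge_3 by (intro gr_one_powr) auto

text \<open>The reason for the choice of \<open>kap\<close>: for n > 0 the factorial of n contains
  at most (n - 1)/(p - 1) factors p, so its inverse grows at most like \<open>kap\<close> ^ (n -
  1).\<close>

lemma kap_power: "kap ^ (p - Suc 0) = real p"
proof -
  have "kap ^ (p - Suc 0) = kap powr real (p - Suc 0)" using kap_gt_1 by (simp add: powr_realpow)
  also have "\<dots> = real p powr 1" unfolding kap_def powr_powr using p_ge_3 by (simp add: of_nat_diff)
  finally show ?thesis using p_ge_3 by simp
qed

lemma kap_less_p: "kap < real p"
proof -
  have "kap ^ 1 < kap ^ (p - 1)" using kap_gt_1 p_ge_3 by (intro power_strict_increasing) auto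
  then show ?thesis by (simp add: kap_power)
qed

lemma pabs_fact_add: "pabs (fact (n + k) :: 'a) = pabs (fact n :: 'a) * (\<Prod>i<k. pabs (of_nat (n + Suc i) :: 'a))"
  by (induction k) (simp_all add: pabs_mult mult_ac flip: of_nat_Suc of_nat_add del: of_nat_add of_nat_Suc)

text \<open>Among p m + 1, ..., p m + p only the last number is divisible by p. This is Legendre's
  formula in recursive form.\<close>

lemma pabs_fact_p_mult: "pabs (fact (p * m) :: 'a) = pabs (fact m :: 'a) / real p ^ m"
proof (induction m)
  case (Suc m)
  obtain q where q: "p = Suc q" using p_ge_3 by (cases p) auto
  have "pabs (fact (p * Suc m) :: 'a) =
      pabs (fact (p * m) :: 'a) * (\<Prod>i<p. pabs (of_nat (p * m + Suc i) :: 'a))"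
    using pabs_fact_add[of "p * m" p] by (simp add: algebra_simps)
  also have "(\<Prod>i<p. pabs (of_nat (p * m + Suc i) :: 'a)) =
      (\<Prod>i<q. pabs (of_nat (p * m + Suc i) :: 'a)) * pabs (of_nat (p * m + p) :: 'a)"
    unfolding q by simp
  also have "(\<Prod>i<q. pabs (of_nat (p * m + Suc i) :: 'a)) = 1"
  proof (rule prod.neutral, rule ballI)
    fix i assume "i \<in> {..<q}"
    then have "\<not> p dvd Suc i" using q dvd_imp_le[of p "Suc i"] by auto
    then have "\<not> p dvd p * m + Suc i" by (simp add: dvd_add_right_iff del: add_Suc_right)
    then show "pabs (of_nat (p * m + Suc i) :: 'a) = 1" by (rule pabs_of_nat_unit)
  qed
  also have "(of_nat (p * m + p) :: 'a) = of_nat p * of_nat (Suc m)" by (simp add: algebra_simps)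
  finally show ?case using Suc.IH by (simp add: pabs_mult pabs_p field_simps del: of_nat_Suc)
qed simp

text \<open>The exponent n - 1 instead of n lets \<open>t gchoose Suc j\<close> be bounded with j
  powers of \<open>kap\<close>, so that the linear term in t suffers no loss.\<close>

lemma pabs_fact_ge: "1 \<le> pabs (fact n :: 'a) * kap ^ (n - 1)"
proof (induction n rule: less_induct)
  case (less n)
  define m r where "m = n div p" and "r = n mod p"
  have n: "n = p * m + r" and "r < p" using p_ge_3 by (auto simp: m_def r_def)
  have "(\<Prod>i<r. pabs (of_nat (p * m + Suc i) :: 'a)) = 1"
  proof (rule prod.neutral, rule ballI)
    fix i assume "i \<in> {..<r}"
    then have "\<not> p dvd Suc i" using \<open>r < p\<close> dvd_imp_le[of p "Suc i"] by auto
    then have "\<not> p dvd p * m + Suc i" by (simp add: dvd_add_right_iff del: add_Suc_right)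
    then show "pabs (of_nat (p * m + Suc i) :: 'a) = 1" by (rule pabs_of_nat_unit)
  qed
  then have eq: "pabs (fact n :: 'a) = pabs (fact m :: 'a) / real p ^ m"
    unfolding n pabs_fact_add by (simp add: pabs_fact_p_mult)
  show ?case
  proof (cases "m = 0")
    case True
    then show ?thesis using eq kap_gt_1 by simp
  next
    case False
    then have "1 * m < p * m" using p_ge_3 by (intro mult_strict_right_mono) auto
    then have "m < n" using n by linarith
    \<comment> \<open>Written as a power of \<open>kap\<close>, p^m has exponent (p - 1) m. The m -
      1 of the induction hypothesis brings the total to p m - 1.\<close>
    have exps: "(p - 1) * m + (m - 1) \<le> n - 1"
      using False n p_ge_3 \<open>1 * m < p * m\<close> by (simp add: diff_mult_distrib)
    have "1 \<le> pabs (fact m :: 'a) * kap ^ (m - 1)" using less.IH \<open>m < n\<close> by blast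
    also have "\<dots> = pabs (fact m :: 'a) / real p ^ m * kap ^ ((p - 1) * m + (m - 1))"
      using p_ge_3 by (simp add: power_add power_mult kap_power)
    also have "\<dots> \<le> pabs (fact m :: 'a) / real p ^ m * kap ^ (n - 1)"
      using kap_gt_1 exps by (intro mult_left_mono power_increasing) auto
    finally show ?thesis by (simp add: eq)
  qed
qed

text \<open>Since (p - 2)/(p - 1) = 1 - 1/(p - 1), the radius is p / \<open>kap\<close>.\<close>

lemma disc_iff: "(t :: 'a) \<in> padic_disc p \<longleftrightarrow> pabs t * kap < real p"
proof -
  have "(real p - 2) / (real p - 1) = 1 - 1 / (real p - 1)" using p_ge_3 by (simp add: field_simps)
  then have "real p powr ((real p - 2) / (real p - 1)) = real p / kap"
    using p_ge_3 by (simp add: powr_diff kap_def)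
  then have "pabs t \<in> {..<real p powr ((real p - 2) / (real p - 1))} \<longleftrightarrow> pabs t < real p / kap" by simp
  then show ?thesis using kap_gt_1 by (simp add: padic_disc_def pos_less_divide_eq)
qed

lemma disc_pabs_le_1: "pabs (t :: 'a) \<le> 1 \<Longrightarrow> t \<in> padic_disc p"
  using kap_less_p kap_gt_1 mult_right_mono[of "pabs t" 1 kap] unfolding disc_iff by linarith

lemma disc_0 [simp]: "(0 :: 'a) \<in> padic_disc p"
  and disc_1 [simp]: "(1 :: 'a) \<in> padic_disc p"
  by (auto intro: disc_pabs_le_1)

lemma disc_diff: "(s :: 'a) \<in> padic_disc p \<Longrightarrow> t \<in> padic_disc p \<Longrightarrow> s - t \<in> padic_disc p"
  using pabs_diff_max[of s t] unfolding padic_disc_def by auto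

lemma disc_minus [simp]: "- (s :: 'a) \<in> padic_disc p \<longleftrightarrow> s \<in> padic_disc p"
  by (simp add: padic_disc_def)

lemma disc_add: "(s :: 'a) \<in> padic_disc p \<Longrightarrow> t \<in> padic_disc p \<Longrightarrow> s + t \<in> padic_disc p"
  using disc_diff[of s "- t"] by simp

section \<open>Binomial coefficients and binomial series as functions of the upper argument\<close>

lemma pabs_gchoose_Suc_le:
  assumes "pabs (t :: 'a) \<le> r" "r \<ge> 1"
  shows "pabs (t gchoose Suc j) \<le> pabs t * (r * kap) ^ j"
proof -
  have "pabs (t - of_nat i) \<le> r" for i
    using assms pabs_of_nat_le_1[of i] by (intro pabs_diff_le) linarith+
  then have "(\<Prod>i=1..<Suc j. pabs (t - of_nat i)) \<le> (\<Prod>i=1..<Suc j. r)"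
    by (intro prod_mono) auto
  then have "pabs t * (\<Prod>i=1..<Suc j. pabs (t - of_nat i)) \<le> pabs t * r ^ j"
    by (intro mult_left_mono) auto
  \<comment> \<open>The factor for i = 0 is t itself and is kept as |t|, which gives smallness near
    t = 0. Only the other j factors are estimated by r.\<close>
  then have "(\<Prod>i=0..<Suc j. pabs (t - of_nat i)) \<le> pabs t * r ^ j"
    by (subst prod.atLeast_Suc_lessThan) auto
  moreover have "pabs (fact (Suc j) :: 'a) * pabs (t gchoose Suc j) = (\<Prod>i=0..<Suc j. pabs (t - of_nat i))"
    by (simp only: gbinomial_mult_fact flip: pabs_mult pabs_prod)
  ultimately have "pabs (fact (Suc j) :: 'a) * pabs (t gchoose Suc j) \<le> pabs t * r ^ j" by simp
  then have "pabs (fact (Suc j) :: 'a) * kap ^ j * pabs (t gchoose Suc j) \<le> pabs t * (r * kap) ^ j"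
    using kap_gt_1 mult_right_mono[of _ _ "kap ^ j"] by (simp add: power_mult_distrib mult_ac)
  moreover have "1 * pabs (t gchoose Suc j) \<le> pabs (fact (Suc j) :: 'a) * kap ^ j * pabs (t gchoose Suc j)"
    using pabs_fact_ge[of "Suc j"] by (intro mult_right_mono) auto
  ultimately show ?thesis by simp
qed

lemma pabs_gchoose_le:
  assumes "pabs (t :: 'a) \<le> r" "r \<ge> 1"
  shows "pabs (t gchoose j) \<le> (r * kap) ^ j"
proof (cases j)
  case (Suc i)
  have "pabs t \<le> r * kap" using assms kap_gt_1 mult_mono[of "pabs t" r 1 kap] by simp
  then have "pabs t * (r * kap) ^ i \<le> r * kap * (r * kap) ^ i"
    using assms kap_gt_1 by (intro mult_right_mono) auto
  then show ?thesis using pabs_gchoose_Suc_le[OF assms, of i] by (simp add: Suc)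
qed simp

text \<open>Vandermonde for s = (s - t) + t: the term k = 0 is \<open>t gchoose j\<close>, and every
  other term contains \<open>(s - t) gchoose k\<close> with k > 0, hence a factor |s - t|.\<close>

lemma pabs_gchoose_lipschitz:
  assumes "pabs (s :: 'a) \<le> 1" "pabs t \<le> 1"
  shows "pabs ((s gchoose j) - (t gchoose j)) \<le> pabs (s - t) * kap ^ j"
proof -
  have "s gchoose j = (\<Sum>k=0..j. ((s - t) gchoose k) * (t gchoose (j - k)))"
    using gbinomial_Vandermonde[of "s - t" t j] by simp
  also have "\<dots> = (t gchoose j) + (\<Sum>k=1..j. ((s - t) gchoose k) * (t gchoose (j - k)))"
    by (subst sum.atLeast_Suc_atMost) auto
  finally have "(s gchoose j) - (t gchoose j) = (\<Sum>k=1..j. ((s - t) gchoose k) * (t gchoose (j - k)))"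
    by simp
  also have "pabs \<dots> \<le> pabs (s - t) * kap ^ j"
  proof (rule pabs_sum_le)
    fix k assume k: "k \<in> {1..j}"
    have st: "pabs (s - t) \<le> 1" using assms by (intro pabs_diff_le)
    have "pabs ((s - t) gchoose k) \<le> pabs (s - t) * kap ^ (k - 1)"
      using pabs_gchoose_Suc_le[OF st, of "k - 1"] k by simp
    moreover have "pabs (t gchoose (j - k)) \<le> kap ^ (j - k)"
      using pabs_gchoose_le[OF assms(2), of "j - k"] by simp
    ultimately have "pabs (((s - t) gchoose k) * (t gchoose (j - k))) \<le> pabs (s - t) * kap ^ (k - 1) * kap ^ (j - k)"
      unfolding pabs_mult using kap_gt_1 by (intro mult_mono) auto
    also have "\<dots> = pabs (s - t) * kap ^ (k - 1 + (j - k))" by (simp add: power_add)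
    also have "\<dots> \<le> pabs (s - t) * kap ^ j"
      using kap_gt_1 k by (intro mult_left_mono power_increasing) auto
    finally show "pabs (((s - t) gchoose k) * (t gchoose (j - k))) \<le> pabs (s - t) * kap ^ j" .
  qed (use kap_gt_1 in auto)
  finally show ?thesis .
qed

text \<open>Ratio of the geometric majorant of a binomial series with coefficients of size p^(-j).
  The maximum with 1 accounts for the factors t - i, where |i| can be 1.\<close>

definition rho :: "'a \<Rightarrow> real" where "rho t = max 1 (pabs t) * kap / real p"

lemma rho_pos: "rho t > 0"
  using kap_gt_1 p_ge_3 by (simp add: rho_def)

lemma rho_less_1: "t \<in> padic_disc p \<Longrightarrow> rho t < 1"
  using kap_less_p p_ge_3 by (simp add: rho_def disc_iff max_def)

lemma pabs_gchoose_mult_le: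
  assumes "pabs c \<le> C * (1 / real p) ^ j"
  shows "pabs ((t gchoose j) * c) \<le> C * rho t ^ j"
proof -
  have "pabs ((t gchoose j) * c) \<le> (max 1 (pabs t) * kap) ^ j * (C * (1 / real p) ^ j)"
    unfolding pabs_mult using assms pabs_gchoose_le[of t "max 1 (pabs t)" j] kap_gt_1
    by (intro mult_mono) auto
  also have "\<dots> = C * rho t ^ j" by (simp add: rho_def power_divide)
  finally show ?thesis .
qed

lemma gchoose_series_sums:
  fixes c :: "nat \<Rightarrow> 'a"
  assumes "t \<in> padic_disc p" "\<And>j. pabs (c j) \<le> C * (1 / real p) ^ j"
  shows "(\<lambda>j. (t gchoose j) * c j) sums (\<Sum>j. (t gchoose j) * c j)"
  using summable_padic_geometric[of "\<lambda>j. (t gchoose j) * c j", OF pabs_gchoose_mult_le[OF assms(2)]]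
    rho_pos[of t] rho_less_1[OF assms(1)]
  by (simp add: summable_sums)

lemma gchoose_series_lipschitz:
  fixes c :: "nat \<Rightarrow> 'a"
  assumes "pabs s \<le> 1" "pabs t \<le> 1" "\<And>j. pabs (c j) \<le> C * (1 / real p) ^ j"
  shows "pabs ((\<Sum>j. (s gchoose j) * c j) - (\<Sum>j. (t gchoose j) * c j)) \<le> C * pabs (s - t)"
proof (rule pabs_sums_le)
  show "(\<lambda>j. (s gchoose j) * c j - (t gchoose j) * c j) sums
      ((\<Sum>j. (s gchoose j) * c j) - (\<Sum>j. (t gchoose j) * c j))"
    using assms by (intro sums_diff_padic gchoose_series_sums disc_pabs_le_1)
next
  fix j
  have C: "C \<ge> 0" using order_trans[OF pabs_nonneg assms(3)[of 0]] by simp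
  have "pabs ((s gchoose j) * c j - (t gchoose j) * c j) = pabs ((s gchoose j) - (t gchoose j)) * pabs (c j)"
    by (simp add: algebra_simps flip: pabs_mult)
  also have "\<dots> \<le> pabs (s - t) * kap ^ j * (C * (1 / real p) ^ j)"
    using assms(3) pabs_gchoose_lipschitz[OF assms(1,2)] kap_gt_1 by (intro mult_mono) auto
  also have "\<dots> = C * pabs (s - t) * (kap / real p) ^ j" by (simp add: power_divide)
  also have "\<dots> \<le> C * pabs (s - t) * 1"
    using kap_gt_1 kap_less_p C by (intro mult_left_mono power_le_one) auto
  finally show "pabs ((s gchoose j) * c j - (t gchoose j) * c j) \<le> C * pabs (s - t)" by simp
qed

text \<open>Absorption, \<open>t gchoose Suc j\<close> = t/(j + 1) *
  (\<open>(t - 1) gchoose j\<close>), pulls a factor t out of all terms but the constant one. This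
  factor will cancel the 1/(s - 1) of the L-function at s = 1.\<close>

lemma gchoose_series_derivative:
  fixes c :: "nat \<Rightarrow> 'a"
  assumes c: "\<And>j. pabs (c j) \<le> C * (1 / real p) ^ j"
  shows "\<exists>\<phi> l. (\<forall>t. pabs t \<le> 1 \<longrightarrow> (\<Sum>j. (t gchoose j) * c j) = c 0 + t * \<phi> t) \<and> (\<phi> \<longlongrightarrow> l) (at 0)"
proof -
  define d where "d = (\<lambda>j. c (Suc j) / of_nat (Suc j))"
  define \<phi> where "\<phi> t = (\<Sum>j. ((t - 1) gchoose j) * d j)" for t
  have C: "C \<ge> 0" using order_trans[OF pabs_nonneg c[of 0]] by simp
  \<comment> \<open>A majorant of \<open>kap\<close> ^ j * |d j|: the denominator j + 1 costs a
    linear factor, which (\<open>kap\<close>/p)^j absorbs. Being null it gives convergence, being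
    bounded it gives the constant K.\<close>
  define g where "g = (\<lambda>j. C * (real (Suc j) * (kap / real p) ^ j))"
  have lim: "g \<longlonglongrightarrow> 0"
  proof -
    have norm: "norm (kap / real p) < 1" using kap_gt_1 kap_less_p by simp
    have "(\<lambda>j. of_nat j * (kap / real p) ^ j) \<longlonglongrightarrow> 0" using norm by (rule powser_times_n_limit_0)
    moreover have "(\<lambda>j. (kap / real p) ^ j) \<longlonglongrightarrow> 0" using norm by (rule LIMSEQ_power_zero)
    ultimately have "(\<lambda>j. C * (of_nat j * (kap / real p) ^ j + (kap / real p) ^ j)) \<longlonglongrightarrow> C * (0 + 0)"
      by (rule tendsto_mult[OF tendsto_const tendsto_add])
    then show ?thesis by (simp add: g_def algebra_simps)
  qed
  have d: "pabs (d j) \<le> C * real (Suc j) * (1 / real p) ^ j" for j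
  proof -
    have "pabs (d j) = pabs (c (Suc j)) * (1 / pabs (of_nat (Suc j) :: 'a))"
      by (simp add: d_def pabs_divide)
    also have "\<dots> \<le> (C * (1 / real p) ^ Suc j) * real (Suc j)"
      using c[of "Suc j"] pabs_of_nat_ge[of "Suc j"] C
      by (intro mult_mono) (auto simp: field_simps simp del: of_nat_Suc)
    also have "\<dots> \<le> (C * (1 / real p) ^ j) * real (Suc j)"
      using C p_ge_3 by (intro mult_right_mono mult_left_mono power_decreasing) auto
    finally show ?thesis by (simp add: mult_ac)
  qed
  have kd: "kap ^ j * pabs (d j) \<le> g j" for j
    using mult_left_mono[OF d[of j], of "kap ^ j"] kap_gt_1 by (simp add: g_def power_divide mult_ac)
  have sums: "(\<lambda>j. ((t - 1) gchoose j) * d j) sums \<phi> t" if "pabs t \<le> 1" for t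
  proof -
    have "pabs (t - 1) \<le> 1" using that by (intro pabs_diff_le) auto
    then have "pabs (((t - 1) gchoose j) * d j) \<le> g j" for j
      using pabs_gchoose_le[of "t - 1" 1 j] mult_right_mono[of _ "kap ^ j" "pabs (d j)"] kd[of j]
      by (fastforce simp: pabs_mult)
    then have "summable (\<lambda>j. ((t - 1) gchoose j) * d j)"
      by (intro summable_padic tendsto_sandwich[OF _ _ tendsto_const lim]) auto
    then show ?thesis unfolding \<phi>_def by (rule summable_sums)
  qed
  have eq: "(\<Sum>j. (t gchoose j) * c j) = c 0 + t * \<phi> t" if "pabs t \<le> 1" for t
  proof -
    have "(\<lambda>j. t * (((t - 1) gchoose j) * d j)) sums (t * \<phi> t)"
      using sums[OF that] by (rule sums_cmult_padic)
    moreover have "t * (((t - 1) gchoose j) * d j) = (t gchoose Suc j) * c (Suc j)" for j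
      by (simp add: d_def gbinomial_absorption' del: of_nat_Suc)
    ultimately have "(\<lambda>j. (t gchoose Suc j) * c (Suc j)) sums (t * \<phi> t)" by simp
    then show ?thesis using sums_shift_padic[of "\<lambda>j. (t gchoose j) * c j"] by (simp add: sums_unique[symmetric])
  qed
  obtain K where K: "\<And>j. g j \<le> K"
  proof -
    have "Bseq g" using lim by (intro convergent_imp_Bseq convergentI)
    then show ?thesis using that by (metis BseqE abs_le_D1 real_norm_def)
  qed
  have lip: "pabs (\<phi> t - \<phi> 0) \<le> K * pabs t" if t: "pabs t \<le> 1" for t
  proof (rule pabs_sums_le)
    show "(\<lambda>j. ((t - 1) gchoose j) * d j - ((0 - 1) gchoose j) * d j) sums (\<phi> t - \<phi> 0)"
      using t by (intro sums_diff_padic sums) auto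
  next
    fix j
    have t1: "pabs (t - 1) \<le> 1" using t by (intro pabs_diff_le) auto
    have "pabs (((t - 1) gchoose j) * d j - ((0 - 1) gchoose j) * d j) =
        pabs (((t - 1) gchoose j) - ((0 - 1) gchoose j)) * pabs (d j)"
      by (simp add: algebra_simps flip: pabs_mult)
    also have "\<dots> \<le> pabs t * kap ^ j * pabs (d j)"
      using pabs_gchoose_lipschitz[OF t1, of "0 - 1" j] by (intro mult_right_mono) auto
    also have "\<dots> \<le> pabs t * K"
      using kd[of j] K[of j] by (auto simp: mult.assoc intro!: mult_left_mono)
    finally show "pabs (((t - 1) gchoose j) * d j - ((0 - 1) gchoose j) * d j) \<le> K * pabs t"
      by (simp add: mult.commute)
  qed
  have "(\<phi> \<longlongrightarrow> \<phi> 0) (at 0)"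
  proof (rule tendsto_pabs_bound)
    show "\<forall>\<^sub>F t in at 0. pabs (\<phi> t - \<phi> 0) \<le> K * pabs t"
      using lip by (auto simp: eventually_at dist_pabs intro!: exI[of _ 1])
    have "((\<lambda>t :: 'a. pabs t) \<longlongrightarrow> pabs (0 :: 'a)) (at 0)" by (rule tendsto_pabs[OF tendsto_ident_at])
    then show "((\<lambda>t :: 'a. K * pabs t) \<longlongrightarrow> 0) (at 0)" by (intro tendsto_mult_right_zero) simp
  qed
  then show ?thesis using eq by blast
qed

subsection \<open>The power function\<close>

text \<open>The admissible bases of powers: every <a> lies here, and so does every quotient 1 + M/c
  with p dividing M but not c.\<close>

definition one_units :: "'a set" where "one_units = {x. pabs (x - 1) \<le> 1 / real p}"

lemma one_unitsD: "x \<in> one_units \<Longrightarrow> pabs ((x - 1) ^ j) \<le> 1 * (1 / real p) ^ j"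
  by (simp add: one_units_def pabs_power power_mono del: power_divide)

lemma padic_pow_sums:
  assumes "x \<in> one_units" "t \<in> padic_disc p"
  shows "(\<lambda>j. (t gchoose j) * (x - 1) ^ j) sums padic_pow x t"
  unfolding padic_pow_def using assms(2) one_unitsD[OF assms(1)] by (rule gchoose_series_sums)

lemma padic_pow_0 [simp]: "x \<in> one_units \<Longrightarrow> padic_pow x 0 = 1"
  using sums_finite[of "{0}" "\<lambda>j. (0 gchoose j) * (x - 1) ^ j"]
  by (auto simp: padic_pow_def gbinomial_0_left sums_unique[symmetric])

lemma padic_pow_1 [simp]: "x \<in> one_units \<Longrightarrow> padic_pow x 1 = x"
proof -
  have "(1 gchoose j :: 'a) = 0" if "j \<notin> {0, 1}" for j
    using that binomial_gbinomial[of 1 j, where ?'a = 'a] by (simp add: binomial_eq_0)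
  then show ?thesis
    using sums_finite[of "{0, 1}" "\<lambda>j. (1 gchoose j) * (x - 1) ^ j"]
    by (auto simp: padic_pow_def sums_unique[symmetric])
qed

lemma padic_pow_lipschitz:
  assumes "x \<in> one_units" "pabs s \<le> 1" "pabs t \<le> 1"
  shows "pabs (padic_pow x s - padic_pow x t) \<le> pabs (s - t)"
  unfolding padic_pow_def
  using gchoose_series_lipschitz[OF assms(2,3) one_unitsD[OF assms(1)]] by simp

text \<open>Each term beyond the linear one contains (x - 1)^2, and what remains of it is at most a
  power of \<open>rho t\<close> < 1. The constant depends on t only, so the error is quadratic
  uniformly in x.\<close>

lemma padic_pow_taylor:
  assumes "x \<in> one_units" "t \<in> padic_disc p"
  shows "pabs (padic_pow x t - 1 - t * (x - 1)) \<le> (max 1 (pabs t) * kap)\<^sup>2 * (pabs (x - 1))\<^sup>2"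
proof (rule pabs_lim_le)
  define u where "u = x - 1"
  let ?r = "max 1 (pabs t) * kap"
  show "(\<lambda>n. (\<Sum>j<n. (t gchoose j) * (x - 1) ^ j) - 1 - t * (x - 1)) \<longlonglongrightarrow> padic_pow x t - 1 - t * (x - 1)"
    using padic_pow_sums[OF assms] unfolding sums_def by (intro tendsto_diff_padic tendsto_const)
  fix n :: nat assume "n \<ge> 2"
  then obtain k where k: "n = Suc (Suc k)" by (metis add_2_eq_Suc le_Suc_ex)
  have "(\<Sum>j<n. (t gchoose j) * (x - 1) ^ j) - 1 - t * (x - 1) =
      (\<Sum>j<k. (t gchoose Suc (Suc j)) * u ^ Suc (Suc j))"
    unfolding k sum.lessThan_Suc_shift by (simp add: u_def)
  also have "pabs \<dots> \<le> ?r\<^sup>2 * (pabs (x - 1))\<^sup>2"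
  proof (rule pabs_sum_le)
    fix j
    have "pabs u \<le> 1 / real p" using assms(1) by (simp add: one_units_def u_def)
    then have "?r * pabs u \<le> rho t"
      unfolding rho_def using kap_gt_1 mult_left_mono[of "pabs u" "1 / real p" ?r] by simp
    then have "(?r * pabs u) ^ j \<le> 1"
      using rho_less_1[OF assms(2)] kap_gt_1 by (intro power_le_one) auto
    have "pabs ((t gchoose Suc (Suc j)) * u ^ Suc (Suc j)) \<le> ?r ^ Suc (Suc j) * pabs u ^ Suc (Suc j)"
      unfolding pabs_mult pabs_power by (intro mult_right_mono pabs_gchoose_le) auto
    also have "\<dots> = ?r\<^sup>2 * (pabs u)\<^sup>2 * (?r * pabs u) ^ j"
      by (simp add: power_mult_distrib power2_eq_square)
    also have "\<dots> \<le> ?r\<^sup>2 * (pabs u)\<^sup>2 * 1"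
      using \<open>(?r * pabs u) ^ j \<le> 1\<close> by (intro mult_left_mono) auto
    finally show "pabs ((t gchoose Suc (Suc j)) * u ^ Suc (Suc j)) \<le> ?r\<^sup>2 * (pabs (x - 1))\<^sup>2"
      by (simp add: u_def)
  qed simp
  finally show "pabs ((\<Sum>j<n. (t gchoose j) * (x - 1) ^ j) - 1 - t * (x - 1)) \<le> ?r\<^sup>2 * (pabs (x - 1))\<^sup>2" .
qed

text \<open>The linear term t (x - 1) strictly dominates, as every later term is smaller by at least
  the factor \<open>rho t\<close> < 1. The exact value, rather than a bound, is what shows that
  <2>^t = 1 forces t = 0.\<close>

lemma pabs_padic_pow_minus_1:
  assumes "x \<in> one_units" "t \<in> padic_disc p"
  shows "pabs (padic_pow x t - 1) = pabs t * pabs (x - 1)"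
proof (cases "t * (x - 1) = 0")
  case True
  moreover have "padic_pow 1 t = 1"
  proof -
    have "(\<lambda>j. (t gchoose j) * (1 - 1) ^ j) sums (\<Sum>j\<in>{0}. (t gchoose j) * (1 - 1) ^ j)"
      by (rule sums_finite) auto
    then show ?thesis by (simp add: padic_pow_def sums_unique[symmetric])
  qed
  ultimately show ?thesis using assms by auto
next
  case False
  define u where "u = x - 1"
  let ?r = "max 1 (pabs t) * kap"
  have pu: "pabs u \<le> 1 / real p" using assms(1) by (simp add: one_units_def u_def)
  then have ru: "?r * pabs u \<le> rho t"
    unfolding rho_def using kap_gt_1 mult_left_mono[of "pabs u" "1 / real p" ?r] by simp
  have "pabs (padic_pow x t - 1 - t * (x - 1)) \<le> pabs t * pabs u * rho t"
  proof (rule pabs_lim_le)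
    show "(\<lambda>n. (\<Sum>j<n. (t gchoose j) * (x - 1) ^ j) - 1 - t * (x - 1)) \<longlonglongrightarrow> padic_pow x t - 1 - t * (x - 1)"
      using padic_pow_sums[OF assms] unfolding sums_def by (intro tendsto_diff_padic tendsto_const)
    fix n :: nat assume "n \<ge> 2"
    then obtain k where k: "n = Suc (Suc k)" by (metis add_2_eq_Suc le_Suc_ex)
    have "(\<Sum>j<n. (t gchoose j) * (x - 1) ^ j) - 1 - t * (x - 1) =
        (\<Sum>j<k. (t gchoose Suc (Suc j)) * u ^ Suc (Suc j))"
      unfolding k sum.lessThan_Suc_shift by (simp add: u_def)
    also have "pabs \<dots> \<le> pabs t * pabs u * rho t"
    proof (rule pabs_sum_le)
      fix j
      have "(?r * pabs u) ^ Suc j \<le> rho t ^ Suc j"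
        using ru kap_gt_1 by (intro power_mono) auto
      also have "\<dots> \<le> rho t"
        using rho_less_1[OF assms(2)] rho_pos[of t] by (simp add: mult_left_le power_le_one)
      finally have *: "(?r * pabs u) ^ Suc j \<le> rho t" .
      have "pabs ((t gchoose Suc (Suc j)) * u ^ Suc (Suc j)) \<le> pabs t * ?r ^ Suc j * pabs u ^ Suc (Suc j)"
        unfolding pabs_mult pabs_power by (intro mult_right_mono pabs_gchoose_Suc_le) auto
      also have "\<dots> = pabs t * pabs u * (?r * pabs u) ^ Suc j"
        by (simp add: power_mult_distrib)
      also have "\<dots> \<le> pabs t * pabs u * rho t"
        using * by (intro mult_left_mono) auto
      finally show "pabs ((t gchoose Suc (Suc j)) * u ^ Suc (Suc j)) \<le> pabs t * pabs u * rho t" .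
    qed (use rho_pos[of t] in simp)
    finally show "pabs ((\<Sum>j<n. (t gchoose j) * (x - 1) ^ j) - 1 - t * (x - 1)) \<le> pabs t * pabs u * rho t" .
  qed
  also have "\<dots> < pabs (t * (x - 1))"
    using False rho_less_1[OF assms(2)] mult_strict_left_mono[of "rho t" 1 "pabs t * pabs u"]
    by (simp add: pabs_mult u_def)
  finally have "pabs (padic_pow x t - 1) = pabs (t * (x - 1))" by (rule pabs_eqI)
  then show ?thesis by (simp add: pabs_mult)
qed

lemma pabs_padic_pow_minus_1_less:
  assumes "x \<in> one_units" "t \<in> padic_disc p"
  shows "pabs (padic_pow x t - 1) < 1"
proof -
  have "pabs t * pabs (x - 1) \<le> pabs t * kap * pabs (x - 1)"
    using kap_gt_1 mult_left_mono[of 1 kap "pabs t"] by (intro mult_right_mono) auto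
  also have "\<dots> \<le> pabs t * kap * (1 / real p)"
    using assms(1) kap_gt_1 by (intro mult_left_mono) (auto simp: one_units_def)
  also have "\<dots> < 1" using assms(2) p_ge_3 by (simp add: disc_iff field_simps)
  finally show ?thesis by (simp add: pabs_padic_pow_minus_1[OF assms])
qed

lemma pabs_padic_pow: "x \<in> one_units \<Longrightarrow> t \<in> padic_disc p \<Longrightarrow> pabs (padic_pow x t) = 1"
  using pabs_eqI[of "padic_pow x t" 1] pabs_padic_pow_minus_1_less by simp

text \<open>
  Both sides of \<open>x\<^sup>t y\<^sup>t = (x y)\<^sup>t\<close> agree for natural \<open>t\<close>.  To pass to all \<open>t\<close>, the truncated series
  are expanded in the basis \<open>t gchoose k\<close>: the first coefficients of the difference vanish, as it
  has zeros at small naturals, and the other ones contribute little.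
\<close>

definition mahler :: "('a \<Rightarrow> 'a) set" where
  "mahler = {h. \<exists>d N. (\<forall>t. h t = (\<Sum>k<N. d k * (t gchoose k))) \<and>
     (\<forall>k. pabs (d k) \<le> (1 / real p) ^ k) \<and> (\<forall>k\<ge>N. d k = 0)}"

lemma mahlerI:
  assumes "\<And>t. h t = (\<Sum>k<N. d k * (t gchoose k))" "\<And>k. pabs (d k) \<le> (1 / real p) ^ k"
    "\<And>k. k \<ge> N \<Longrightarrow> d k = 0"
  shows "h \<in> mahler"
  using assms unfolding mahler_def by blast

lemma mahlerE:
  assumes "h \<in> mahler"
  obtains d N where "\<And>t M. M \<ge> N \<Longrightarrow> h t = (\<Sum>k<M. d k * (t gchoose k))"
    "\<And>k. pabs (d k) \<le> (1 / real p) ^ k" "\<And>k. k \<ge> N \<Longrightarrow> d k = 0"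
proof -
  obtain d N where d: "\<And>t. h t = (\<Sum>k<N. d k * (t gchoose k))"
    "\<And>k. pabs (d k) \<le> (1 / real p) ^ k" "\<And>k. k \<ge> N \<Longrightarrow> d k = 0"
    using assms unfolding mahler_def by blast
  have "h t = (\<Sum>k<M. d k * (t gchoose k))" if "M \<ge> N" for t M
    unfolding d(1) using that d(3) by (intro sum.mono_neutral_left) auto
  then show ?thesis using d that by blast
qed

lemma mahler_diff:
  assumes "g \<in> mahler" "h \<in> mahler"
  shows "(\<lambda>t. g t - h t) \<in> mahler"
proof -
  obtain d N where d: "\<And>t M. M \<ge> N \<Longrightarrow> g t = (\<Sum>k<M. d k * (t gchoose k))"
    "\<And>k. pabs (d k) \<le> (1 / real p) ^ k" "\<And>k. k \<ge> N \<Longrightarrow> d k = 0"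
    using mahlerE[OF assms(1)] by metis
  obtain e M where e: "\<And>t M'. M' \<ge> M \<Longrightarrow> h t = (\<Sum>k<M'. e k * (t gchoose k))"
    "\<And>k. pabs (e k) \<le> (1 / real p) ^ k" "\<And>k. k \<ge> M \<Longrightarrow> e k = 0"
    using mahlerE[OF assms(2)] by metis
  show ?thesis
  proof (rule mahlerI)
    show "g t - h t = (\<Sum>k<max N M. (d k - e k) * (t gchoose k))" for t
      by (simp add: d(1)[of "max N M"] e(1)[of "max N M"] algebra_simps sum_subtractf)
    show "pabs (d k - e k) \<le> (1 / real p) ^ k" for k using d(2) e(2) by (rule pabs_diff_le)
    show "d k - e k = 0" if "k \<ge> max N M" for k using d(3) e(3) that by simp
  qed
qed

lemma mahler_0: "(\<lambda>t. 0) \<in> mahler"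
  by (rule mahlerI[of _ "\<lambda>_. 0" 0]) auto

lemma mahler_add: "g \<in> mahler \<Longrightarrow> h \<in> mahler \<Longrightarrow> (\<lambda>t. g t + h t) \<in> mahler"
  using mahler_diff[of g "\<lambda>t. 0 - h t"] mahler_diff[OF mahler_0, of h] by simp

lemma mahler_sum: "(\<And>i. i \<in> I \<Longrightarrow> h i \<in> mahler) \<Longrightarrow> (\<lambda>t. \<Sum>i\<in>I. h i t) \<in> mahler"
  by (induction I rule: infinite_finite_induct) (simp_all add: mahler_0 mahler_add)

text \<open>Vandermonde expands \<open>t gchoose i\<close> in the binomials of t - j, and
  \<open>t gchoose j\<close> times \<open>(t - of_nat j) gchoose l\<close> is a natural multiple of
  \<open>t gchoose (j + l)\<close>. What counts is that the coefficients are natural numbers, hence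
  of absolute value at most 1.\<close>

lemma gchoose_mult:
  fixes t :: "'b :: field_char_0"
  shows "(t gchoose i) * (t gchoose j) =
    (\<Sum>l\<le>i. of_nat ((j choose (i - l)) * ((j + l) choose j)) * (t gchoose (j + l)))"
proof -
  have "t gchoose i = (\<Sum>l\<le>i. ((t - of_nat j) gchoose l) * of_nat (j choose (i - l)))"
    using gbinomial_Vandermonde[of "t - of_nat j" "of_nat j" i]
    by (simp add: atMost_atLeast0 binomial_gbinomial)
  then have "(t gchoose i) * (t gchoose j) =
      (\<Sum>l\<le>i. of_nat (j choose (i - l)) * ((t gchoose j) * ((t - of_nat j) gchoose (j + l - j))))"
    by (simp add: sum_distrib_left sum_distrib_right mult_ac)
  also have "\<dots> = (\<Sum>l\<le>i. of_nat ((j choose (i - l)) * ((j + l) choose j)) * (t gchoose (j + l)))"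
    by (intro sum.cong refl) (subst gbinomial_trinomial_revision[symmetric], auto simp: binomial_gbinomial)
  finally show ?thesis .
qed

text \<open>The product involves \<open>t gchoose k\<close> only for k <= i + j, so the bound on e
  is at least as strong as the p^(-k) that membership demands.\<close>

lemma mahler_gchoose_mult:
  assumes "pabs e \<le> (1 / real p) ^ (i + j)"
  shows "(\<lambda>t. e * ((t gchoose i) * (t gchoose j))) \<in> mahler"
proof (rule mahlerI)
  let ?c = "\<lambda>l. of_nat ((j choose (i - l)) * ((j + l) choose j)) :: 'a"
  let ?d = "\<lambda>k. if j \<le> k \<and> k \<le> i + j then e * ?c (k - j) else 0"
  show "e * ((t gchoose i) * (t gchoose j)) = (\<Sum>k<Suc (i + j). ?d k * (t gchoose k))" for t
  proof -
    have "e * ((t gchoose i) * (t gchoose j)) = (\<Sum>l\<le>i. e * ?c l * (t gchoose (j + l)))"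
      unfolding gchoose_mult by (simp only: sum_distrib_left mult.assoc)
    also have "\<dots> = (\<Sum>k\<in>{j..i + j}. ?d k * (t gchoose k))"
      by (rule sum.reindex_bij_witness[of _ "\<lambda>k. k - j" "\<lambda>l. j + l"]) auto
    also have "\<dots> = (\<Sum>k<Suc (i + j). ?d k * (t gchoose k))"
      by (rule sum.mono_neutral_left) auto
    finally show ?thesis .
  qed
  fix k
  show "pabs (?d k) \<le> (1 / real p) ^ k"
  proof (cases "j \<le> k \<and> k \<le> i + j")
    case True
    have "pabs (e * ?c (k - j)) \<le> (1 / real p) ^ (i + j) * 1"
      unfolding pabs_mult[of e] using assms by (intro mult_mono) (auto simp del: of_nat_mult)
    also have "\<dots> \<le> (1 / real p) ^ k"
      using True p_ge_3 by (simp only: mult_1_right) (intro power_decreasing, auto)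
    finally show ?thesis unfolding if_P[OF True] .
  next
    case False
    then show ?thesis by (subst if_not_P) auto
  qed
qed auto

lemma mahler_gchoose: "pabs e \<le> (1 / real p) ^ i \<Longrightarrow> (\<lambda>t. (t gchoose i) * e) \<in> mahler"
  using mahler_gchoose_mult[of e i 0] by (simp add: mult_ac)

text \<open>The values at 0, ..., J - 1 determine the first J coefficients by a triangular system,
  so these vanish. A term of index k >= J is at most \<open>rho t\<close> ^ k.\<close>

lemma mahler_zeros:
  assumes "h \<in> mahler" "\<And>m. m < J \<Longrightarrow> h (of_nat m) = 0" "t \<in> padic_disc p"
  shows "pabs (h t) \<le> rho t ^ J"
proof -
  obtain d N where d: "\<And>t M. M \<ge> N \<Longrightarrow> h t = (\<Sum>k<M. d k * (t gchoose k))"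
    "\<And>k. pabs (d k) \<le> (1 / real p) ^ k" "\<And>k. k \<ge> N \<Longrightarrow> d k = 0"
    using mahlerE[OF assms(1)] by metis
  have zero: "d k = 0" if "k < J" for k
    using that
  proof (induction k rule: less_induct)
    case (less k)
    have "0 = (\<Sum>i<N + Suc k. d i * (of_nat k gchoose i))"
      using assms(2)[OF less.prems] d(1)[of "N + Suc k"] by simp
    also have "\<dots> = (\<Sum>i\<in>{k}. d i * (of_nat k gchoose i))"
    proof (rule sum.mono_neutral_right)
      show "\<forall>i\<in>{..<N + Suc k} - {k}. d i * (of_nat k gchoose i) = 0"
      proof
        fix i assume "i \<in> {..<N + Suc k} - {k}"
        then consider "i < k" | "k < i" by force
        then show "d i * (of_nat k gchoose i) = 0"
        proof cases
          case 1
          then show ?thesis using less by simp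
        next
          case 2
          then have "(of_nat k gchoose i :: 'a) = 0"
            by (simp add: binomial_eq_0 flip: binomial_gbinomial)
          then show ?thesis by simp
        qed
      qed
    qed auto
    also have "\<dots> = d k" by (simp flip: binomial_gbinomial)
    finally show ?case by simp
  qed
  have "pabs (d k * (t gchoose k)) \<le> rho t ^ J" for k
  proof (cases "k < J")
    case True
    then show ?thesis using zero rho_pos[of t] by simp
  next
    case False
    have "pabs (d k * (t gchoose k)) \<le> 1 * rho t ^ k"
      using d(2)[of k] pabs_gchoose_mult_le[of "d k" 1 k t] by (simp add: mult.commute)
    also have "\<dots> \<le> rho t ^ J"
      using False rho_pos[of t] rho_less_1[OF assms(3)] by (simp add: power_decreasing)
    finally show ?thesis .
  qed
  then show ?thesis
    unfolding d(1)[OF order.refl] using rho_pos[of t] by (intro pabs_sum_le) auto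
qed

lemma one_units_pabs:
  assumes "x \<in> one_units"
  shows "pabs x = 1"
proof -
  have "1 / real p < 1" using p_ge_3 by simp
  then have "pabs (x - 1) < pabs (1 :: 'a)" using assms by (simp add: one_units_def)
  then show ?thesis using pabs_eqI[of x 1] by simp
qed

lemma one_units_mult: "x \<in> one_units \<Longrightarrow> y \<in> one_units \<Longrightarrow> x * y \<in> one_units"
proof -
  assume x: "x \<in> one_units" and y: "y \<in> one_units"

  have "pabs ((x - 1) * y) \<le> 1 / real p"
    using x one_units_pabs[OF y] by (simp add: one_units_def pabs_mult)
  moreover have "pabs (y - 1) \<le> 1 / real p" using y by (simp add: one_units_def)
  ultimately have "pabs ((x - 1) * y + (y - 1)) \<le> 1 / real p" by (rule pabs_add_le)
  moreover have "(x - 1) * y + (y - 1) = x * y - 1" by (simp add: algebra_simps)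
  ultimately show "x * y \<in> one_units" by (simp only: one_units_def mem_Collect_eq)
qed

lemma binomial_partial_sum:
  assumes "m < J"
  shows "(\<Sum>j<J. (of_nat m gchoose j) * (x - 1 :: 'a) ^ j) = x ^ m"
proof -
  have "x ^ m = (\<Sum>j\<le>m. of_nat (m choose j) * (x - 1) ^ j)"
    using binomial_ring[of "x - 1" 1 m] by simp
  also have "\<dots> = (\<Sum>j<J. of_nat (m choose j) * (x - 1) ^ j)"
    using assms by (intro sum.mono_neutral_left) (auto simp: binomial_eq_0)
  finally show ?thesis by (simp add: binomial_gbinomial)
qed

lemma padic_pow_mult:
  assumes "x \<in> one_units" "y \<in> one_units" "t \<in> padic_disc p"
  shows "padic_pow (x * y) t = padic_pow x t * padic_pow y t"
proof -
  let ?P = "\<lambda>x t J. \<Sum>j<J. (t gchoose j) * (x - 1) ^ j :: 'a"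
  have P: "?P z t \<longlonglongrightarrow> padic_pow z t" if "z \<in> one_units" for z
    using padic_pow_sums[OF that assms(3)] unfolding sums_def .
  have "(\<lambda>t. ?P x t J * ?P y t J - ?P (x * y) t J) \<in> mahler" for J
  proof (rule mahler_diff)
    have "(\<lambda>t. \<Sum>i<J. \<Sum>j<J. (x - 1) ^ i * (y - 1) ^ j * ((t gchoose i) * (t gchoose j))) \<in> mahler"
    proof (intro mahler_sum mahler_gchoose_mult)
      fix i j
      show "pabs ((x - 1) ^ i * (y - 1) ^ j) \<le> (1 / real p) ^ (i + j)"
        unfolding pabs_mult power_add using one_unitsD[OF assms(1)] one_unitsD[OF assms(2)]
        by (intro mult_mono) (auto simp del: power_divide)
    qed
    then show "(\<lambda>t. ?P x t J * ?P y t J) \<in> mahler"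
      by (simp add: sum_product mult_ac)
    show "(\<lambda>t. ?P (x * y) t J) \<in> mahler"
      using one_unitsD[OF one_units_mult[OF assms(1,2)]] by (intro mahler_sum mahler_gchoose) simp
  qed
  \<comment> \<open>For natural m < J the truncated series is the complete binomial expansion of
    x^m, so the law holds exactly at m.\<close>
  moreover have "?P x (of_nat m) J * ?P y (of_nat m) J - ?P (x * y) (of_nat m) J = 0" if "m < J" for m J
    using that by (simp add: binomial_partial_sum power_mult_distrib)
  ultimately have bound: "pabs (?P x t J * ?P y t J - ?P (x * y) t J) \<le> rho t ^ J" for J
    using assms(3) by (intro mahler_zeros[of "\<lambda>t. ?P x t J * ?P y t J - ?P (x * y) t J"]) auto
  have "(\<lambda>J. ?P x t J * ?P y t J - ?P (x * y) t J) \<longlonglongrightarrow> 0"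
  proof (rule tendsto_pabs_bound)
    show "\<forall>\<^sub>F J in sequentially. pabs (?P x t J * ?P y t J - ?P (x * y) t J - 0) \<le> rho t ^ J"
      using bound by simp
    show "(\<lambda>J. rho t ^ J) \<longlonglongrightarrow> 0"
      using rho_pos[of t] rho_less_1[OF assms(3)] by (intro LIMSEQ_realpow_zero) auto
  qed
  moreover have "(\<lambda>J. ?P x t J * ?P y t J - ?P (x * y) t J) \<longlonglongrightarrow>
      padic_pow x t * padic_pow y t - padic_pow (x * y) t"
    by (intro tendsto_diff_padic tendsto_mult_padic P assms one_units_mult)
  ultimately show ?thesis using LIMSEQ_unique by fastforce
qed

text \<open>A Cauchy product: by Vandermonde the truncation for s + t collects the products with i +
  j < J. The difference from the product of truncations consists of terms with i + j >= J, each at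
  most \<rho> ^ J.\<close>

lemma padic_pow_add:
  assumes "x \<in> one_units" "s \<in> padic_disc p" "t \<in> padic_disc p"
  shows "padic_pow x (s + t) = padic_pow x s * padic_pow x t"
proof -
  let ?P = "\<lambda>t J. \<Sum>j<J. (t gchoose j) * (x - 1) ^ j :: 'a"
  define \<rho> where "\<rho> = max (rho s) (rho t)"
  have \<rho>: "0 < \<rho>" "\<rho> < 1" using rho_pos rho_less_1 assms by (auto simp: \<rho>_def less_max_iff_disj)
  have P: "?P z \<longlonglongrightarrow> padic_pow x z" if "z \<in> padic_disc p" for z
    using padic_pow_sums[OF assms(1) that] unfolding sums_def .
  have bound: "pabs (?P s J * ?P t J - ?P (s + t) J) \<le> \<rho> ^ J" for J
  proof -
    let ?g = "\<lambda>i j. (s gchoose i) * (x - 1) ^ i * ((t gchoose j) * (x - 1) ^ j)"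
    have "?P (s + t) J = (\<Sum>n<J. \<Sum>i\<le>n. ?g i (n - i))"
    proof (rule sum.cong, rule refl)
      fix n
      have "((s + t) gchoose n) * (x - 1) ^ n = (\<Sum>i\<le>n. (s gchoose i) * (t gchoose (n - i)) * (x - 1) ^ n)"
        by (simp add: gbinomial_Vandermonde[of s t n, symmetric] sum_distrib_right atMost_atLeast0)
      also have "\<dots> = (\<Sum>i\<le>n. ?g i (n - i))"
      proof (rule sum.cong, rule refl)
        fix i assume "i \<in> {..n}"
        then have "(x - 1) ^ n = (x - 1) ^ i * (x - 1) ^ (n - i)" by (simp flip: power_add)
        then show "(s gchoose i) * (t gchoose (n - i)) * (x - 1) ^ n = ?g i (n - i)"
          by (simp add: mult_ac)
      qed
      finally show "((s + t) gchoose n) * (x - 1) ^ n = (\<Sum>i\<le>n. ?g i (n - i))" .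
    qed
    also have "\<dots> = (\<Sum>(i,j)\<in>{(i,j). i + j < J}. ?g i j)"
      by (rule sum.triangle_reindex[symmetric])
    finally have 1: "?P (s + t) J = (\<Sum>(i,j)\<in>{(i,j). i + j < J}. ?g i j)" .
    have 2: "?P s J * ?P t J = (\<Sum>(i,j)\<in>{..<J} \<times> {..<J}. ?g i j)"
      by (simp add: sum_product sum.cartesian_product)
    have "?P s J * ?P t J - ?P (s + t) J =
        (\<Sum>(i,j)\<in>{..<J} \<times> {..<J} - {(i,j). i + j < J}. ?g i j)"
      unfolding 1 2 by (rule sum_diff[symmetric]) auto
    also have "pabs \<dots> \<le> \<rho> ^ J"
    proof (rule pabs_sum_le)
      fix q assume "q \<in> {..<J} \<times> {..<J} - {(i,j). i + j < J}"
      then obtain i j where q: "q = (i, j)" and ij: "\<not> i + j < J" by blast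
      have "pabs ((s gchoose i) * (x - 1) ^ i) \<le> 1 * rho s ^ i" "pabs ((t gchoose j) * (x - 1) ^ j) \<le> 1 * rho t ^ j"
        using one_unitsD[OF assms(1)] by (intro pabs_gchoose_mult_le; simp)+
      then have "pabs (?g i j) \<le> rho s ^ i * rho t ^ j"
        unfolding pabs_mult[of "_ * _" "_ * _"] using rho_pos[of s] rho_pos[of t] by (intro mult_mono) auto
      also have "\<dots> \<le> \<rho> ^ i * \<rho> ^ j"
        using rho_pos[of s] rho_pos[of t] \<rho> by (intro mult_mono power_mono) (auto simp: \<rho>_def)
      also have "\<dots> \<le> \<rho> ^ J" using ij \<rho> by (simp add: power_decreasing flip: power_add)
      finally show "pabs (case q of (i, j) \<Rightarrow> ?g i j) \<le> \<rho> ^ J" by (simp add: q)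
    qed (use \<rho> in simp)
    finally show ?thesis .
  qed
  have "(\<lambda>J. ?P s J * ?P t J - ?P (s + t) J) \<longlonglongrightarrow> 0"
  proof (rule tendsto_pabs_bound)
    show "\<forall>\<^sub>F J in sequentially. pabs (?P s J * ?P t J - ?P (s + t) J - 0) \<le> \<rho> ^ J"
      using bound by simp
    show "(\<lambda>J. \<rho> ^ J) \<longlonglongrightarrow> 0"
      using \<rho> by (intro LIMSEQ_realpow_zero) auto
  qed
  moreover have "(\<lambda>J. ?P s J * ?P t J - ?P (s + t) J) \<longlonglongrightarrow>
      padic_pow x s * padic_pow x t - padic_pow x (s + t)"
    by (intro tendsto_diff_padic tendsto_mult_padic P assms disc_add)
  ultimately show ?thesis using LIMSEQ_unique by fastforce
qed

lemma padic_pow_nonzero: "x \<in> one_units \<Longrightarrow> t \<in> padic_disc p \<Longrightarrow> padic_pow x t \<noteq> 0"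
  using pabs_padic_pow by fastforce

lemma padic_pow_minus:
  assumes "x \<in> one_units" "t \<in> padic_disc p"
  shows "padic_pow x (- t) = 1 / padic_pow x t"
  using padic_pow_add[OF assms(1), of "- t" t] assms padic_pow_nonzero[OF assms]
  by (simp add: field_simps)

subsection \<open>The Teichmueller character\<close>

lemma pabs_power_diff_le:
  assumes "pabs (x :: 'a) \<le> 1" "pabs y \<le> 1"
  shows "pabs (x ^ n - y ^ n) \<le> pabs (x - y)"
proof -
  have "pabs (\<Sum>i<n. y ^ (n - Suc i) * x ^ i) \<le> 1"
    using assms by (intro pabs_sum_le) (auto simp: pabs_mult pabs_power intro!: mult_le_one power_le_one)
  then show ?thesis
    unfolding power_diff_sumr2 pabs_mult using mult_left_mono[of _ 1 "pabs (x - y)"] by simp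
qed

text \<open>Modulo x - y all n summands become x^(n - 1), so the cofactor of x - y in x^n - y^n is
  close to the derivative n x^(n - 1). For n = p that is small, for n = p - 1 and |x| = 1 it is a
  unit; both cases are used.\<close>

lemma pabs_geometric_sum_diff:
  assumes "pabs (x :: 'a) \<le> 1" "pabs y \<le> 1"
  shows "pabs ((\<Sum>i<n. y ^ (n - Suc i) * x ^ i) - of_nat n * x ^ (n - 1)) \<le> pabs (x - y)"
proof -
  have "(\<Sum>i<n. y ^ (n - Suc i) * x ^ i) - of_nat n * x ^ (n - 1) =
      (\<Sum>i<n. y ^ (n - Suc i) * x ^ i - x ^ (n - 1))"
    by (simp add: sum_subtractf)
  also have "pabs \<dots> \<le> pabs (x - y)"
  proof (rule pabs_sum_le)
    fix i assume "i \<in> {..<n}"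
    then have "x ^ (n - 1) = x ^ (n - Suc i) * x ^ i" by (simp flip: power_add)
    then have "y ^ (n - Suc i) * x ^ i - x ^ (n - 1) = (y ^ (n - Suc i) - x ^ (n - Suc i)) * x ^ i"
      by (simp add: algebra_simps)
    moreover have "pabs (x ^ i) \<le> 1" using assms by (simp add: pabs_power power_le_one)
    ultimately show "pabs (y ^ (n - Suc i) * x ^ i - x ^ (n - 1)) \<le> pabs (x - y)"
      using pabs_power_diff_le[OF assms(2,1), of "n - Suc i"]
        mult_mono[of "pabs (y ^ (n - Suc i) - x ^ (n - Suc i))" "pabs (y - x)" "pabs (x ^ i)" 1]
      by (simp add: pabs_mult pabs_minus_commute)
  qed simp
  finally show ?thesis .
qed

text \<open>The p-th power map contracts: the cofactor of x - y is p x^(p - 1) up to |x - y|, so it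
  is at most 1/p.\<close>

lemma pabs_power_p_diff_le:
  assumes "pabs (x :: 'a) \<le> 1" "pabs y \<le> 1" "pabs (x - y) \<le> 1 / real p"
  shows "pabs (x ^ p - y ^ p) \<le> pabs (x - y) / real p"
proof -
  let ?S = "\<Sum>i<p. y ^ (p - Suc i) * x ^ i"
  have "pabs (of_nat p * x ^ (p - 1)) \<le> 1 / real p"
    using assms power_le_one[of "pabs x" "p - 1"] p_ge_3
    by (simp add: pabs_mult pabs_power pabs_p field_simps)
  moreover have "pabs (?S - of_nat p * x ^ (p - 1)) \<le> 1 / real p"
    using pabs_geometric_sum_diff[OF assms(1,2), of p] assms(3) by linarith
  ultimately have "pabs ?S \<le> 1 / real p"
    using pabs_add_le[of "?S - of_nat p * x ^ (p - 1)" "1 / real p" "of_nat p * x ^ (p - 1)"] by simp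
  then show ?thesis
    unfolding power_diff_sumr2 pabs_mult using mult_left_mono[of "pabs ?S" "1 / real p" "pabs (x - y)"] by simp
qed

lemma pabs_root_of_unity: "(w :: 'a) ^ (p - 1) = 1 \<Longrightarrow> pabs w = 1"
proof -
  assume "w ^ (p - 1) = 1"
  then have "pabs w ^ (p - 1) = 1" by (simp flip: pabs_power)
  then show ?thesis using p_ge_3 power_eq_imp_eq_base[of "pabs w" "p - 1" 1] by simp
qed

text \<open>If v and w differed, the cofactor of v - w in v^(p-1) - w^(p-1) = 0 would vanish. But it
  has distance less than 1 from (p - 1) v^(p - 2), which has absolute value 1.\<close>

lemma root_of_unity_unique:
  assumes "(v :: 'a) ^ (p - 1) = 1" "w ^ (p - 1) = 1" "pabs (v - w) < 1"
  shows "v = w"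
proof (rule ccontr)
  assume "v \<noteq> w"
  let ?S = "\<Sum>i<p - 1. w ^ (p - 1 - Suc i) * v ^ i"
  have "(v - w) * ?S = 0"
    using power_diff_sumr2[of v "p - 1" w] assms by simp
  then have "?S = 0" using \<open>v \<noteq> w\<close> by simp
  have "\<not> p dvd p - 1" using p_ge_3 dvd_imp_le[of p "p - 1"] by auto
  then have "pabs (of_nat (p - 1) :: 'a) = 1" by (rule pabs_of_nat_unit)
  then have "pabs (of_nat (p - 1) * v ^ (p - 1 - 1)) = 1"
    using pabs_root_of_unity[OF assms(1)] by (simp add: pabs_mult pabs_power)
  moreover have "pabs (?S - of_nat (p - 1) * v ^ (p - 1 - 1)) \<le> pabs (v - w)"
    using assms pabs_root_of_unity by (intro pabs_geometric_sum_diff) auto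
  ultimately show False using assms(3) \<open>?S = 0\<close> by simp
qed

lemma padic_ints_pabs_le_1: "(z :: 'a) \<in> padic_ints \<Longrightarrow> pabs z \<le> 1"
proof -
  assume "z \<in> padic_ints"
  then obtain X where X: "\<And>n. X n \<in> (\<int> :: 'a set)" "X \<longlonglongrightarrow> z"
    unfolding padic_ints_def closure_sequential by blast
  have "pabs (X n) \<le> 1" for n using X(1)[of n] by (auto elim: Ints_cases)
  then show ?thesis using pabs_lim_le[OF X(2)] by blast
qed

text \<open>The root is the limit w of a^(p^n). Fermat makes the first difference divisible by p,
  the contraction of p-th powers makes the later ones shrink, and the limit satisfies w^p =
  w.\<close>

lemma teich_exists:
  assumes "\<not> int p dvd a"
  shows "\<exists>w :: 'a. w \<in> padic_ints \<and> w ^ (p - 1) = 1 \<and>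
    (\<exists>z \<in> padic_ints. w - of_int a = of_nat p * z)"
proof -
  define X :: "nat \<Rightarrow> 'a" where "X n = of_int (a ^ p ^ n)" for n
  have fermat: "[b ^ p = b] (mod int p)" for b :: int
  proof (cases "int p dvd b")
    case True
    then have "int p dvd b ^ p" using p_ge_3 dvd_trans[OF True dvd_power[of p b]] by simp
    then show ?thesis using True by (simp add: cong_iff_dvd_diff)
  next
    case False
    obtain c where c: "b = int c \<or> b = - int c" by (metis int_cases2)
    then have "\<not> p dvd c" using False by auto
    then have "[c ^ (p - 1) = 1] (mod p)" using prime_p by (intro fermat_theorem)
    then have "[c ^ (p - 1) * c = 1 * c] (mod p)" by (rule cong_scalar_right)
    then have "[int c ^ p = int c] (mod int p)"
      using p_ge_3 by (simp add: cong_int_iff[symmetric] mult.commute flip: power_Suc)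
    then show ?thesis
      using c odd_p by (auto simp: cong_minus_minus_iff)
  qed
  have cong: "[a ^ p ^ n = a] (mod int p)" for n
  proof (induction n)
    case (Suc n)
    have "[(a ^ p ^ n) ^ p = a ^ p ^ n] (mod int p)" by (rule fermat)
    then have "[(a ^ p ^ n) ^ p = a] (mod int p)" using Suc.IH by (rule cong_trans)
    then show ?case by (simp add: power_mult[symmetric] mult.commute)
  qed simp
  have step: "pabs (X (Suc n) - X n) \<le> (1 / real p) ^ Suc n" for n
  proof (induction n)
    case 0
    have "int p dvd a ^ p - a" using fermat[of a] by (simp add: cong_iff_dvd_diff)
    then show ?case using pabs_of_int_dvd[of "a ^ p - a"] by (simp add: X_def)
  next
    case (Suc n)
    have X: "X (Suc k) = X k ^ p" for k by (simp add: X_def power_mult[symmetric] mult.commute)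
    have "(1 / real p) ^ Suc n \<le> (1 / real p) ^ 1" using p_ge_3 by (intro power_decreasing) auto
    then have "pabs (X (Suc n) - X n) \<le> 1 / real p" using Suc by simp
    then have "pabs (X (Suc n) ^ p - X n ^ p) \<le> pabs (X (Suc n) - X n) / real p"
      by (intro pabs_power_p_diff_le) (auto simp: X_def simp del: of_int_power)
    also have "\<dots> \<le> (1 / real p) ^ Suc n / real p" using Suc by (intro divide_right_mono) auto
    finally show ?case by (simp add: X[symmetric])
  qed
  have "convergent X"
  proof (rule convergent_padic, rule tendsto_sandwich[OF _ _ tendsto_const])
    show "(\<lambda>n. (1 / real p) ^ Suc n) \<longlonglongrightarrow> 0"
      using p_ge_3 by (intro LIMSEQ_Suc LIMSEQ_realpow_zero) auto
  qed (use step in auto)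
  then obtain w where w: "X \<longlonglongrightarrow> w" unfolding convergent_def by blast
  have "(\<lambda>n. X n ^ k) \<longlonglongrightarrow> w ^ k" for k
    by (induction k) (simp_all add: tendsto_mult_padic w)
  then have "(\<lambda>n. X (Suc n)) \<longlonglongrightarrow> w ^ p"
    by (simp add: X_def power_mult[symmetric] mult.commute flip: of_int_power)
  then have "w ^ p = w" using LIMSEQ_Suc[OF w] LIMSEQ_unique by blast
  have "\<exists>k. a ^ p ^ n - a = int p * k" for n
    using cong[of n] by (simp add: cong_iff_dvd_diff dvd_def)
  \<comment> \<open>The integer quotients k n converge to (w - a)/p, which puts it into the closure
    of the integers, as the definition of \<open>teich\<close> demands.\<close>
  then obtain k where k: "\<And>n. a ^ p ^ n - a = int p * k n" by metis
  have z: "(\<lambda>n. of_int (k n)) \<longlonglongrightarrow> (w - of_int a) / of_nat p"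
  proof -
    have "(\<lambda>n. 1 / of_nat p * (X n - of_int a)) \<longlonglongrightarrow> 1 / of_nat p * (w - of_int a)"
      by (intro tendsto_cmult_padic tendsto_diff_padic w tendsto_const)
    moreover have "X n - of_int a = of_nat p * of_int (k n)" for n
    proof -
      have "X n - of_int a = of_int (int p * k n)" unfolding X_def k[symmetric] of_int_diff ..
      then show ?thesis by simp
    qed
    ultimately show ?thesis using p_ge_3 by simp
  qed
  have lim_int: "l \<in> padic_ints" if "(\<lambda>n. of_int (b n)) \<longlonglongrightarrow> l" for b and l :: 'a
    unfolding padic_ints_def closure_sequential using that by (intro exI[of _ "\<lambda>n. of_int (b n)"]) simp
  have ints: "w \<in> padic_ints" "(w - of_int a) / of_nat p \<in> padic_ints"
    using lim_int[of "\<lambda>n. a ^ p ^ n" w] lim_int[OF z] w by (simp_all only: X_def[abs_def])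
  have wa: "w - of_int a = of_nat p * ((w - of_int a) / of_nat p)" using p_ge_3 by simp
  have "pabs (w - of_int a) \<le> 1 / real p"
    by (subst wa) (use padic_ints_pabs_le_1[OF ints(2)] p_ge_3 in \<open>simp only: pabs_mult pabs_p, simp add: field_simps\<close>)
  \<comment> \<open>|w - a| < 1 = |a| keeps w away from 0, so that a factor w can be cancelled in
    w^p = w.\<close>
  then have "w \<noteq> 0" using pabs_of_int_unit[OF assms] p_ge_3 by auto
  moreover have "w * w ^ (p - 1) = w" using \<open>w ^ p = w\<close> p_ge_3 by (simp flip: power_Suc)
  ultimately have "w ^ (p - 1) = 1" by simp
  then show ?thesis using ints wa by blast
qed

lemma teich:
  assumes "\<not> int p dvd a"
  shows "(teich p a :: 'a) ^ (p - 1) = 1" "pabs (teich p a - of_int a :: 'a) \<le> 1 / real p"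
proof -
  let ?P = "\<lambda>w :: 'a. w \<in> padic_ints \<and> w ^ (p - 1) = 1 \<and> (\<exists>z \<in> padic_ints. w - of_int a = of_nat p * z)"
  have bound: "pabs (w - of_int a) \<le> 1 / real p" if Pw: "?P w" for w
  proof -
    obtain z where "z \<in> padic_ints" "w - of_int a = of_nat p * z" using Pw by blast
    then show ?thesis
      using padic_ints_pabs_le_1[of z] p_ge_3 by (simp add: pabs_mult pabs_p field_simps)
  qed
  have p1: "1 / real p < 1" using p_ge_3 by simp
  obtain w where w: "?P w" using teich_exists[OF assms] by blast
  have "v = w" if "?P v" for v
  proof (rule root_of_unity_unique)
    have "pabs ((v - of_int a) - (w - of_int a)) \<le> 1 / real p"
      using bound[OF that] bound[OF w] by (rule pabs_diff_le)
    then show "pabs (v - w) < 1" using p1 by simp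
  qed (use that w in auto)
  then have "?P (THE w. ?P w)" using w by (intro theI[of ?P w])
  then have "?P (teich p a)" using assms by (simp add: teich_def)
  then show "(teich p a :: 'a) ^ (p - 1) = 1" "pabs (teich p a - of_int a :: 'a) \<le> 1 / real p"
    using bound by blast+
qed

lemma pabs_teich: "\<not> int p dvd a \<Longrightarrow> pabs (teich p a :: 'a) = 1"
  using teich(1) by (rule pabs_root_of_unity)

lemma teich_nonzero: "\<not> int p dvd a \<Longrightarrow> (teich p a :: 'a) \<noteq> 0"
  using pabs_teich[of a] by auto

text \<open>Close to a there is only one (p - 1)-st root of unity, so closeness can replace the
  membership in \<open>padic_ints\<close> of the definition.\<close>

lemma teich_eqI:
  assumes "\<not> int p dvd a" "w ^ (p - 1) = 1" "pabs (w - of_int a :: 'a) \<le> 1 / real p"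
  shows "teich p a = w"
proof (rule root_of_unity_unique)
  have "pabs ((teich p a - of_int a) - (w - of_int a)) \<le> 1 / real p"
    using teich(2)[OF assms(1)] assms(3) by (rule pabs_diff_le)
  moreover have "1 / real p < 1" using p_ge_3 by simp
  ultimately show "pabs (teich p a - w) < 1" by simp
qed (use assms teich in auto)

lemma not_p_dvd_mult: "\<not> int p dvd a \<Longrightarrow> \<not> int p dvd b \<Longrightarrow> \<not> int p dvd a * b"
  using prime_p by (simp add: prime_dvd_mult_iff)

lemma teich_mult:
  assumes "\<not> int p dvd a" "\<not> int p dvd b"
  shows "teich p (a * b) = (teich p a * teich p b :: 'a)"
proof (rule teich_eqI)
  have "teich p a * teich p b - of_int (a * b) =
      (teich p a - of_int a) * teich p b + of_int a * (teich p b - of_int b :: 'a)"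
    by (simp add: algebra_simps)
  also have "pabs \<dots> \<le> 1 / real p"
    using teich(2)[OF assms(1)] teich(2)[OF assms(2)] assms
    by (intro pabs_add_le) (simp_all add: pabs_mult pabs_teich pabs_of_int_unit)
  finally show "pabs (teich p a * teich p b - of_int (a * b) :: 'a) \<le> 1 / real p" .
qed (use assms teich(1) not_p_dvd_mult in \<open>auto simp: power_mult_distrib\<close>)

lemma teich_cong:
  assumes "[a = b] (mod int p)"
  shows "teich p a = (teich p b :: 'a)"
proof (cases "int p dvd b")
  case True
  then have "int p dvd a" using assms cong_dvd_iff by blast
  then show ?thesis using True by (simp add: teich_def)
next
  case False
  then have "\<not> int p dvd a" using assms cong_dvd_iff by blast
  then show ?thesis
  proof (rule teich_eqI)
    have "pabs (of_int (b - a) :: 'a) \<le> 1 / real p"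
      using assms by (intro pabs_of_int_dvd) (simp add: cong_iff_dvd_diff dvd_diff_commute)
    then have "pabs ((teich p b - of_int b) + of_int (b - a) :: 'a) \<le> 1 / real p"
      using teich(2)[OF False] by (intro pabs_add_le)
    then show "pabs (teich p b - of_int a :: 'a) \<le> 1 / real p" by simp
  qed (use teich(1)[OF False] in simp)
qed

lemma of_int_nonzero: "\<not> int p dvd a \<Longrightarrow> of_int a \<noteq> (0 :: 'a)"
  by auto

lemma angle_one_units:
  assumes "\<not> int p dvd a"
  shows "angle p a \<in> one_units"
proof -
  have "(angle p a :: 'a) - 1 = (of_int a - teich p a) / teich p a"
    using teich_nonzero[OF assms] by (simp add: angle_def field_simps)
  then show ?thesis
    using teich(2)[OF assms] by (simp add: one_units_def pabs_divide pabs_teich[OF assms] pabs_minus_commute)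
qed

lemma angle_mult:
  "\<not> int p dvd a \<Longrightarrow> \<not> int p dvd b \<Longrightarrow> angle p (a * b) = (angle p a * angle p b :: 'a)"
  by (simp add: angle_def teich_mult)

lemma one_units_add_divide:
  assumes "\<not> int p dvd a" "int p dvd N"
  shows "1 + of_int N / of_int a \<in> one_units"
  using pabs_of_int_dvd[OF assms(2)] pabs_of_int_unit[OF assms(1)]
  by (simp add: one_units_def pabs_divide)

lemma angle_add:
  assumes "\<not> int p dvd a" "int p dvd N"
  shows "angle p (a + N) = (angle p a * (1 + of_int N / of_int a) :: 'a)"
proof -
  have "teich p (a + N) = (teich p a :: 'a)"
    using assms(2) by (intro teich_cong) (simp add: cong_iff_dvd_diff)
  then show ?thesis using of_int_nonzero[OF assms(1)] teich_nonzero[OF assms(1)]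
    by (simp add: angle_def field_simps)
qed

lemma not_p_dvd_2: "\<not> int p dvd 2"
  using p_ge_3 zdvd_imp_le[of "int p" 2] by auto

text \<open>Otherwise 2 would be its own Teichmueller representative, and 2^(p - 1) = 1 would hold
  in characteristic 0.\<close>

lemma angle_2_neq_1: "angle p 2 \<noteq> (1 :: 'a)"
proof
  assume "angle p 2 = (1 :: 'a)"
  then have "teich p 2 = (2 :: 'a)"
    using teich_nonzero[OF not_p_dvd_2] by (simp add: angle_def)
  then have "(2 :: 'a) ^ (p - 1) = 1" using teich(1)[OF not_p_dvd_2] by simp
  then have "(of_nat (2 ^ (p - 1)) :: 'a) = of_nat 1" by simp
  then have "(2 :: nat) ^ (p - 1) = 1" by (simp only: of_nat_eq_iff)
  then show False using p_ge_3 by simp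
qed

text \<open>If the factor vanishes, \<zeta> has distance less than 1 from 1, because <2>^t has; so
  \<zeta> = 1, as roots of unity are separated. Then |t| |<2> - 1| = |<2>^t - 1| = 0 gives t =
  0.\<close>

lemma euler_factor_nonzero:
  assumes "\<zeta> ^ (p - 1) = (1 :: 'a)" "t \<in> padic_disc p" "t \<noteq> 0 \<or> \<zeta> \<noteq> 1"
  shows "1 - \<zeta> * padic_pow (angle p 2) t \<noteq> 0"
proof
  assume zero: "1 - \<zeta> * padic_pow (angle p 2) t = 0"
  let ?x = "padic_pow (angle p 2) t"
  note u = angle_one_units[OF not_p_dvd_2]
  have "pabs \<zeta> = 1" using assms(1) by (rule pabs_root_of_unity)
  have "\<zeta> - 1 = \<zeta> * (1 - ?x)" using zero by (simp add: algebra_simps)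
  then have "pabs (\<zeta> - 1) = pabs (?x - 1)"
    using \<open>pabs \<zeta> = 1\<close> by (simp add: pabs_mult pabs_minus_commute)
  then have "pabs (\<zeta> - 1) < 1" using pabs_padic_pow_minus_1_less[OF u assms(2)] by simp
  then have "\<zeta> = 1" using root_of_unity_unique[OF assms(1), of 1] by simp
  then have "pabs t * pabs (angle p 2 - 1 :: 'a) = 0"
    using zero pabs_padic_pow_minus_1[OF u assms(2)] by simp
  then show False using assms(3) \<open>\<zeta> = 1\<close> angle_2_neq_1 by simp
qed

end

subsection \<open>Bernoulli numbers and power sums\<close>

lemma bernoulli_fps: "fps_X / (fps_exp 1 - 1) * (fps_exp 1 - 1) = (fps_X :: rat fps)"
proof -
  have "subdegree (fps_exp 1 - 1 :: rat fps) = 1"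
    by (rule subdegreeI) auto
  then have "(fps_exp 1 - 1 :: rat fps) dvd fps_X"
    by (simp add: fps_dvd_iff)
  then show ?thesis by simp
qed

lemma fps_exp_sum_telescope:
  "(\<Sum>x<M. fps_exp (of_nat x)) * (fps_exp 1 - 1) = (fps_exp (of_nat M) - 1 :: rat fps)"
proof (induction M)
  case (Suc M)
  have "fps_exp (of_nat (Suc M)) = fps_exp (of_nat M) * (fps_exp 1 :: rat fps)"
    by (simp add: fps_exp_add_mult mult.commute)
  then show ?case using Suc by (simp add: algebra_simps del: of_nat_Suc)
qed simp

text \<open>Faulhaber's formula: compare the coefficients of X^(j + 1) in X * (sum of e^(xX) over x
  < M) = X/(e^X - 1) * (e^(MX) - 1).\<close>

lemma power_sum_bernoulli_rat:
  "(\<Sum>x<M. of_nat x ^ j) =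
    (\<Sum>k\<le>j. of_nat (j choose k) * bernoulli (j - k) * (of_nat M ^ Suc k / of_nat (Suc k)))"
proof -
  let ?b = "fps_X / (fps_exp 1 - 1) :: rat fps"
  let ?S = "\<Sum>x<M. fps_exp (of_nat x) :: rat fps"
  have "fps_X * ?S = ?b * (fps_exp 1 - 1) * ?S" by (simp only: bernoulli_fps)
  also have "\<dots> = ?b * (?S * (fps_exp 1 - 1))" by (simp add: mult_ac)
  finally have "fps_X * ?S = ?b * (fps_exp (of_nat M) - 1)" unfolding fps_exp_sum_telescope .
  then have "fps_nth ?S j = fps_nth (?b * (fps_exp (of_nat M) - 1)) (Suc j)"
    by (metis fps_X_mult_nth diff_Suc_1 nat.distinct(1))
  also have "\<dots> = (\<Sum>i\<le>j. fps_nth ?b i * (of_nat M ^ (Suc j - i) / fact (Suc j - i)))"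
    by (simp add: fps_mult_nth atMost_atLeast0 fps_exp_def)
  also have "\<dots> = (\<Sum>k\<le>j. fps_nth ?b (j - k) * (of_nat M ^ (Suc k) / fact (Suc k)))"
    by (rule sum.reindex_bij_witness[of _ "\<lambda>k. j - k" "\<lambda>k. j - k"]) (auto simp: Suc_diff_le)
  finally have "(\<Sum>x<M. of_nat x ^ j) / fact j =
      (\<Sum>k\<le>j. fps_nth ?b (j - k) * (of_nat M ^ (Suc k) / fact (Suc k)))"
    by (simp add: fps_sum_nth sum_divide_distrib)
  then have "(\<Sum>x<M. of_nat x ^ j) =
      (\<Sum>k\<le>j. fps_nth ?b (j - k) * (of_nat M ^ (Suc k) / fact (Suc k))) * fact j"
    by (simp add: field_simps)
  also have "\<dots> = (\<Sum>k\<le>j. of_nat (j choose k) * bernoulli (j - k) * (of_nat M ^ Suc k / of_nat (Suc k)))"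
    unfolding sum_distrib_right
  proof (rule sum.cong, rule refl)
    fix k assume "k \<in> {..j}"
    then have "of_nat (j choose k) = (fact j / (fact k * fact (j - k)) :: rat)"
      by (simp add: binomial_fact)
    moreover have "bernoulli (j - k) = fact (j - k) * fps_nth ?b (j - k)"
      by (simp add: bernoulli_def)
    ultimately show "fps_nth ?b (j - k) * (of_nat M ^ Suc k / fact (Suc k)) * fact j =
        of_nat (j choose k) * bernoulli (j - k) * (of_nat M ^ Suc k / of_nat (Suc k))"
      by (simp add: field_simps del: of_nat_Suc)
  qed
  finally show ?thesis .
qed

lemma bernoulli_0: "bernoulli 0 = 1"
  using power_sum_bernoulli_rat[of 0 1] by simp

lemma power_sum_bernoulli:
  "(\<Sum>x<M. of_nat x ^ j :: 'a :: field_char_0) =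
    (\<Sum>k\<le>j. of_nat (j choose k) * of_rat (bernoulli (j - k)) * (of_nat M ^ Suc k / of_nat (Suc k)))"
proof -
  have "(\<Sum>x<M. of_nat x ^ j :: 'a) = of_rat (\<Sum>x<M. of_nat x ^ j)"
    by (simp add: of_rat_sum of_rat_power)
  then show ?thesis
    unfolding power_sum_bernoulli_rat
    by (simp add: of_rat_sum of_rat_mult of_rat_divide of_rat_power del: of_nat_Suc power_Suc)
qed

context padic_field
begin

text \<open>From |1/(k + 1)| <= k + 1 <= 2^k <= 2 p^(k - 1): all factors x but one absorb the
  denominator, and the constant 2 is left over.\<close>

lemma pabs_power_divide_Suc_le:
  assumes "pabs (x :: 'a) \<le> (1 / real p) ^ n" "n \<ge> 1" "k \<ge> 1"
  shows "pabs (x ^ k / of_nat (Suc k)) \<le> 2 * (1 / real p) ^ n"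
proof -
  have "real (Suc k) \<le> 2 * real p ^ (k - 1)"
  proof -
    have "Suc k \<le> 2 ^ k" by (simp add: Suc_leI)
    also have "\<dots> = 2 * 2 ^ (k - 1)" using assms(3) by (simp flip: power_Suc)
    also have "\<dots> \<le> 2 * p ^ (k - 1)" using p_ge_3 by (simp add: power_mono)
    finally show ?thesis by (metis of_nat_le_iff of_nat_mult of_nat_numeral of_nat_power)
  qed
  also have "\<dots> \<le> 2 * real p ^ (n * (k - 1))"
    using p_ge_3 assms(2) by (intro mult_left_mono power_increasing) auto
  finally have *: "real (Suc k) * (1 / real p) ^ (n * (k - 1)) \<le> 2"
    using p_ge_3 by (simp add: field_simps power_divide)
  have "pabs (x ^ k / of_nat (Suc k)) = pabs x ^ k * (1 / pabs (of_nat (Suc k) :: 'a))"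
    by (simp add: pabs_divide pabs_power)
  also have "\<dots> \<le> ((1 / real p) ^ n) ^ k * real (Suc k)"
    using assms(1) pabs_of_nat_ge[of "Suc k"]
    by (intro mult_mono power_mono) (auto simp: field_simps simp del: of_nat_Suc power_divide)
  also have "((1 / real p) ^ n) ^ k = (1 / real p) ^ n * (1 / real p) ^ (n * (k - 1))"
    using assms(3) by (cases k) (simp_all add: power_mult[symmetric] power_add[symmetric])
  also have "\<dots> * real (Suc k) = (1 / real p) ^ n * (real (Suc k) * (1 / real p) ^ (n * (k - 1)))"
    by (simp add: mult_ac)
  also have "\<dots> \<le> (1 / real p) ^ n * 2"
    using * by (intro mult_left_mono) auto
  finally show ?thesis by (simp add: mult.commute)
qed

lemma power_sum_bernoulli_split:
  assumes "M > 0"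
  shows "(\<Sum>x<M. of_nat x ^ j :: 'a) / of_nat M = of_rat (bernoulli j) +
    (\<Sum>k=1..j. of_nat (j choose k) * of_rat (bernoulli (j - k)) * (of_nat M ^ k / of_nat (Suc k)))"
proof -
  have "(\<Sum>x<M. of_nat x ^ j :: 'a) / of_nat M =
      (\<Sum>k\<le>j. of_nat (j choose k) * of_rat (bernoulli (j - k)) * (of_nat M ^ k / of_nat (Suc k)))"
    unfolding power_sum_bernoulli using assms
    by (simp add: sum_divide_distrib field_simps del: of_nat_Suc)
  also have "\<dots> = of_rat (bernoulli j) +
    (\<Sum>k=1..j. of_nat (j choose k) * of_rat (bernoulli (j - k)) * (of_nat M ^ k / of_nat (Suc k)))"
    unfolding atMost_atLeast0 by (subst sum.atLeast_Suc_atMost) auto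
  finally show ?thesis .
qed

text \<open>The easy part of von Staudt-Clausen: p B_j is p-integral. Faulhaber with M = p expresses
  B_j by an integer divided by p and by earlier Bernoulli numbers, whose coefficients p^k/(k + 1)
  have absolute value at most 2/p < 1, up to integers.\<close>

lemma pabs_bernoulli: "pabs (of_rat (bernoulli j) :: 'a) \<le> real p"
proof (induction j rule: less_induct)
  case (less j)
  let ?f = "\<lambda>k. of_nat (j choose k) * of_rat (bernoulli (j - k)) * (of_nat p ^ k / of_nat (Suc k)) :: 'a"
  have p3: "real p \<ge> 3" using p_ge_3 by simp
  have "pabs (\<Sum>k=1..j. ?f k) \<le> real p"
  proof (rule pabs_sum_le)
    fix k assume k: "k \<in> {1..j}"
    then have IH: "pabs (of_rat (bernoulli (j - k)) :: 'a) \<le> real p" using less by simp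
    have "pabs (of_nat p ^ k / of_nat (Suc k) :: 'a) \<le> 2 * (1 / real p) ^ 1"
      using k by (intro pabs_power_divide_Suc_le) (auto simp: pabs_p)
    also have "\<dots> \<le> 1" using p3 by simp
    finally have "pabs (?f k) \<le> 1 * real p * 1"
      unfolding pabs_mult using IH p3 by (intro mult_mono) auto
    then show "pabs (?f k) \<le> real p" by simp
  qed simp
  moreover have "pabs ((\<Sum>x<p. of_nat x ^ j :: 'a) / of_nat p) \<le> real p"
  proof -
    have "pabs (\<Sum>x<p. of_nat x ^ j :: 'a) \<le> 1"
      by (intro pabs_sum_le) (simp_all add: pabs_power power_le_one)
    then have "pabs (\<Sum>x<p. of_nat x ^ j :: 'a) * real p \<le> 1 * real p" by (intro mult_right_mono) auto
    then show ?thesis by (simp add: pabs_divide pabs_p)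
  qed
  moreover have "of_rat (bernoulli j) = (\<Sum>x<p. of_nat x ^ j :: 'a) / of_nat p - (\<Sum>k=1..j. ?f k)"
    using power_sum_bernoulli_split[of p j] p_ge_3 by simp
  ultimately show ?case by (simp add: pabs_diff_le)
qed

text \<open>The bound is uniform in j, which lets the limit be taken under the binomial
  series.\<close>

lemma power_sum_mean_bernoulli:
  assumes "n \<ge> 1"
  shows "pabs ((\<Sum>x<p ^ n. of_nat x ^ j :: 'a) / of_nat (p ^ n) - of_rat (bernoulli j)) \<le> 2 * real p * (1 / real p) ^ n"
proof -
  let ?f = "\<lambda>k. of_nat (j choose k) * of_rat (bernoulli (j - k)) * (of_nat (p ^ n) ^ k / of_nat (Suc k)) :: 'a"
  have "(\<Sum>x<p ^ n. of_nat x ^ j :: 'a) / of_nat (p ^ n) - of_rat (bernoulli j) = (\<Sum>k=1..j. ?f k)"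
    using power_sum_bernoulli_split[of "p ^ n" j] p_ge_3 by simp
  also have "pabs \<dots> \<le> 2 * real p * (1 / real p) ^ n"
  proof (rule pabs_sum_le)
    fix k assume k: "k \<in> {1..j}"
    have "pabs (of_nat (p ^ n) ^ k / of_nat (Suc k) :: 'a) \<le> 2 * (1 / real p) ^ n"
      using k assms by (intro pabs_power_divide_Suc_le) (auto simp: pabs_power pabs_p)
    then have "pabs (?f k) \<le> 1 * real p * (2 * (1 / real p) ^ n)"
      unfolding pabs_mult using pabs_bernoulli[of "j - k"] by (intro mult_mono) auto
    then show "pabs (?f k) \<le> 2 * real p * (1 / real p) ^ n" by simp
  qed simp
  finally show ?thesis .
qed

text \<open>For y = F/a this is the inner series of the L-function formula. It is the Volkenborn
  integral over x of (1 + x y)^t, as x^j has the integral B_j.\<close>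

definition bernoulli_series :: "'a \<Rightarrow> 'a \<Rightarrow> 'a" where
  "bernoulli_series t y = (\<Sum>j. (t gchoose j) * y ^ j * of_rat (bernoulli j))"

lemma bernoulli_series_coeff:
  assumes "pabs (y :: 'a) \<le> 1 / real p"
  shows "pabs (y ^ j * of_rat (bernoulli j)) \<le> real p * (1 / real p) ^ j"
proof -
  have "pabs y ^ j * pabs (of_rat (bernoulli j) :: 'a) \<le> (1 / real p) ^ j * real p"
    using assms pabs_bernoulli by (intro mult_mono power_mono) auto
  then show ?thesis by (simp add: pabs_mult pabs_power mult.commute)
qed

lemma volkenborn_padic_pow:
  assumes "t \<in> padic_disc p" "pabs y \<le> 1 / real p" "n \<ge> 1"
  shows "pabs ((\<Sum>x<p ^ n. padic_pow (1 + of_nat x * y) t) / of_nat (p ^ n) - bernoulli_series t y)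
    \<le> 2 * real p * (1 / real p) ^ n"
proof (rule pabs_sums_le)
  let ?e = "\<lambda>j. (\<Sum>x<p ^ n. of_nat x ^ j :: 'a) / of_nat (p ^ n) - of_rat (bernoulli j)"
  have "(\<lambda>j. (t gchoose j) * (of_nat x * y) ^ j) sums padic_pow (1 + of_nat x * y) t" for x
  proof -
    have "pabs (of_nat x * y) \<le> 1 * (1 / real p)"
      unfolding pabs_mult using assms(2) by (intro mult_mono) auto
    then have "1 + of_nat x * y \<in> one_units" by (simp add: one_units_def)
    then show ?thesis using padic_pow_sums[OF _ assms(1)] by fastforce
  qed
  then have "(\<lambda>j. 1 / of_nat (p ^ n) * (\<Sum>x<p ^ n. (t gchoose j) * (of_nat x * y) ^ j)) sums
      (1 / of_nat (p ^ n) * (\<Sum>x<p ^ n. padic_pow (1 + of_nat x * y) t))"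
    by (intro sums_cmult_padic sums_sum_padic)
  moreover have "(\<lambda>j. (t gchoose j) * (y ^ j * of_rat (bernoulli j))) sums bernoulli_series t y"
    using gchoose_series_sums[OF assms(1) bernoulli_series_coeff[OF assms(2)]]
    by (simp add: bernoulli_series_def mult.assoc)
  ultimately have "(\<lambda>j. 1 / of_nat (p ^ n) * (\<Sum>x<p ^ n. (t gchoose j) * (of_nat x * y) ^ j) -
      (t gchoose j) * (y ^ j * of_rat (bernoulli j))) sums
      (1 / of_nat (p ^ n) * (\<Sum>x<p ^ n. padic_pow (1 + of_nat x * y) t) - bernoulli_series t y)"
    by (rule sums_diff_padic)
  moreover have "1 / of_nat (p ^ n) * (\<Sum>x<p ^ n. (t gchoose j) * (of_nat x * y) ^ j) -
      (t gchoose j) * (y ^ j * of_rat (bernoulli j)) = (t gchoose j) * (y ^ j * ?e j)" for j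
    by (simp add: power_mult_distrib algebra_simps sum_distrib_left sum_distrib_right sum_divide_distrib)
  ultimately show "(\<lambda>j. (t gchoose j) * (y ^ j * ?e j)) sums
      ((\<Sum>x<p ^ n. padic_pow (1 + of_nat x * y) t) / of_nat (p ^ n) - bernoulli_series t y)"
    by simp
  fix j
  have "pabs (y ^ j * ?e j) \<le> (1 / real p) ^ j * (2 * real p * (1 / real p) ^ n)"
    unfolding pabs_mult[of "y ^ j"] pabs_power[of y]
    using assms(2) power_sum_mean_bernoulli[OF assms(3), of j] by (intro mult_mono power_mono) auto
  then have "pabs ((t gchoose j) * (y ^ j * ?e j)) \<le> 2 * real p * (1 / real p) ^ n * rho t ^ j"
    by (intro pabs_gchoose_mult_le) (simp add: mult_ac)
  also have "\<dots> \<le> 2 * real p * (1 / real p) ^ n * 1"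
    using rho_pos[of t] rho_less_1[OF assms(1)] by (intro mult_left_mono power_le_one) auto
  finally show "pabs ((t gchoose j) * (y ^ j * ?e j)) \<le> 2 * real p * (1 / real p) ^ n" by simp
qed

end

section \<open>Periodic functions and twisted powers\<close>

lemma sum_blocks:
  fixes h :: "nat \<Rightarrow> 'b :: comm_monoid_add"
  shows "(\<Sum>b\<in>{1..N * m}. h b) = (\<Sum>k<m. \<Sum>a\<in>{1..N}. h (a + k * N))"
proof (induction m)
  case (Suc m)
  have "(\<Sum>b\<in>{1..N * Suc m}. h b) = (\<Sum>b\<in>{1..N * m}. h b) + (\<Sum>b\<in>{N * m + 1..N * m + N}. h b)"
    by (subst sum.ub_add_nat[symmetric]) (auto simp: add.commute)
  also have "(\<Sum>b\<in>{N * m + 1..N * m + N}. h b) = (\<Sum>a\<in>{1..N}. h (a + m * N))"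
    by (rule sum.reindex_bij_witness[of _ "\<lambda>a. a + m * N" "\<lambda>b. b - m * N"]) (auto simp: mult.commute)
  finally show ?case using Suc by simp
qed simp

lemma minus_one_power_mult_odd: "odd n \<Longrightarrow> (-1 :: 'b :: ring_1) ^ (k * n) = (-1) ^ k"
  by (cases "even k") simp_all

context padic_field
begin

text \<open>The function g of the overview. Both \<psi> and t are parameters because g(c)/c is of
  the same form with other values of them.\<close>

definition twisted_power :: "(int \<Rightarrow> 'a) \<Rightarrow> 'a \<Rightarrow> int \<Rightarrow> 'a" where
  "twisted_power \<psi> t b = (if int p dvd b then 0 else \<psi> b * padic_pow (angle p b) t)"

lemma periodic_mult:
  assumes "\<And>a. \<psi> (a + int N) = (\<psi> a :: 'b)"
  shows "\<psi> (a + int k * int N) = \<psi> a"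
proof (induction k)
  case (Suc k)
  then show ?case using assms[of "a + int k * int N"] by (simp add: algebra_simps)
qed simp

lemma periodic_dvd:
  assumes "\<And>a. \<psi> (a + int N) = (\<psi> a :: 'b)" "N dvd M"
  shows "\<psi> (a + int M) = \<psi> a"
  using assms(2) periodic_mult[of \<psi> N, OF assms(1)] by (auto simp: dvd_def mult.commute)

lemma periodic_mod:
  assumes "\<And>a. \<psi> (a + int N) = (\<psi> a :: 'b)"
  shows "\<psi> (a mod int N) = \<psi> a"
proof (cases "a div int N \<ge> 0")
  case True
  have "a = a mod int N + int (nat (a div int N)) * int N" using True by simp
  then show ?thesis using periodic_mult[of \<psi> N, OF assms(1)] by metis
next
  case False
  have "a mod int N = a + int (nat (- (a div int N))) * int N"
    using False by (simp add: minus_div_mult_eq_mod[symmetric])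
  then show ?thesis using periodic_mult[of \<psi> N, OF assms(1)] by metis
qed

lemma periodic_bounded:
  assumes "\<And>a. \<psi> (a + int N) = (\<psi> a :: 'a)" "N > 0"
  obtains C where "C \<ge> 0" "\<And>a. pabs (\<psi> a) \<le> C"
proof
  define C where "C = (\<Sum>b\<in>{0..<int N}. pabs (\<psi> b))"
  show "C \<ge> 0" unfolding C_def by (intro sum_nonneg) simp
  fix a
  have "pabs (\<psi> (a mod int N)) \<le> C"
    unfolding C_def using assms(2) by (intro member_le_sum) auto
  then show "pabs (\<psi> a) \<le> C" using periodic_mod[of \<psi> N, OF assms(1)] by simp
qed

lemma pabs_twisted_power_le:
  assumes "pabs (\<psi> b) \<le> C" "t \<in> padic_disc p"
  shows "pabs (twisted_power \<psi> t b) \<le> C"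
proof (cases "int p dvd b")
  case True
  then show ?thesis using order_trans[OF pabs_nonneg assms(1)] by (simp add: twisted_power_def)
next
  case False
  then show ?thesis
    using assms by (simp add: twisted_power_def pabs_mult pabs_padic_pow angle_one_units)
qed

lemma twisted_power_add:
  assumes "\<psi> (c + M) = \<psi> c" "int p dvd M" "t \<in> padic_disc p"
  shows "twisted_power \<psi> t (c + M) = twisted_power \<psi> t c * padic_pow (1 + of_int M / of_int c) t"
proof (cases "int p dvd c")
  case True
  then show ?thesis using assms(2) by (simp add: twisted_power_def)
next
  case False
  then have "\<not> int p dvd c + M" using assms(2) by (simp add: dvd_add_left_iff)
  then show ?thesis
    using False assms
    by (simp add: twisted_power_def angle_add padic_pow_mult angle_one_units one_units_add_divide)
qed

lemma twisted_power_add_bound1: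
  assumes "\<psi> (c + M) = \<psi> c" "int p dvd M" "t \<in> padic_disc p" "pabs (\<psi> c) \<le> C"
  shows "pabs (twisted_power \<psi> t (c + M) - twisted_power \<psi> t c) \<le> C * pabs t * pabs (of_int M :: 'a)"
proof (cases "int p dvd c")
  case True
  then show ?thesis using assms(2) order_trans[OF pabs_nonneg assms(4)] by (simp add: twisted_power_def)
next
  case False
  let ?x = "1 + of_int M / of_int c :: 'a"
  have "twisted_power \<psi> t (c + M) - twisted_power \<psi> t c = twisted_power \<psi> t c * (padic_pow ?x t - 1)"
    using twisted_power_add[of \<psi> c M t] assms by (simp add: algebra_simps)
  moreover have "pabs (padic_pow ?x t - 1) = pabs t * pabs (of_int M :: 'a)"
    using pabs_padic_pow_minus_1[OF one_units_add_divide[OF False assms(2)] assms(3)]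
    by (simp add: pabs_divide pabs_of_int_unit[OF False])
  ultimately show ?thesis
    using pabs_twisted_power_le[of \<psi> c C t] assms
    by (simp add: pabs_mult mult.assoc mult_right_mono)
qed

text \<open>The quadratic error still tends to 0 after division by the length of a mean; the linear
  one of the preceding lemma would not.\<close>

lemma twisted_power_add_bound2:
  assumes "\<psi> (c + M) = \<psi> c" "int p dvd M" "t \<in> padic_disc p" "pabs (\<psi> c) \<le> C"
  shows "pabs (twisted_power \<psi> t (c + M) - twisted_power \<psi> t c - t * of_int M * (twisted_power \<psi> t c / of_int c))
    \<le> C * (max 1 (pabs t) * kap)\<^sup>2 * (pabs (of_int M :: 'a))\<^sup>2"
proof (cases "int p dvd c")
  case True
  then show ?thesis using assms(2) order_trans[OF pabs_nonneg assms(4)] by (simp add: twisted_power_def)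
next
  case False
  let ?x = "1 + of_int M / of_int c :: 'a"
  have "twisted_power \<psi> t (c + M) - twisted_power \<psi> t c - t * of_int M * (twisted_power \<psi> t c / of_int c) =
      twisted_power \<psi> t c * (padic_pow ?x t - 1 - t * (?x - 1))"
    using twisted_power_add[of \<psi> c M t] assms by (simp add: algebra_simps)
  moreover have "pabs (padic_pow ?x t - 1 - t * (?x - 1)) \<le> (max 1 (pabs t) * kap)\<^sup>2 * (pabs (of_int M :: 'a))\<^sup>2"
    using padic_pow_taylor[OF one_units_add_divide[OF False assms(2)] assms(3)]
    by (simp add: pabs_divide pabs_of_int_unit[OF False])
  ultimately show ?thesis
    using pabs_twisted_power_le[of \<psi> c C t] assms order_trans[OF pabs_nonneg assms(4)]
    unfolding mult.assoc[of C] by (simp only: pabs_mult) (intro mult_mono, auto)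
qed

text \<open>This is c = \<omega>(c) <c>. For t = 1 - s the exponent t - 1 is -s, so g(c)/c is, up to
  sign, a summand of the alternating sum.\<close>

lemma twisted_power_divide:
  assumes "t \<in> padic_disc p"
  shows "twisted_power \<psi> t c / of_int c = twisted_power (\<lambda>a. \<psi> a / teich p a) (t - 1) c"
proof (cases "int p dvd c")
  case False
  have "padic_pow (angle p c) t = padic_pow (angle p c) (t - 1) * padic_pow (angle p c) 1"
    using padic_pow_add[OF angle_one_units[OF False], of "t - 1" 1] assms disc_diff[OF assms disc_1] by simp
  then show ?thesis
    using False teich_nonzero[OF False] of_int_nonzero[OF False]
    by (simp add: twisted_power_def angle_one_units) (simp add: angle_def)
qed (simp add: twisted_power_def)

lemma twisted_power_mult:
  assumes "\<psi> (a * b) = \<psi> a * \<psi> b" "\<not> int p dvd a" "t \<in> padic_disc p"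
  shows "twisted_power \<psi> t (a * b) = twisted_power \<psi> t a * twisted_power \<psi> t b"
proof (cases "int p dvd b")
  case False
  then show ?thesis
    using assms not_p_dvd_mult[OF assms(2) False]
    by (simp add: twisted_power_def angle_mult padic_pow_mult angle_one_units)
qed (simp add: twisted_power_def)

lemma periodic_divide_teich:
  assumes "\<And>a. \<psi> (a + int N) = \<psi> a" "p dvd N"
  shows "\<psi> (a + int N) / teich p (a + int N) = (\<psi> a / teich p a :: 'a)"
  using teich_cong[of "a + int N" a] assms by (simp add: cong_iff_dvd_diff)

lemma alternating_sum_twisted_power:
  assumes "s \<in> padic_disc p"
  shows "alternating_sum p N (\<lambda>a. \<psi> a / teich p a) s =
    1 / 2 * (\<Sum>a\<in>{1..N}. (-1) ^ (a + 1) * twisted_power (\<lambda>a. \<psi> a / teich p a) (- s) (int a))"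
proof -
  have "(\<Sum>a | a \<in> {1..N} \<and> \<not> p dvd a. (-1) ^ (a + 1) * (\<psi> (int a) / teich p (int a)) *
      (1 / padic_pow (angle p (int a)) s)) =
    (\<Sum>a | a \<in> {1..N} \<and> \<not> p dvd a. (-1) ^ (a + 1) * twisted_power (\<lambda>a. \<psi> a / teich p a) (- s) (int a))"
    using assms by (intro sum.cong refl) (auto simp: twisted_power_def padic_pow_minus angle_one_units)
  also have "\<dots> = (\<Sum>a\<in>{1..N}. (-1) ^ (a + 1) * twisted_power (\<lambda>a. \<psi> a / teich p a) (- s) (int a))"
    by (intro sum.mono_neutral_left) (auto simp: twisted_power_def)
  finally show ?thesis unfolding alternating_sum_def by (rule arg_cong)
qed

subsection \<open>The Volkenborn integral of a twisted power\<close>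

text \<open>This is (s - 1) times \<open>padic_L_formula\<close> for t = 1 - s. That it is an
  integral, a limit of means, is the content of \<open>volkenborn_limit\<close>.\<close>

definition volkenborn :: "nat \<Rightarrow> (int \<Rightarrow> 'a) \<Rightarrow> 'a \<Rightarrow> 'a" where
  "volkenborn F \<psi> t = 1 / of_nat F *
     (\<Sum>a\<in>{1..F}. twisted_power \<psi> t (int a) * bernoulli_series t (of_nat F / of_nat a))"

lemma padic_L_formula_volkenborn:
  "padic_L_formula p F \<psi> s = 1 / (s - 1) * volkenborn F \<psi> (1 - s)"
proof -
  have "(\<Sum>a | a \<in> {1..F} \<and> \<not> p dvd a.
        \<psi> (int a) * padic_pow (angle p (int a)) (1 - s) *
        (\<Sum>j. ((1 - s) gchoose j) * (of_nat F / of_nat a) ^ j * of_rat (bernoulli j))) =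
     (\<Sum>a | a \<in> {1..F} \<and> \<not> p dvd a. twisted_power \<psi> (1 - s) (int a) * bernoulli_series (1 - s) (of_nat F / of_nat a))"
    by (intro sum.cong refl) (auto simp: twisted_power_def bernoulli_series_def)
  also have "\<dots> = (\<Sum>a\<in>{1..F}. twisted_power \<psi> (1 - s) (int a) * bernoulli_series (1 - s) (of_nat F / of_nat a))"
    by (intro sum.mono_neutral_left) (auto simp: twisted_power_def)
  finally show ?thesis unfolding padic_L_formula_def volkenborn_def by (simp add: mult_ac)
qed

lemma inverse_p_power_tendsto_0: "(\<lambda>n. C * (1 / real p) ^ n) \<longlonglongrightarrow> 0"
  using p_ge_3 by (intro tendsto_mult_right_zero LIMSEQ_realpow_zero) auto

lemma pabs_mult_p_power_le: "pabs (of_nat (F * p ^ n) :: 'a) \<le> (1 / real p) ^ n"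
  using mult_right_mono[OF pabs_of_nat_le_1[of F], of "(1 / real p) ^ n"]
  by (simp add: pabs_mult pabs_power pabs_p)

lemma volkenborn_limit:
  assumes per: "\<And>a. \<psi> (a + int F) = \<psi> a" and F: "F > 0" "p dvd F" and t: "t \<in> padic_disc p"
  shows "(\<lambda>n. (\<Sum>b\<in>{1..F * p ^ n}. twisted_power \<psi> t (int b)) / of_nat (F * p ^ n)) \<longlonglongrightarrow> volkenborn F \<psi> t"
proof -
  obtain C where C: "C \<ge> 0" "\<And>a. pabs (\<psi> a) \<le> C" using periodic_bounded[of \<psi> F] per F by metis
  let ?K = "1 / pabs (of_nat F :: 'a) * (C * (2 * real p))"
  have "\<forall>\<^sub>F n in sequentially. pabs ((\<Sum>b\<in>{1..F * p ^ n}. twisted_power \<psi> t (int b)) / of_nat (F * p ^ n) -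
      volkenborn F \<psi> t) \<le> ?K * (1 / real p) ^ n"
  proof (rule eventually_sequentiallyI)
    fix n :: nat assume n: "n \<ge> 1"
    let ?y = "\<lambda>a :: nat. of_nat F / of_nat a :: 'a"
    let ?e = "\<lambda>a. (\<Sum>x<p ^ n. padic_pow (1 + of_nat x * ?y a) t) / of_nat (p ^ n) - bernoulli_series t (?y a)"
    \<comment> \<open>Every b is a + x F with 1 <= a <= F and x < p^n, so for fixed a the sum over x
      becomes a mean of (1 + x F/a)^t.\<close>
    have "twisted_power \<psi> t (int (a + x * F)) = twisted_power \<psi> t (int a) * padic_pow (1 + of_nat x * ?y a) t" for a x
      using twisted_power_add[of \<psi> "int a" "int x * int F" t] periodic_mult[of \<psi> F, OF per] F t by simp
    then have "(\<Sum>b\<in>{1..F * p ^ n}. twisted_power \<psi> t (int b)) =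
        (\<Sum>x<p ^ n. \<Sum>a\<in>{1..F}. twisted_power \<psi> t (int a) * padic_pow (1 + of_nat x * ?y a) t)"
      unfolding sum_blocks by (simp only:)
    also have "\<dots> = (\<Sum>a\<in>{1..F}. twisted_power \<psi> t (int a) * (\<Sum>x<p ^ n. padic_pow (1 + of_nat x * ?y a) t))"
      by (subst sum.swap) (simp add: sum_distrib_left)
    finally have "(\<Sum>b\<in>{1..F * p ^ n}. twisted_power \<psi> t (int b)) / of_nat (F * p ^ n) - volkenborn F \<psi> t =
        1 / of_nat F * (\<Sum>a\<in>{1..F}. twisted_power \<psi> t (int a) * ?e a)"
      unfolding volkenborn_def
      by (simp add: right_diff_distrib sum_subtractf sum_divide_distrib sum_distrib_left)
    also have "pabs \<dots> \<le> 1 / pabs (of_nat F :: 'a) * (C * (2 * real p * (1 / real p) ^ n))"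
    proof -
      have "pabs (\<Sum>a\<in>{1..F}. twisted_power \<psi> t (int a) * ?e a) \<le> C * (2 * real p * (1 / real p) ^ n)"
      proof (rule pabs_sum_le)
        fix a assume "a \<in> {1..F}"
        show "pabs (twisted_power \<psi> t (int a) * ?e a) \<le> C * (2 * real p * (1 / real p) ^ n)"
        proof (cases "p dvd a")
          case True
          then show ?thesis using C by (simp add: twisted_power_def)
        next
          case False
          have "pabs (?y a) \<le> 1 / real p"
            using pabs_of_nat_dvd[OF F(2)] by (simp add: pabs_divide pabs_of_nat_unit[OF False])
          then show ?thesis
            unfolding pabs_mult using C t n
            by (intro mult_mono pabs_twisted_power_le volkenborn_padic_pow) auto
        qed
      qed (use C in simp)
      then show ?thesis unfolding pabs_mult pabs_divide pabs_1 by (intro mult_left_mono) simp_all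
    qed
    finally show "pabs ((\<Sum>b\<in>{1..F * p ^ n}. twisted_power \<psi> t (int b)) / of_nat (F * p ^ n) -
      volkenborn F \<psi> t) \<le> ?K * (1 / real p) ^ n" by (simp add: mult_ac)
  qed
  then show ?thesis by (rule tendsto_pabs_bound[OF _ inverse_p_power_tendsto_0])
qed

text \<open>The sum is its length times its mean; the length F p^n tends to 0 and the means
  converge.\<close>

lemma twisted_power_sum_tendsto_0:
  assumes per: "\<And>a. \<psi> (a + int F) = \<psi> a" and F: "F > 0" "p dvd F" and t: "t \<in> padic_disc p"
  shows "(\<lambda>n. \<Sum>b\<in>{1..F * p ^ n}. twisted_power \<psi> t (int b)) \<longlonglongrightarrow> 0"
proof -
  have "(\<lambda>n. of_nat (F * p ^ n) :: 'a) \<longlonglongrightarrow> 0"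
    by (rule tendsto_pabs_bound[OF _ inverse_p_power_tendsto_0[of 1]]) (use pabs_mult_p_power_le in simp)
  then have "(\<lambda>n. of_nat (F * p ^ n) * ((\<Sum>b\<in>{1..F * p ^ n}. twisted_power \<psi> t (int b)) / of_nat (F * p ^ n)))
      \<longlonglongrightarrow> 0 * volkenborn F \<psi> t"
    using volkenborn_limit[of \<psi> F t, OF assms] by (rule tendsto_mult_padic)
  then show ?thesis using F p_ge_3 by simp
qed

text \<open>Cut the range of length m N, with N = F p^n, into m blocks. To first order, block k
  differs from block 0 by t k N times the sum of g(c)/c. Division by m N leaves a fixed multiple of
  that sum, which tends to 0.\<close>

lemma volkenborn_mult:
  assumes per: "\<And>a. \<psi> (a + int F) = \<psi> a" and F: "F > 0" "p dvd F" and t: "t \<in> padic_disc p"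
    and m: "m > 0"
  shows "volkenborn (F * m) \<psi> t = volkenborn F \<psi> t"
proof -
  obtain C where C: "C \<ge> 0" "\<And>a. pabs (\<psi> a) \<le> C" using periodic_bounded[of \<psi> F] per F by metis
  define D where "D = C * (max 1 (pabs t) * kap)\<^sup>2"
  have D: "D \<ge> 0" using C by (simp add: D_def)
  let ?G = "\<lambda>b. twisted_power \<psi> t (int b)"
  let ?N = "\<lambda>n. F * p ^ n"
  define X where "X n = (\<Sum>b\<in>{1..(F * m) * p ^ n}. ?G b) / of_nat (F * m * p ^ n)" for n
  define Y where "Y n = (\<Sum>b\<in>{1..?N n}. ?G b) / of_nat (?N n)" for n
  define Z where "Z n = (\<Sum>b\<in>{1..?N n}. twisted_power (\<lambda>a. \<psi> a / teich p a) (t - 1) (int b))" for n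
  have X: "X \<longlonglongrightarrow> volkenborn (F * m) \<psi> t"
    unfolding X_def by (rule volkenborn_limit) (use periodic_dvd[of \<psi> F "F * m", OF per] assms in auto)
  have Y: "Y \<longlonglongrightarrow> volkenborn F \<psi> t"
    unfolding Y_def by (rule volkenborn_limit) (use assms in auto)
  have Z: "Z \<longlonglongrightarrow> 0"
    unfolding Z_def
    by (rule twisted_power_sum_tendsto_0) (use periodic_divide_teich[of \<psi> F] disc_diff[OF t disc_1] assms in auto)
  \<comment> \<open>The total weight of the first-order terms, as block k is shifted by k N.\<close>
  let ?s = "of_nat (\<Sum>k<m. k) :: 'a"
  have "(\<lambda>n. X n - Y n - 1 / of_nat m * (t * ?s * Z n)) \<longlonglongrightarrow> 0"
  proof (rule tendsto_pabs_bound)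
    show "\<forall>\<^sub>F n in sequentially. pabs (X n - Y n - 1 / of_nat m * (t * ?s * Z n) - 0)
        \<le> (1 / pabs (of_nat m :: 'a) * D) * (1 / real p) ^ n"
    proof (rule always_eventually, rule allI)
      fix n
      let ?M = "?N n"
      have M: "?M > 0" using F p_ge_3 by simp
      let ?r = "\<lambda>k a. ?G (a + k * ?M) - ?G a - t * of_int (int (k * ?M)) * (?G a / of_int (int a))"
      have "(\<Sum>k<m. \<Sum>a\<in>{1..?M}. ?r k a) =
          (\<Sum>k<m. \<Sum>a\<in>{1..?M}. ?G (a + k * ?M)) - of_nat m * (\<Sum>a\<in>{1..?M}. ?G a) - t * ?s * of_nat ?M * Z n"
        unfolding twisted_power_divide[OF t] Z_def
        by (simp add: sum_subtractf sum_distrib_left sum_distrib_right mult_ac) (rule sum.swap)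
      also have "(\<Sum>k<m. \<Sum>a\<in>{1..?M}. ?G (a + k * ?M)) = (\<Sum>b\<in>{1..F * m * p ^ n}. ?G b)"
        by (subst sum_blocks[symmetric]) (simp add: mult_ac)
      finally have R: "(\<Sum>k<m. \<Sum>a\<in>{1..?M}. ?r k a) =
          (\<Sum>b\<in>{1..F * m * p ^ n}. ?G b) - of_nat m * (\<Sum>a\<in>{1..?M}. ?G a) - t * ?s * of_nat ?M * Z n" .
      have eq: "X n - Y n - 1 / of_nat m * (t * ?s * Z n) =
          1 / of_nat m * (1 / of_nat ?M) * (\<Sum>k<m. \<Sum>a\<in>{1..?M}. ?r k a)"
      proof -
        have alg: "sx / (d * M) - sy / M - 1 / d * (t * s * z) = 1 / d * (1 / M) * r"
          if "r = sx - d * sy - t * s * M * z" "d \<noteq> 0" "M \<noteq> 0" for r sx sy s z d M :: 'a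
          unfolding that(1) using that(2,3) by (simp add: field_simps)
        have e: "of_nat (F * m * p ^ n) = (of_nat m * of_nat ?M :: 'a)" by simp
        have "(of_nat m :: 'a) \<noteq> 0" "(of_nat ?M :: 'a) \<noteq> 0"
          using m M by (simp_all only: of_nat_eq_0_iff)
        then show ?thesis unfolding X_def Y_def e by (rule alg[OF R])
      qed
      have "pabs (\<Sum>k<m. \<Sum>a\<in>{1..?M}. ?r k a) \<le> D * (pabs (of_nat ?M :: 'a))\<^sup>2"
      proof (intro pabs_sum_le)
        fix k a
        have "\<psi> (int a + int (k * ?M)) = \<psi> (int a)"
          by (rule periodic_dvd[of \<psi> F, OF per]) simp
        then have "pabs (?r k a) \<le> D * (pabs (of_int (int (k * ?M)) :: 'a))\<^sup>2"
          unfolding D_def of_nat_add using C F t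
          by (intro twisted_power_add_bound2) (auto simp: dvd_mult)
        also have "\<dots> \<le> D * (pabs (of_nat ?M :: 'a))\<^sup>2"
        proof (intro mult_left_mono power_mono D)
          have "pabs (of_nat k :: 'a) * pabs (of_nat ?M :: 'a) \<le> 1 * pabs (of_nat ?M :: 'a)"
            by (intro mult_right_mono) auto
          then show "pabs (of_int (int (k * ?M)) :: 'a) \<le> pabs (of_nat ?M :: 'a)"
            by (simp add: pabs_mult)
        qed simp
        finally show "pabs (?r k a) \<le> D * (pabs (of_nat ?M :: 'a))\<^sup>2" .
      qed (use D in auto)
      then have "pabs (X n - Y n - 1 / of_nat m * (t * ?s * Z n))
          \<le> 1 / pabs (of_nat m :: 'a) * (1 / pabs (of_nat ?M :: 'a)) * (D * (pabs (of_nat ?M :: 'a))\<^sup>2)"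
        unfolding eq pabs_mult[of "_ * _"] pabs_mult[of "1 / _"] pabs_divide[of 1] pabs_1
        by (intro mult_left_mono) simp_all
      also have "\<dots> = 1 / pabs (of_nat m :: 'a) * D * pabs (of_nat ?M :: 'a)"
        using M by (simp add: power2_eq_square)
      also have "\<dots> \<le> 1 / pabs (of_nat m :: 'a) * D * (1 / real p) ^ n"
        using D pabs_mult_p_power_le by (intro mult_left_mono) auto
      finally show "pabs (X n - Y n - 1 / of_nat m * (t * ?s * Z n) - 0)
        \<le> (1 / pabs (of_nat m :: 'a) * D) * (1 / real p) ^ n" by simp
    qed
  qed (rule inverse_p_power_tendsto_0)
  moreover have "(\<lambda>n. X n - Y n - 1 / of_nat m * (t * ?s * Z n)) \<longlonglongrightarrow>
      volkenborn (F * m) \<psi> t - volkenborn F \<psi> t - 1 / of_nat m * (t * ?s * 0)"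
    by (intro tendsto_diff_padic tendsto_cmult_padic X Y Z)
  ultimately have "volkenborn (F * m) \<psi> t - volkenborn F \<psi> t - 1 / of_nat m * (t * ?s * 0) = 0"
    using LIMSEQ_unique by blast
  then show ?thesis by simp
qed

text \<open>Both sides equal the value at F F'.\<close>

lemma volkenborn_eq:
  assumes "\<And>a. \<psi> (a + int F) = \<psi> a" "F > 0" "p dvd F"
    and "\<And>a. \<psi> (a + int F') = \<psi> a" "F' > 0" "p dvd F'" and t: "t \<in> padic_disc p"
  shows "volkenborn F \<psi> t = volkenborn F' \<psi> t"
  using volkenborn_mult[of \<psi> F t F', OF assms(1-3) t assms(5)] volkenborn_mult[of \<psi> F' t F, OF assms(4-6) t assms(2)]
  by (simp add: mult.commute)

section \<open>Alternating sums of twisted powers\<close>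

lemma alternating_twisted_power_convergent:
  assumes per: "\<And>a. \<psi> (a + int F) = \<psi> a" and F: "F > 0" "p dvd F" "odd F" and t: "t \<in> padic_disc p"
  shows "convergent (\<lambda>n. \<Sum>a\<in>{1..F * p ^ n}. (-1) ^ (a + 1) * twisted_power \<psi> t (int a))"
proof (rule convergent_padic)
  obtain C where C: "C \<ge> 0" "\<And>a. pabs (\<psi> a) \<le> C" using periodic_bounded[of \<psi> F] per F by metis
  let ?G = "\<lambda>b. twisted_power \<psi> t (int b)"
  let ?X = "\<lambda>n. \<Sum>a\<in>{1..F * p ^ n}. (-1) ^ (a + 1) * ?G a"
  have "pabs (?X (Suc n) - ?X n) \<le> C * pabs t * (1 / real p) ^ n" for n
  proof -
    let ?N = "F * p ^ n"
    have oddN: "odd ?N" using F odd_p by simp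
    \<comment> \<open>From n to n + 1 one block of length N becomes p blocks. Block k carries the
      sign (-1)^k since N is odd, and these signs add up to 1 since p is odd; so the old sum can be
      subtracted block by block.\<close>
    have alt: "(\<Sum>k<m. (-1) ^ k :: 'a) = (if odd m then 1 else 0)" for m
      by (induction m) auto
    have "?X (Suc n) = (\<Sum>a\<in>{1..?N * p}. (-1) ^ (a + 1) * ?G a)" by (simp add: mult_ac)
    also have "\<dots> = (\<Sum>k<p. \<Sum>a\<in>{1..?N}. (-1) ^ k * ((-1) ^ (a + 1) * ?G (a + k * ?N)))"
      unfolding sum_blocks
      by (intro sum.cong refl) (simp add: power_add minus_one_power_mult_odd[OF oddN])
    finally have 1: "?X (Suc n) = (\<Sum>k<p. \<Sum>a\<in>{1..?N}. (-1) ^ k * ((-1) ^ (a + 1) * ?G (a + k * ?N)))" .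
    have "?X n = (\<Sum>k<p. (-1) ^ k) * ?X n" using odd_p by (simp add: alt)
    also have "\<dots> = (\<Sum>k<p. (-1) ^ k * ?X n)" by (rule sum_distrib_right)
    also have "\<dots> = (\<Sum>k<p. \<Sum>a\<in>{1..?N}. (-1) ^ k * ((-1) ^ (a + 1) * ?G a))"
      by (intro sum.cong refl sum_distrib_left)
    finally have 2: "?X n = (\<Sum>k<p. \<Sum>a\<in>{1..?N}. (-1) ^ k * ((-1) ^ (a + 1) * ?G a))" .
    have "?X (Suc n) - ?X n =
        (\<Sum>k<p. \<Sum>a\<in>{1..?N}. (-1) ^ k * ((-1) ^ (a + 1) * (?G (a + k * ?N) - ?G a)))"
      unfolding 1 2 by (simp only: right_diff_distrib sum_subtractf)
    also have "pabs \<dots> \<le> C * pabs t * (1 / real p) ^ n"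
    proof (intro pabs_sum_le)
      fix k a
      have "\<psi> (int a + int (k * ?N)) = \<psi> (int a)"
        by (rule periodic_dvd[of \<psi> F, OF per]) simp
      then have "pabs (?G (a + k * ?N) - ?G a) \<le> C * pabs t * pabs (of_int (int (k * ?N)) :: 'a)"
        unfolding of_nat_add using C F t by (intro twisted_power_add_bound1) (auto simp: dvd_mult)
      also have "\<dots> \<le> C * pabs t * (1 / real p) ^ n"
        using C pabs_mult_p_power_le[of "k * F" n] by (intro mult_left_mono) (auto simp: mult_ac)
      finally show "pabs ((-1) ^ k * ((-1) ^ (a + 1) * (?G (a + k * ?N) - ?G a))) \<le> C * pabs t * (1 / real p) ^ n"
        by (simp add: pabs_mult pabs_power)
    qed (use C in auto)
    finally show ?thesis .
  qed
  then show "(\<lambda>n. pabs (?X (Suc n) - ?X n)) \<longlonglongrightarrow> 0"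
    by (intro tendsto_sandwich[OF _ _ tendsto_const inverse_p_power_tendsto_0[of "C * pabs t"]]) auto
qed

text \<open>
  The doubling \<open>a \<mapsto> 2a\<close> maps \<open>{1..N}\<close> onto the even numbers up to \<open>2N\<close>; those above \<open>N\<close> are
  \<open>c + N\<close> with \<open>c\<close> odd, as \<open>N\<close> is odd.
\<close>

lemma doubling:
  assumes per: "\<And>a. \<psi> (a + int F) = \<psi> a" and F: "F > 0" "p dvd F" "odd F" and t: "t \<in> padic_disc p"
    and double: "\<And>a. \<psi> (2 * a) = \<psi> 2 * \<psi> a"
    and A: "(\<lambda>n. \<Sum>a\<in>{1..F * p ^ n}. (-1) ^ (a + 1) * twisted_power (\<lambda>a. \<psi> a / teich p a) (t - 1) (int a)) \<longlonglongrightarrow> A"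
  shows "2 * (\<psi> 2 * padic_pow (angle p 2) t - 1) * volkenborn F \<psi> t = t * A"
proof -
  obtain C where C: "C \<ge> 0" "\<And>a. pabs (\<psi> a) \<le> C" using periodic_bounded[of \<psi> F] per F by metis
  define D where "D = C * (max 1 (pabs t) * kap)\<^sup>2"
  have D: "D \<ge> 0" using C by (simp add: D_def)
  let ?G = "\<lambda>b. twisted_power \<psi> t (int b)"
  let ?H = "\<lambda>b. twisted_power (\<lambda>a. \<psi> a / teich p a) (t - 1) (int b)"
  let ?g = "\<psi> 2 * padic_pow (angle p 2) t"
  let ?N = "\<lambda>n. F * p ^ n"
  define Y where "Y n = (\<Sum>b\<in>{1..?N n}. ?G b) / of_nat (?N n)" for n
  define Z where "Z n = (\<Sum>b\<in>{1..?N n}. ?H b)" for n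
  define A' where "A' n = (\<Sum>a\<in>{1..?N n}. (-1) ^ (a + 1) * ?H a)" for n
  have Y: "Y \<longlonglongrightarrow> volkenborn F \<psi> t"
    unfolding Y_def by (rule volkenborn_limit) (use assms in auto)
  have Z: "Z \<longlonglongrightarrow> 0"
    unfolding Z_def
    by (rule twisted_power_sum_tendsto_0) (use periodic_divide_teich[of \<psi> F] disc_diff[OF t disc_1] assms in auto)
  have "(\<lambda>n. 2 * (?g - 1) * Y n - t * (Z n + A' n)) \<longlonglongrightarrow> 0"
  proof (rule tendsto_pabs_bound[OF _ inverse_p_power_tendsto_0[of D]])
    show "\<forall>\<^sub>F n in sequentially. pabs (2 * (?g - 1) * Y n - t * (Z n + A' n) - 0) \<le> D * (1 / real p) ^ n"
    proof (rule always_eventually, rule allI)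
      fix n
      let ?M = "?N n"
      have M: "?M > 0" "odd ?M" using F p_ge_3 odd_p by auto
      let ?r = "\<lambda>a. ?G (a + ?M) - ?G a - t * of_int (int ?M) * (?G a / of_int (int a))"
      \<comment> \<open>The weight 1 + (-1)^b is twice the indicator of the even numbers.\<close>
      have "(\<Sum>b\<in>{1..?M * 2}. (1 + (-1) ^ b) * ?G b) = (\<Sum>a\<in>{1..?M}. 2 * ?G (2 * a))"
      proof -
        have "(\<Sum>b\<in>{1..?M * 2}. (1 + (-1) ^ b) * ?G b) = (\<Sum>b\<in>(\<lambda>a. 2 * a) ` {1..?M}. (1 + (-1) ^ b) * ?G b)"
        proof (rule sum.mono_neutral_right)
          show "\<forall>b\<in>{1..?M * 2} - (\<lambda>a. 2 * a) ` {1..?M}. (1 + (-1) ^ b) * ?G b = 0"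
          proof
            fix b assume b: "b \<in> {1..?M * 2} - (\<lambda>a. 2 * a) ` {1..?M}"
            have "odd b"
            proof
              assume "even b"
              then obtain c where "b = 2 * c" by blast
              with b show False by auto
            qed
            then show "(1 + (-1) ^ b) * ?G b = 0" by simp
          qed
        qed auto
        also have "\<dots> = (\<Sum>a\<in>{1..?M}. 2 * ?G (2 * a))"
          by (subst sum.reindex) (auto simp: inj_on_def)
        finally show ?thesis .
      qed
      also have "\<dots> = 2 * ?g * (\<Sum>a\<in>{1..?M}. ?G a)"
      proof -
        have "?G (2 * a) = ?g * ?G a" for a
          using twisted_power_mult[of \<psi> 2 "int a" t] double not_p_dvd_2 t by (simp add: twisted_power_def)
        then show ?thesis by (simp add: sum_distrib_left mult_ac)
      qed
      finally have "2 * ?g * (\<Sum>a\<in>{1..?M}. ?G a) = (\<Sum>b\<in>{1..?M * 2}. (1 + (-1) ^ b) * ?G b)" ..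
      \<comment> \<open>On the upper half, 1 + (-1)^(a + N) is 1 - (-1)^a because N is odd.\<close>
      also have "\<dots> = (\<Sum>a\<in>{1..?M}. (1 + (-1) ^ a) * ?G a) + (\<Sum>a\<in>{1..?M}. (1 - (-1) ^ a) * ?G (a + ?M))"
        unfolding sum_blocks using M(2) by (simp add: numeral_2_eq_2 power_add)
      also have "\<dots> = 2 * (\<Sum>a\<in>{1..?M}. ?G a) + (\<Sum>a\<in>{1..?M}. (1 - (-1) ^ a) * (?G (a + ?M) - ?G a))"
        by (simp add: sum_distrib_left flip: sum.distrib) (simp add: algebra_simps)
      \<comment> \<open>As 1 - (-1)^a = 1 + (-1)^(a + 1), the first-order terms yield the plain sum
        \<open>Z n\<close>, which tends to 0, plus the alternating sum \<open>A' n\<close>.\<close>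
      also have "(\<Sum>a\<in>{1..?M}. (1 - (-1) ^ a) * (?G (a + ?M) - ?G a)) =
          (\<Sum>a\<in>{1..?M}. (1 - (-1) ^ a) * ?r a) + t * of_nat ?M * (Z n + A' n)"
        unfolding twisted_power_divide[OF t] Z_def A'_def
        by (simp add: sum_distrib_left flip: sum.distrib) (simp add: algebra_simps)
      finally have R: "2 * (?g - 1) * (\<Sum>a\<in>{1..?M}. ?G a) - t * of_nat ?M * (Z n + A' n) =
          (\<Sum>a\<in>{1..?M}. (1 - (-1) ^ a) * ?r a)"
        by (simp add: algebra_simps)
      have eq: "2 * (?g - 1) * Y n - t * (Z n + A' n) =
          1 / of_nat ?M * (\<Sum>a\<in>{1..?M}. (1 - (-1) ^ a) * ?r a)"
      proof -
        have alg: "2 * (g - 1) * (sy / M) - t * z = 1 / M * r"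
          if "2 * (g - 1) * sy - t * M * z = r" "M \<noteq> 0" for g sy z r M :: 'a
          unfolding that(1)[symmetric] using that(2) by (simp add: field_simps)
        have "(of_nat ?M :: 'a) \<noteq> 0" using M by (simp only: of_nat_eq_0_iff)
        with R show ?thesis unfolding Y_def by (rule alg)
      qed
      have "pabs (\<Sum>a\<in>{1..?M}. (1 - (-1) ^ a) * ?r a) \<le> D * (pabs (of_nat ?M :: 'a))\<^sup>2"
      proof (rule pabs_sum_le)
        fix a
        have "\<psi> (int a + int ?M) = \<psi> (int a)"
          by (rule periodic_dvd[of \<psi> F, OF per]) simp
        then have "pabs (?r a) \<le> D * (pabs (of_int (int ?M) :: 'a))\<^sup>2"
          unfolding D_def of_nat_add using C F t
          by (intro twisted_power_add_bound2) auto
        moreover have "pabs (1 - (-1) ^ a :: 'a) \<le> 1"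
          by (intro pabs_diff_le) (simp_all add: pabs_power)
        ultimately have "pabs ((1 - (-1) ^ a) * ?r a) \<le> 1 * (D * (pabs (of_int (int ?M) :: 'a))\<^sup>2)"
          unfolding pabs_mult[of "1 - _"] by (intro mult_mono) auto
        then show "pabs ((1 - (-1) ^ a) * ?r a) \<le> D * (pabs (of_nat ?M :: 'a))\<^sup>2" by simp
      qed (use D in auto)
      then have "pabs (2 * (?g - 1) * Y n - t * (Z n + A' n))
          \<le> 1 / pabs (of_nat ?M :: 'a) * (D * (pabs (of_nat ?M :: 'a))\<^sup>2)"
        unfolding eq pabs_mult[of "1 / _"] pabs_divide[of 1] pabs_1
        by (intro mult_left_mono) simp_all
      also have "\<dots> = D * pabs (of_nat ?M :: 'a)"
        using M p_ge_3 by (simp add: power2_eq_square)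
      also have "\<dots> \<le> D * (1 / real p) ^ n"
        using D pabs_mult_p_power_le by (intro mult_left_mono) auto
      finally show "pabs (2 * (?g - 1) * Y n - t * (Z n + A' n) - 0) \<le> D * (1 / real p) ^ n" by simp
    qed
  qed
  moreover have "(\<lambda>n. 2 * (?g - 1) * Y n - t * (Z n + A' n)) \<longlonglongrightarrow>
      2 * (?g - 1) * volkenborn F \<psi> t - t * (0 + A)"
    using A unfolding A'_def by (intro tendsto_diff_padic tendsto_cmult_padic tendsto_add_padic Y Z)
  ultimately have "2 * (?g - 1) * volkenborn F \<psi> t - t * (0 + A) = 0"
    using LIMSEQ_unique by blast
  then show ?thesis by simp
qed

section \<open>Limits of the alternating sums in terms of the L-function\<close>

lemma alternating_sum_convergent:
  fixes \<psi> :: "int \<Rightarrow> 'a"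
  assumes per: "\<And>a. \<psi> (a + int f) = \<psi> a" and f: "f > 0" "odd f" and s: "s \<in> padic_disc p"
  shows "convergent (\<lambda>n. alternating_sum p (f * p ^ n) (\<lambda>a. \<psi> a / teich p a) s)"
proof -
  \<comment> \<open>The preceding results ask for a period divisible by p, so f p takes the place of
    f. This shifts the index by one: f p^(n + 1) = (f p) p^n.\<close>
  have per': "\<psi> (a + int (f * p)) = \<psi> a" for a by (rule periodic_dvd[of \<psi> f, OF per]) simp
  have "convergent (\<lambda>n. \<Sum>a\<in>{1..f * p * p ^ n}. (-1) ^ (a + 1) * twisted_power (\<lambda>a. \<psi> a / teich p a) (- s) (int a))"
    by (rule alternating_twisted_power_convergent)
      (use periodic_divide_teich[of \<psi> "f * p"] per' f odd_p p_ge_3 s in auto)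
  then obtain l where "(\<lambda>n. \<Sum>a\<in>{1..f * p * p ^ n}. (-1) ^ (a + 1) *
      twisted_power (\<lambda>a. \<psi> a / teich p a) (- s) (int a)) \<longlonglongrightarrow> l"
    unfolding convergent_def by blast
  then have "(\<lambda>n. 1 / 2 * (\<Sum>a\<in>{1..f * p ^ Suc n}. (-1) ^ (a + 1) *
      twisted_power (\<lambda>a. \<psi> a / teich p a) (- s) (int a))) \<longlonglongrightarrow> 1 / 2 * l"
    by (intro tendsto_cmult_padic) (simp add: mult.assoc)
  then have "(\<lambda>n. alternating_sum p (f * p ^ Suc n) (\<lambda>a. \<psi> a / teich p a) s) \<longlonglongrightarrow> 1 / 2 * l"
    unfolding alternating_sum_twisted_power[OF s] .
  from LIMSEQ_imp_Suc[OF this] show ?thesis by (rule convergentI)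
qed

lemma alternating_sum_limit:
  fixes \<psi> :: "int \<Rightarrow> 'a"
  assumes per: "\<And>a. \<psi> (a + int f) = \<psi> a" and f: "f > 0" "odd f"
    and double: "\<And>a. \<psi> (2 * a) = \<psi> 2 * \<psi> a"
    and F: "F > 0" "p dvd F" "f dvd F" and s: "s \<in> padic_disc p" "s \<noteq> 1"
  shows "(\<lambda>n. alternating_sum p (f * p ^ n) (\<lambda>a. \<psi> a / teich p a) s)
    \<longlonglongrightarrow> (1 - \<psi> 2 * padic_pow (angle p 2) (1 - s)) * padic_L_formula p F \<psi> s"
proof -
  let ?X = "\<lambda>n. alternating_sum p (f * p ^ n) (\<lambda>a. \<psi> a / teich p a) s"
  let ?Y = "\<lambda>n. \<Sum>a\<in>{1..f * p * p ^ n}. (-1) ^ (a + 1) * twisted_power (\<lambda>a. \<psi> a / teich p a) (- s) (int a)"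
  let ?g = "\<psi> 2 * padic_pow (angle p 2) (1 - s)"
  have t: "1 - s \<in> padic_disc p" using disc_diff[OF disc_1 s(1)] .
  have per': "\<psi> (a + int M) = \<psi> a" if "f dvd M" for a M
    using that by (rule periodic_dvd[of \<psi> f, OF per])
  obtain l where l: "?X \<longlonglongrightarrow> l"
    using alternating_sum_convergent[of \<psi> f s, OF per f s(1)] unfolding convergent_def by blast
  have Y: "?Y \<longlonglongrightarrow> 2 * l"
    using tendsto_cmult_padic[OF LIMSEQ_Suc[OF l], of 2]
    unfolding alternating_sum_twisted_power[OF s(1)] by (simp add: mult.assoc)
  have minus: "1 - s - 1 = - s" by simp
  have fp: "\<And>a. \<psi> (a + int (f * p)) = \<psi> a" "f * p > 0" "p dvd f * p" "odd (f * p)"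
    using f odd_p p_ge_3 by (simp_all only: per' dvd_triv_left dvd_triv_right even_mult_iff) auto
  have "2 * (?g - 1) * volkenborn (f * p) \<psi> (1 - s) = (1 - s) * (2 * l)"
    using doubling[of \<psi> "f * p" "1 - s", OF fp t double] Y unfolding minus by blast
  also have "volkenborn (f * p) \<psi> (1 - s) = volkenborn F \<psi> (1 - s)"
    using volkenborn_eq[of \<psi> "f * p" F, OF fp(1-3) per'[OF F(3)] F(1,2) t] .
  finally have "2 * ((?g - 1) * volkenborn F \<psi> (1 - s)) = 2 * ((1 - s) * l)" by (simp only: mult_ac)
  then have "(?g - 1) * volkenborn F \<psi> (1 - s) = (1 - s) * l" by simp
  \<comment> \<open>Division by 1 - s = -(s - 1) turns the Volkenborn integral into the L-function
    and \<open>?g\<close> - 1 into 1 - \<open>?g\<close>.\<close>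
  then have "l = (1 - ?g) * padic_L_formula p F \<psi> s"
    using s(2) by (simp add: padic_L_formula_volkenborn field_simps)
  then show ?thesis using l by simp
qed

text \<open>Each summand has the Lipschitz constant C, and by the ultrametric inequality so has the
  sum, whatever N is. This uniformity allows the limits in n and in s to be exchanged.\<close>

lemma alternating_sum_lipschitz:
  fixes \<psi> :: "int \<Rightarrow> 'a"
  assumes C: "C \<ge> 0" "\<And>a. pabs (\<psi> a) \<le> C" and s: "pabs s \<le> 1" "pabs t \<le> 1"
  shows "pabs (alternating_sum p N (\<lambda>a. \<psi> a / teich p a) s - alternating_sum p N (\<lambda>a. \<psi> a / teich p a) t)
    \<le> C * pabs (s - t)"
proof -
  let ?T = "twisted_power (\<lambda>a. \<psi> a / teich p a)"
  have half: "pabs (1 / 2 * x :: 'a) = pabs x" for x by (simp add: pabs_mult pabs_divide)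
  have disc: "s \<in> padic_disc p" "t \<in> padic_disc p" using s by (auto intro: disc_pabs_le_1)
  have "alternating_sum p N (\<lambda>a. \<psi> a / teich p a) s - alternating_sum p N (\<lambda>a. \<psi> a / teich p a) t =
      1 / 2 * (\<Sum>a\<in>{1..N}. (-1) ^ (a + 1) * (?T (- s) (int a) - ?T (- t) (int a)))"
    unfolding alternating_sum_twisted_power[OF disc(1)] alternating_sum_twisted_power[OF disc(2)]
    by (simp only: right_diff_distrib sum_subtractf)
  then have "pabs (alternating_sum p N (\<lambda>a. \<psi> a / teich p a) s - alternating_sum p N (\<lambda>a. \<psi> a / teich p a) t) =
      pabs (\<Sum>a\<in>{1..N}. (-1) ^ (a + 1) * (?T (- s) (int a) - ?T (- t) (int a)))"
    by (simp only: half)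
  also have "\<dots> \<le> C * pabs (s - t)"
  proof (rule pabs_sum_le)
    fix a
    show "pabs ((-1) ^ (a + 1) * (?T (- s) (int a) - ?T (- t) (int a))) \<le> C * pabs (s - t)"
    proof (cases "int p dvd int a")
      case True
      then show ?thesis using C by (simp add: twisted_power_def)
    next
      case False
      let ?x = "angle p (int a)"
      have "pabs (padic_pow ?x (- s) - padic_pow ?x (- t)) \<le> pabs (- s - - t)"
        using s by (intro padic_pow_lipschitz angle_one_units False) auto
      also have "\<dots> = pabs (s - t)" using pabs_minus_commute[of s t] by simp
      finally have "pabs (\<psi> (int a)) * pabs (padic_pow ?x (- s) - padic_pow ?x (- t)) \<le> C * pabs (s - t)"
        using C by (intro mult_mono) auto
      moreover have "?T (- s) (int a) - ?T (- t) (int a) =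
          \<psi> (int a) / teich p (int a) * (padic_pow ?x (- s) - padic_pow ?x (- t))"
        using False by (simp add: twisted_power_def algebra_simps)
      ultimately show ?thesis
        by (simp add: pabs_mult pabs_power pabs_divide pabs_teich[OF False])
    qed
  qed (use C in simp)
  finally show ?thesis .
qed

section \<open>Continuity at s = 1\<close>

lemma eventually_at_1_disc: "\<forall>\<^sub>F s :: 'a in at 1. pabs s \<le> 1 \<and> s \<in> padic_disc p \<and> s \<noteq> 1"
proof -
  have "pabs s \<le> 1" if "dist s 1 < 1" for s :: 'a
    using that pabs_add_le[of "s - 1" 1 1] by (simp add: dist_pabs)
  then show ?thesis
    unfolding eventually_at by (intro exI[of _ 1]) (auto intro: disc_pabs_le_1)
qed

lemma pabs_diff_1_tendsto_0: "((\<lambda>s :: 'a. C * pabs (s - 1)) \<longlongrightarrow> 0) (at 1)"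
proof -
  have "((\<lambda>s :: 'a. pabs (s - 1)) \<longlongrightarrow> 0) (at 1)"
    using tendsto_ident_at[of "1 :: 'a" UNIV] unfolding tendsto_pabs_iff .
  then show ?thesis by (rule tendsto_mult_right_zero)
qed

text \<open>For every n the alternating sums at s and at 1 differ by at most C |s - 1|, hence so do
  their limits. The argument looks only at the alternating sums and thus covers the trivial
  character with its pole.\<close>

lemma alternating_sum_limit_at_1:
  fixes \<psi> :: "int \<Rightarrow> 'a"
  assumes per: "\<And>a. \<psi> (a + int f) = \<psi> a" and f: "f > 0" "odd f"
    and double: "\<And>a. \<psi> (2 * a) = \<psi> 2 * \<psi> a"
    and F: "F > 0" "p dvd F" "f dvd F"
  obtains l where "(\<lambda>n. alternating_sum p (f * p ^ n) (\<lambda>a. \<psi> a / teich p a) 1) \<longlonglongrightarrow> l"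
    "((\<lambda>s. (1 - \<psi> 2 * padic_pow (angle p 2) (1 - s)) * padic_L_formula p F \<psi> s) \<longlongrightarrow> l) (at 1)"
proof -
  let ?X = "\<lambda>s n. alternating_sum p (f * p ^ n) (\<lambda>a. \<psi> a / teich p a) s"
  let ?R = "\<lambda>s. (1 - \<psi> 2 * padic_pow (angle p 2) (1 - s)) * padic_L_formula p F \<psi> s"
  obtain C where C: "C \<ge> 0" "\<And>a. pabs (\<psi> a) \<le> C" using periodic_bounded[of \<psi> f] per f by metis
  obtain l where l: "?X 1 \<longlonglongrightarrow> l"
    using alternating_sum_convergent[of \<psi> f 1, OF per f disc_1] unfolding convergent_def by blast
  have "pabs (?R s - l) \<le> C * pabs (s - 1)" if "pabs s \<le> 1 \<and> s \<in> padic_disc p \<and> s \<noteq> 1" for s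
  proof (rule pabs_lim_le)
    show "(\<lambda>n. ?X s n - ?X 1 n) \<longlonglongrightarrow> ?R s - l"
      using that by (intro tendsto_diff_padic l alternating_sum_limit per f double F) auto
    show "pabs (?X s n - ?X 1 n) \<le> C * pabs (s - 1)" for n
      using that C by (intro alternating_sum_lipschitz) auto
  qed
  then have "(?R \<longlongrightarrow> l) (at 1)"
    by (intro tendsto_pabs_bound[OF _ pabs_diff_1_tendsto_0[of C]] eventually_mono[OF eventually_at_1_disc])
  then show ?thesis using l that by blast
qed

lemma filterlim_1_minus: "((\<lambda>s :: 'a. 1 - s) \<longlongrightarrow> 0) (at 1)"
  using tendsto_diff_padic[OF tendsto_const[of 1] tendsto_ident_at[of "1 :: 'a" UNIV]] by simp

lemma filterlim_at_1_minus: "filterlim (\<lambda>s :: 'a. 1 - s) (at 0) (at 1)"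
  unfolding filterlim_at
  using filterlim_1_minus by (auto simp: eventually_at_filter)

lemma padic_pow_tendsto_at_1:
  assumes "x \<in> one_units"
  shows "((\<lambda>s. padic_pow x (1 - s)) \<longlongrightarrow> 1) (at 1)"
proof (rule tendsto_pabs_bound[OF _ pabs_diff_1_tendsto_0[of 1]])
  have "pabs (padic_pow x (1 - s) - 1) \<le> 1 * pabs (s - 1)" if "pabs s \<le> 1 \<and> s \<in> padic_disc p \<and> s \<noteq> 1" for s
    using padic_pow_lipschitz[OF assms, of "1 - s" 0] that pabs_diff_le[of 1 1 s]
    by (simp add: padic_pow_0[OF assms] pabs_minus_commute)
  then show "\<forall>\<^sub>F s in at 1. pabs (padic_pow x (1 - s) - 1) \<le> 1 * pabs (s - 1)"
    by (rule eventually_mono[OF eventually_at_1_disc])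
qed

text \<open>Near t = 1 - s = 0 write <a>^t = 1 + t \<theta> and the Bernoulli series as 1 + t
  \<sigma>. The constant terms add up to the character sum, which is 0, so a factor t splits off and
  cancels 1/(s - 1) = -1/t.\<close>

lemma padic_L_formula_tendsto_at_1:
  assumes F: "F > 0" "p dvd F" and zero: "(\<Sum>a | a \<in> {1..F} \<and> \<not> p dvd a. \<psi> (int a)) = 0"
  shows "\<exists>L. (padic_L_formula p F \<psi> \<longlongrightarrow> L) (at (1 :: 'a))"
proof -
  let ?I = "{a. a \<in> {1..F} \<and> \<not> p dvd a}"
  have "\<exists>\<theta> l. (\<forall>t. pabs t \<le> 1 \<longrightarrow> padic_pow (angle p (int a)) t = 1 + t * \<theta> (t :: 'a)) \<and> (\<theta> \<longlongrightarrow> l) (at 0)"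
    if "a \<in> ?I" for a
  proof -
    have "angle p (int a) \<in> one_units" using that by (intro angle_one_units) auto
    from gchoose_series_derivative[of "\<lambda>j. (angle p (int a) - 1) ^ j" 1, OF one_unitsD[OF this]]
    show ?thesis unfolding padic_pow_def by simp
  qed
  then have "\<forall>a\<in>?I. \<exists>\<theta> l. (\<forall>t :: 'a. pabs t \<le> 1 \<longrightarrow> padic_pow (angle p (int a)) t = 1 + t * \<theta> t) \<and> (\<theta> \<longlongrightarrow> l) (at 0)"
    by blast
  from bchoice[OF this] obtain \<theta> where
    "\<forall>a\<in>?I. \<exists>l. (\<forall>t :: 'a. pabs t \<le> 1 \<longrightarrow> padic_pow (angle p (int a)) t = 1 + t * \<theta> a t) \<and> (\<theta> a \<longlongrightarrow> l) (at 0)" ..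
  from bchoice[OF this] obtain l where \<theta>: "\<And>a t. a \<in> ?I \<Longrightarrow> pabs t \<le> 1 \<Longrightarrow> padic_pow (angle p (int a)) t = 1 + t * \<theta> a t"
    and \<theta>_lim: "\<And>a. a \<in> ?I \<Longrightarrow> (\<theta> a \<longlongrightarrow> l a) (at 0)" by blast
  have "\<exists>\<sigma> m. (\<forall>t. pabs t \<le> 1 \<longrightarrow> bernoulli_series t (of_nat F / of_nat a) = 1 + t * \<sigma> (t :: 'a)) \<and> (\<sigma> \<longlongrightarrow> m) (at 0)"
    if "a \<in> ?I" for a
  proof -
    have "pabs (of_nat F / of_nat a :: 'a) \<le> 1 / real p"
      using pabs_of_nat_dvd[OF F(2)] that by (simp add: pabs_divide pabs_of_nat_unit)
    from gchoose_series_derivative[OF bernoulli_series_coeff[OF this]]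
    show ?thesis unfolding bernoulli_series_def by (simp add: bernoulli_0 mult.assoc)
  qed
  then have "\<forall>a\<in>?I. \<exists>\<sigma> m. (\<forall>t :: 'a. pabs t \<le> 1 \<longrightarrow> bernoulli_series t (of_nat F / of_nat a) = 1 + t * \<sigma> t) \<and> (\<sigma> \<longlongrightarrow> m) (at 0)"
    by blast
  from bchoice[OF this] obtain \<sigma> where
    "\<forall>a\<in>?I. \<exists>m. (\<forall>t :: 'a. pabs t \<le> 1 \<longrightarrow> bernoulli_series t (of_nat F / of_nat a) = 1 + t * \<sigma> a t) \<and> (\<sigma> a \<longlongrightarrow> m) (at 0)" ..
  from bchoice[OF this] obtain m where \<sigma>: "\<And>a t. a \<in> ?I \<Longrightarrow> pabs t \<le> 1 \<Longrightarrow> bernoulli_series t (of_nat F / of_nat a) = 1 + t * \<sigma> a t"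
    and \<sigma>_lim: "\<And>a. a \<in> ?I \<Longrightarrow> (\<sigma> a \<longlongrightarrow> m a) (at 0)" by blast
  let ?\<Phi> = "\<lambda>t. - 1 / of_nat F * (\<Sum>a\<in>?I. \<psi> (int a) * (\<theta> a t + \<sigma> a t + t * (\<theta> a t * \<sigma> a t)))"
  have "(?\<Phi> \<longlongrightarrow> - 1 / of_nat F * (\<Sum>a\<in>?I. \<psi> (int a) * (l a + m a + 0 * (l a * m a)))) (at 0)"
    by (intro tendsto_cmult_padic[where c = "- 1 / of_nat F"] tendsto_sum_padic tendsto_add_padic tendsto_mult_padic
        \<theta>_lim \<sigma>_lim tendsto_ident_at tendsto_const)
  then have "((\<lambda>s. ?\<Phi> (1 - s)) \<longlongrightarrow> - 1 / of_nat F * (\<Sum>a\<in>?I. \<psi> (int a) * (l a + m a + 0 * (l a * m a)))) (at 1)"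
    by (rule filterlim_compose[OF _ filterlim_at_1_minus])
  moreover have "\<forall>\<^sub>F s in at 1. ?\<Phi> (1 - s) = padic_L_formula p F \<psi> s"
  proof (rule eventually_mono[OF eventually_at_1_disc])
    fix s :: 'a assume s: "pabs s \<le> 1 \<and> s \<in> padic_disc p \<and> s \<noteq> 1"
    define t where "t = 1 - s"
    have t: "pabs t \<le> 1" "t \<noteq> 0" using s pabs_diff_le[of 1 1 s] by (auto simp: t_def)
    have "padic_L_formula p F \<psi> s = - 1 / (of_nat F * t) *
        (\<Sum>a\<in>?I. \<psi> (int a) * padic_pow (angle p (int a)) t * bernoulli_series t (of_nat F / of_nat a))"
    proof -
      have "s - 1 = - t" by (simp add: t_def)
      then show ?thesis unfolding padic_L_formula_def bernoulli_series_def t_def[symmetric]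
        by (simp add: divide_simps)
    qed
    also have "(\<Sum>a\<in>?I. \<psi> (int a) * padic_pow (angle p (int a)) t * bernoulli_series t (of_nat F / of_nat a)) =
        (\<Sum>a\<in>?I. \<psi> (int a) + t * (\<psi> (int a) * (\<theta> a t + \<sigma> a t + t * (\<theta> a t * \<sigma> a t))))"
      using t by (intro sum.cong refl) (simp add: \<theta> \<sigma> algebra_simps)
    also have "\<dots> = t * (\<Sum>a\<in>?I. \<psi> (int a) * (\<theta> a t + \<sigma> a t + t * (\<theta> a t * \<sigma> a t)))"
      using zero by (simp only: sum.distrib sum_distrib_left) simp
    also have "- 1 / (of_nat F * t) * \<dots> = ?\<Phi> t" using t by simp
    finally show "?\<Phi> (1 - s) = padic_L_formula p F \<psi> s" by (simp add: t_def)
  qed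
  ultimately show ?thesis by (intro exI) (rule Lim_transform_eventually)
qed

lemma bernoulli_series_0 [simp]: "bernoulli_series 0 y = 1"
  using sums_finite[of "{0}" "\<lambda>j. (0 gchoose j) * y ^ j * of_rat (bernoulli j)"]
  by (auto simp: bernoulli_series_def gbinomial_0_left bernoulli_0 sums_unique[symmetric])

lemma volkenborn_0: "volkenborn F \<psi> 0 = 1 / of_nat F * (\<Sum>a | a \<in> {1..F} \<and> \<not> p dvd a. \<psi> (int a))"
proof -
  have "(\<Sum>a | a \<in> {1..F} \<and> \<not> p dvd a. \<psi> (int a)) = (\<Sum>a | a \<in> {1..F} \<and> \<not> p dvd a. twisted_power \<psi> 0 (int a))"
    by (intro sum.cong refl) (auto simp: twisted_power_def angle_one_units)
  also have "\<dots> = (\<Sum>a\<in>{1..F}. twisted_power \<psi> 0 (int a))"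
    by (intro sum.mono_neutral_left) (auto simp: twisted_power_def)
  finally show ?thesis by (simp add: volkenborn_def)
qed

text \<open>Multiplication by b permutes the residues modulo f p that are prime to p, so their sum
  equals \<psi> b times itself. As b may share factors with F, this is done modulo f p and then
  transferred: at t = 0 the Volkenborn integral is the character sum divided by the modulus, and it
  does not depend on the modulus.\<close>

lemma character_sum_eq_0:
  assumes per: "\<And>a. \<psi> (a + int f) = \<psi> a" and f: "f > 0"
    and mult: "\<And>a b. \<psi> (a * b) = \<psi> a * \<psi> b"
    and F: "F > 0" "p dvd F" "f dvd F"
    and b: "coprime b (int f)" "\<not> int p dvd b" "\<psi> b \<noteq> 1"
  shows "(\<Sum>a | a \<in> {1..F} \<and> \<not> p dvd a. \<psi> (int a)) = (0 :: 'a)"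
proof -
  define q where "q = f * p"
  let ?I = "{a. a \<in> {1..q} \<and> \<not> p dvd a}"
  define h where "h a = nat ((b * int a) mod int q)" for a
  have q: "q > 0" "p dvd q" "f dvd q" using f p_ge_3 by (auto simp: q_def)
  have per': "\<psi> (a + int M) = \<psi> a" if "f dvd M" for a M
    using that by (rule periodic_dvd[of \<psi> f, OF per])
  have cop: "coprime b (int q)"
    using b prime_p prime_imp_coprime[of "int p" b] by (simp add: q_def coprime_commute)
  have h: "int (h a) = (b * int a) mod int q" for a using q by (simp add: h_def)
  have h_in: "h a \<in> ?I" if "a \<in> ?I" for a
  proof -
    have "\<not> int p dvd b * int a" using b(2) that by (intro not_p_dvd_mult) auto
    then have ndvd: "\<not> int p dvd int (h a)"
      unfolding h using q(2) by (simp add: dvd_mod_iff)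
    then have "h a \<noteq> 0" by (intro notI) simp
    moreover have "int (h a) < int q" unfolding h using q by simp
    ultimately show ?thesis using ndvd by simp
  qed
  have inj: "inj_on h ?I"
  proof (rule inj_onI)
    fix a a' assume a: "a \<in> ?I" "a' \<in> ?I" "h a = h a'"
    then have "[b * int a = b * int a'] (mod int q)" using h by (metis cong_def)
    then have "[int a = int a'] (mod int q)" using cop by (simp add: cong_mult_lcancel)
    then have "[a = a'] (mod q)" by (simp add: cong_int_iff)
    moreover have "x < q" if "x \<in> ?I" for x
      using that q(2) by (cases "x = q") auto
    then have "a < q" "a' < q" using a(1,2) by blast+
    ultimately show "a = a'" by (rule cong_less_modulus_unique_nat)
  qed
  have \<psi>h: "\<psi> (int (h a)) = \<psi> b * \<psi> (int a)" for a
    using periodic_mod[of \<psi> q, OF per'[OF q(3)]] by (simp add: h mult)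
  have "h ` ?I = ?I" using h_in inj by (intro endo_inj_surj) auto
  then have "(\<Sum>a\<in>?I. \<psi> (int a)) = (\<Sum>a\<in>?I. \<psi> (int (h a)))"
    using sum.reindex[OF inj, of "\<lambda>a. \<psi> (int a)"] by simp
  also have "\<dots> = \<psi> b * (\<Sum>a\<in>?I. \<psi> (int a))" by (simp only: \<psi>h sum_distrib_left)
  finally have "(\<psi> b - 1) * (\<Sum>a\<in>?I. \<psi> (int a)) = 0" by (simp add: algebra_simps)
  then have "(\<Sum>a\<in>?I. \<psi> (int a)) = 0" using b(3) by simp
  then have "volkenborn q \<psi> 0 = 0" unfolding volkenborn_0 by simp
  moreover have "volkenborn F \<psi> 0 = volkenborn q \<psi> 0"
    using volkenborn_eq[of \<psi> F q, OF per'[OF F(3)] F(1,2) per'[OF q(3)] q(1,2) disc_0] .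
  ultimately have "volkenborn F \<psi> 0 = 0" by simp
  then show ?thesis using F(1) unfolding volkenborn_0 by simp
qed

lemma padic_L_tendsto_at_1:
  fixes \<psi> :: "int \<Rightarrow> 'a"
  assumes per: "\<And>a. \<psi> (a + int f) = \<psi> a" and f: "f > 0"
    and mult: "\<And>a b. \<psi> (a * b) = \<psi> a * \<psi> b"
    and F: "F > 0" "p dvd F" "f dvd F"
    and nontriv: "\<exists>b. coprime b (int f) \<and> \<not> int p dvd b \<and> \<psi> b \<noteq> 1"
  shows "(padic_L_formula p F \<psi> \<longlongrightarrow> padic_L p F \<psi> 1) (at 1)"
proof -
  obtain b where "coprime b (int f)" "\<not> int p dvd b" "\<psi> b \<noteq> 1" using nontriv by blast
  from character_sum_eq_0[of \<psi> f F b, OF per f mult F this]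
  obtain L where L: "(padic_L_formula p F \<psi> \<longlongrightarrow> L) (at 1)"
    using padic_L_formula_tendsto_at_1[of F \<psi>] F by blast
  then show ?thesis using tendsto_Lim[OF islimpt_padic L] by (simp add: padic_L_def)
qed

lemma alternating_sum_padic_L:
  fixes \<psi> :: "int \<Rightarrow> 'a"
  assumes per: "\<And>a. \<psi> (a + int f) = \<psi> a" and f: "f > 0" "odd f"
    and mult: "\<And>a b. \<psi> (a * b) = \<psi> a * \<psi> b"
    and F: "F > 0" "p dvd F" "f dvd F" and s: "s \<in> padic_disc p"
    and nontriv: "s = 1 \<Longrightarrow> \<exists>b. coprime b (int f) \<and> \<not> int p dvd b \<and> \<psi> b \<noteq> 1"
  shows "(\<lambda>n. alternating_sum p (f * p ^ n) (\<lambda>a. \<psi> a / teich p a) s)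
    \<longlonglongrightarrow> (1 - \<psi> 2 * padic_pow (angle p 2) (1 - s)) * padic_L p F \<psi> s"
proof (cases "s = 1")
  case False
  then show ?thesis
    using alternating_sum_limit[of \<psi> f F s, OF per f mult F s] by (simp add: padic_L_def)
next
  case True
  note u = angle_one_units[OF not_p_dvd_2]
  obtain l where l: "(\<lambda>n. alternating_sum p (f * p ^ n) (\<lambda>a. \<psi> a / teich p a) 1) \<longlonglongrightarrow> l"
    and lim: "((\<lambda>s. (1 - \<psi> 2 * padic_pow (angle p 2) (1 - s)) * padic_L_formula p F \<psi> s) \<longlongrightarrow> l) (at 1)"
    using alternating_sum_limit_at_1[of \<psi> f F, OF per f mult F] by blast
  have "((\<lambda>s. (1 - \<psi> 2 * padic_pow (angle p 2) (1 - s)) * padic_L_formula p F \<psi> s)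
      \<longlongrightarrow> (1 - \<psi> 2 * 1) * padic_L p F \<psi> 1) (at 1)"
    using padic_L_tendsto_at_1[of \<psi> f F, OF per f(1) mult F nontriv[OF True]]
    by (intro tendsto_mult_padic[where a = "1 - \<psi> 2 * 1"] tendsto_diff_padic tendsto_const tendsto_cmult_padic
        padic_pow_tendsto_at_1 u)
  then have "l = (1 - \<psi> 2 * 1) * padic_L p F \<psi> 1"
    using lim tendsto_unique[OF islimpt_padic] by blast
  then show ?thesis using l True by (simp add: padic_pow_0[OF u])
qed

text \<open>Primitivity with d = 1: if \<psi> were 1 on everything prime to f, then f = 1 and \<psi>
  would be constant. If the b so found is divisible by p, then p does not divide f and b + f can be
  taken instead.\<close>

lemma dirichlet_char_nontrivial:
  fixes \<psi> :: "int \<Rightarrow> 'a"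
  assumes "dirichlet_char f \<psi>" "\<psi> \<noteq> (\<lambda>_. 1)"
  shows "\<exists>b. coprime b (int f) \<and> \<not> int p dvd b \<and> \<psi> b \<noteq> 1"
proof -
  have per: "\<psi> (a + int f) = \<psi> a" for a using assms(1) by (simp add: dirichlet_char_def)
  have prim: "\<And>d. d dvd f \<Longrightarrow> (\<And>a. coprime a (int f) \<Longrightarrow> [a = 1] (mod int d) \<Longrightarrow> \<psi> a = 1) \<Longrightarrow> d = f"
    using assms(1) by (simp add: dirichlet_char_def)
  have "\<exists>b. coprime b (int f) \<and> \<psi> b \<noteq> 1"
  proof (rule ccontr)
    assume *: "\<not> (\<exists>b. coprime b (int f) \<and> \<psi> b \<noteq> 1)"
    then have "1 = f" by (intro prim) auto
    then have "\<psi> = (\<lambda>_. 1)" using * by auto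
    with assms(2) show False by contradiction
  qed
  then obtain b where b: "coprime b (int f)" "\<psi> b \<noteq> 1" by blast
  show ?thesis
  proof (cases "int p dvd b")
    case False
    then show ?thesis using b by blast
  next
    case True
    have "\<not> int p dvd int f"
    proof
      assume "int p dvd int f"
      then have "is_unit (int p)" using b(1) True by (meson coprime_common_divisor)
      then show False using p_ge_3 by simp
    qed
    then have "\<not> int p dvd b + int f" using True by (simp add: dvd_add_right_iff)
    moreover have "coprime (b + int f) (int f)" using b(1) by (simp add: coprime_iff_gcd_eq_1)
    ultimately show ?thesis using b(2) per by metis
  qed
qed

subsection \<open>Powers of the Teichmueller character\<close>

lemma teich_powi_eq_1:
  assumes "\<not> int p dvd a" "int (p - 1) dvd k"
  shows "(teich p a :: 'a) powi k = 1"
proof -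
  obtain m where "k = int (p - 1) * m" using assms(2) by blast
  then show ?thesis using teich(1)[OF assms(1)] by (simp add: power_int_mult)
qed

lemma teich_char_eq: "\<not> int p dvd a \<Longrightarrow> teich_char p k a = (teich p a powi k :: 'a)"
  by (simp add: teich_char_def teich_powi_eq_1)

lemma teich_char_periodic: "teich_char p k (a + int p) = (teich_char p k a :: 'a)"
proof -
  have "teich p (a + int p) = (teich p a :: 'a)" by (rule teich_cong) (simp add: cong_iff_dvd_diff)
  then show ?thesis by (simp add: teich_char_def)
qed

lemma teich_char_mult: "teich_char p k (a * b) = (teich_char p k a * teich_char p k b :: 'a)"
proof (cases "int p dvd a \<or> int p dvd b")
  case True
  then show ?thesis by (auto simp: teich_char_def)
next
  case False
  then show ?thesis
    using not_p_dvd_mult[of a b] by (simp add: teich_char_eq teich_mult power_int_mult_distrib)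
qed

text \<open>Otherwise the p - 1 distinct values \<omega>(1), ..., \<omega>(p - 1) would all be roots
  of X^r - 1, where r is the residue of k modulo p - 1 and 0 < r < p - 1.\<close>

lemma teich_char_nontrivial:
  assumes "\<not> int (p - 1) dvd k"
  shows "\<exists>b. coprime b (int p) \<and> \<not> int p dvd b \<and> teich_char p k b \<noteq> (1 :: 'a)"
proof (rule ccontr)
  assume neg: "\<not> (\<exists>b. coprime b (int p) \<and> \<not> int p dvd b \<and> teich_char p k b \<noteq> (1 :: 'a))"
  define m where "m = p - 1"
  define r where "r = nat (k mod int m)"
  have "k mod int m \<noteq> 0" using assms by (simp add: m_def dvd_eq_mod_eq_0)
  moreover have "m > 0" using p_ge_3 by (simp add: m_def)
  then have "k mod int m \<ge> 0" "k mod int m < int m" by simp_all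
  ultimately have r: "r > 0" "r < m" "k = int m * (k div int m) + int r"
    by (auto simp: r_def)
  have ndvd: "\<not> int p dvd int a" if "a \<in> {1..m}" for a
    using that p_ge_3 dvd_imp_le[of p a] by (auto simp: m_def)
  have root: "(teich p (int a) :: 'a) ^ r = 1" if "a \<in> {1..m}" for a
  proof -
    note a = ndvd[OF that]
    have "coprime (int a) (int p)"
      using prime_imp_coprime[of "int p" "int a"] a prime_p by (simp add: coprime_commute)
    then have "(teich p (int a) :: 'a) powi k = 1" using neg a teich_char_eq[OF a] by metis
    moreover have "(teich p (int a) :: 'a) powi k =
        teich p (int a) powi (int m * (k div int m)) * teich p (int a) powi int r"
      using r(3) teich_nonzero[OF a] by (metis power_int_add)
    moreover have "(teich p (int a) :: 'a) powi (int m * (k div int m)) = 1"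
      unfolding m_def by (rule teich_powi_eq_1[OF a dvd_triv_left])
    ultimately show ?thesis by simp
  qed
  have inj: "inj_on (\<lambda>a. teich p (int a) :: 'a) {1..m}"
  proof (rule inj_onI)
    fix a b assume a: "a \<in> {1..m}" and b: "b \<in> {1..m}"
      and eq: "teich p (int a) = (teich p (int b) :: 'a)"
    have "pabs ((teich p (int b) - of_int (int b)) - (teich p (int a) - of_int (int a)) :: 'a) \<le> 1 / real p"
      by (rule pabs_diff_le[OF teich(2)[OF ndvd[OF b]] teich(2)[OF ndvd[OF a]]])
    then have "pabs (of_int (int a - int b) :: 'a) \<le> 1 / real p" by (simp add: eq)
    then have "pabs (of_int (int a - int b) :: 'a) \<noteq> 1" using p_ge_3 by auto
    then have "int p dvd int a - int b" using pabs_of_int_unit by blast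
    then have "[a = b] (mod p)" by (simp add: cong_iff_dvd_diff flip: cong_int_iff)
    then show "a = b" using a b p_ge_3 by (intro cong_less_modulus_unique_nat[of a b p]) (auto simp: m_def)
  qed
  let ?P = "Polynomial.monom 1 r - 1 :: 'a poly"
  have deg: "degree ?P \<le> r" by (intro degree_diff_le) (auto simp: degree_monom_le)
  have "Polynomial.coeff ?P r = 1" using r(1) by simp
  then have "?P \<noteq> 0" by (intro notI) simp
  then have "card {x. poly ?P x = 0} \<le> degree ?P" "finite {x. poly ?P x = 0}"
    by (rule card_poly_roots_bound, rule poly_roots_finite)
  moreover have "(\<lambda>a. teich p (int a)) ` {1..m} \<subseteq> {x. poly ?P x = 0}"
    using root by (auto simp: poly_monom)
  ultimately have "card ((\<lambda>a. teich p (int a) :: 'a) ` {1..m}) \<le> degree ?P"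
    by (meson card_mono order_trans)
  then have "card {1..m} \<le> r" using deg unfolding card_image[OF inj] by (rule order_trans)
  then show False using r(2) by simp
qed

lemma alternating_sum_teich:
  "alternating_sum p N (\<lambda>a. teich_char p (1 - int i) a / teich p a :: 'a) s =
    alternating_sum p N (\<lambda>a. teich p a powi (- int i)) s"
proof -
  have "teich_char p (1 - int i) (int a) / teich p (int a) = (teich p (int a) powi (- int i) :: 'a)"
    if "\<not> p dvd a" for a
  proof -
    have a: "\<not> int p dvd int a" using that by simp
    have "(teich p (int a) :: 'a) powi (1 - int i) = teich p (int a) powi (- int i + 1)" by simp
    also have "\<dots> = teich p (int a) powi (- int i) * teich p (int a)"
      using power_int_add[OF disjI1[OF teich_nonzero[OF a]], of "- int i" 1] by simp
    finally show ?thesis using teich_nonzero[OF a] by (simp add: teich_char_eq[OF a])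
  qed
  then show ?thesis unfolding alternating_sum_def by (intro arg_cong[where f = "\<lambda>x. 1 / 2 * x"] sum.cong) auto
qed

lemma alternating_sum_teich_limit:
  fixes s :: 'a
  assumes F: "F > 0" "p dvd F" and i: "i \<in> {1..p - 2}" and s: "s \<in> padic_disc p" "s \<noteq> 1 \<or> i \<noteq> 1"
  shows "(\<lambda>n. alternating_sum p (p ^ n) (\<lambda>a. teich p a powi (- int i)) s)
    \<longlonglongrightarrow> (1 - teich p 2 powi (1 - int i) * padic_pow (angle p 2) (1 - s)) * padic_zeta p F i s"
proof -
  have ndvd: "\<not> int (p - 1) dvd 1 - int i" if "i \<noteq> 1"
    using that i dvd_imp_le_int[of "1 - int i" "int (p - 1)"] by auto
  \<comment> \<open>Here p is used as a period for every i, also for i = 1, where the conductor is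
    1. The sums then start at p^1, and the index is shifted back at the end.\<close>
  have "(\<lambda>n. alternating_sum p (p * p ^ n) (\<lambda>a. teich_char p (1 - int i) a / teich p a) s)
    \<longlonglongrightarrow> (1 - teich_char p (1 - int i) 2 * padic_pow (angle p 2) (1 - s)) * padic_L p F (teich_char p (1 - int i)) s"
    using p_ge_3 odd_p F s ndvd
    by (intro alternating_sum_padic_L teich_char_periodic teich_char_mult teich_char_nontrivial) auto
  then have "(\<lambda>n. alternating_sum p (p ^ Suc n) (\<lambda>a. teich p a powi (- int i)) s)
    \<longlonglongrightarrow> (1 - teich p 2 powi (1 - int i) * padic_pow (angle p 2) (1 - s)) * padic_zeta p F i s"
    by (simp add: alternating_sum_teich teich_char_eq[OF not_p_dvd_2] padic_zeta_def)
  then show ?thesis by (rule LIMSEQ_imp_Suc)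
qed

text \<open>The condition on s is that of \<open>euler_factor_nonzero\<close> for t = 1 - s, so the
  limit formula can be divided by the Euler factor. It also excludes the pole, since for i = 1 the
  power of \<open>teich p 2\<close> is 1.\<close>

lemma padic_zeta_limit:
  fixes s :: 'a
  assumes F: "F > 0" "p dvd F" and i: "i \<in> {1..p - 2}"
    and s: "s \<in> padic_disc p" "s \<noteq> 1 \<or> teich p 2 powi (1 - int i) \<noteq> (1 :: 'a)"
  shows "1 - teich p 2 powi (1 - int i) * padic_pow (angle p 2) (1 - s) \<noteq> 0" (is "?E \<noteq> 0")
    and "convergent (\<lambda>n. alternating_sum p (p ^ n) (\<lambda>a. teich p a powi (- int i)) s)" (is "convergent ?X")
    and "padic_zeta p F i s = 1 / (1 - teich p 2 powi (1 - int i) * padic_pow (angle p 2) (1 - s)) *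
      lim (\<lambda>n. alternating_sum p (p ^ n) (\<lambda>a. teich p a powi (- int i)) s)"
proof -
  have "((teich p 2 :: 'a) powi (1 - int i)) ^ (p - 1) = teich p 2 powi ((1 - int i) * int (p - 1))"
    by (simp add: power_int_mult)
  also have "\<dots> = 1" by (rule teich_powi_eq_1[OF not_p_dvd_2]) simp
  finally show E: "?E \<noteq> 0" using s disc_diff[OF disc_1 s(1)] by (intro euler_factor_nonzero) auto
  have "s \<noteq> 1 \<or> i \<noteq> 1" using s(2) by auto
  from alternating_sum_teich_limit[OF F i s(1) this]
  have lim: "?X \<longlonglongrightarrow> ?E * padic_zeta p F i s" .
  then show "convergent ?X" by (rule convergentI)
  show "padic_zeta p F i s = 1 / ?E * lim ?X" using limI[OF lim] E by simp
qed

end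

lemma padic_field_is_padic_complex:
  assumes "is_padic_complex p TYPE('a :: {alg_closed_field, field_char_0, complete_space})" "p \<noteq> 2"
  shows "padic_field TYPE('a) p"
  using assms unfolding is_padic_complex_def padic_field_def by blast

theorem corollary4p3:
  fixes p f F :: nat
    and \<psi> :: "int \<Rightarrow> 'a::{alg_closed_field, field_char_0, complete_space}"
  assumes "prime p" and "p \<noteq> 2"
    and "is_padic_complex p TYPE('a)"
    and "dirichlet_char f \<psi>" and "\<psi> (-1) = 1" and "odd f"
    and "F > 0" and "p dvd F" and "f dvd F"
  shows
    \<comment> \<open>away from the pole of the L-function\<close>
    "(\<forall>s \<in> padic_disc p. \<psi> \<noteq> (\<lambda>_. 1) \<or> s \<noteq> 1 \<longrightarrow>
        (\<lambda>n. alternating_sum p (f * p ^ n) (\<lambda>a. \<psi> a / teich p a) s)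
          \<longlonglongrightarrow> (1 - \<psi> 2 * padic_pow (angle p 2) (1 - s)) * padic_L p F \<psi> s)
     \<and>
     \<comment> \<open>at the pole of the L-function of the trivial character, where the product on the
         left-hand side has a removable singularity\<close>
     (\<psi> = (\<lambda>_. 1) \<longrightarrow>
        (\<exists>l. (\<lambda>n. alternating_sum p (f * p ^ n) (\<lambda>a. \<psi> a / teich p a) 1) \<longlonglongrightarrow> l \<and>
             ((\<lambda>s. (1 - \<psi> 2 * padic_pow (angle p 2) (1 - s)) * padic_L p F \<psi> s) \<longlongrightarrow> l) (at 1)))
     \<and>
     (\<forall>i \<in> {1..p - 2}. odd i \<longrightarrow>
        (\<forall>s \<in> (padic_disc p :: 'a set). s \<noteq> 1 \<or> teich p 2 powi (1 - int i) \<noteq> (1 :: 'a) \<longrightarrow>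
           1 - teich p 2 powi (1 - int i) * padic_pow (angle p 2) (1 - s) \<noteq> 0 \<and>
           convergent (\<lambda>n. alternating_sum p (p ^ n) (\<lambda>a. teich p a powi (- int i)) s) \<and>
           padic_zeta p F i s =
             1 / (1 - teich p 2 powi (1 - int i) * padic_pow (angle p 2) (1 - s)) *
             lim (\<lambda>n. alternating_sum p (p ^ n) (\<lambda>a. teich p a powi (- int i)) s))
        \<and>
        \<comment> \<open>if the denominator vanishes at 1 and 1 is not a pole, the quotient is to be read as a limit\<close>
        (i \<noteq> 1 \<longrightarrow>
           ((\<lambda>s. 1 / (1 - teich p 2 powi (1 - int i) * padic_pow (angle p 2) (1 - s)) *
                lim (\<lambda>n. alternating_sum p (p ^ n) (\<lambda>a. teich p a powi (- int i)) s))
             \<longlongrightarrow> padic_zeta p F i (1 :: 'a)) (at 1)))"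
proof -
  interpret padic_field p "TYPE('a)"
    using assms(2,3) by (intro padic_field_is_padic_complex)
  have per: "\<And>a. \<psi> (a + int f) = \<psi> a" and mult: "\<And>a b. \<psi> (a * b) = \<psi> a * \<psi> b" and f: "f > 0"
    using assms(4) by (simp_all add: dirichlet_char_def)
  show ?thesis
  proof (intro conjI ballI impI)
    fix s :: 'a assume "s \<in> padic_disc p" "\<psi> \<noteq> (\<lambda>_. 1) \<or> s \<noteq> 1"
    then show "(\<lambda>n. alternating_sum p (f * p ^ n) (\<lambda>a. \<psi> a / teich p a) s)
        \<longlonglongrightarrow> (1 - \<psi> 2 * padic_pow (angle p 2) (1 - s)) * padic_L p F \<psi> s"
      using dirichlet_char_nontrivial[OF assms(4)]
      by (intro alternating_sum_padic_L per f assms mult) auto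
  next
    \<comment> \<open>At the pole the value of \<open>padic_L\<close> is meaningless, but the limit
      at 1 ignores it: for s \<noteq> 1 it agrees with \<open>padic_L_formula\<close>.\<close>
    obtain l where l: "(\<lambda>n. alternating_sum p (f * p ^ n) (\<lambda>a. \<psi> a / teich p a) 1) \<longlonglongrightarrow> l"
      and lim: "((\<lambda>s. (1 - \<psi> 2 * padic_pow (angle p 2) (1 - s)) * padic_L_formula p F \<psi> s) \<longlongrightarrow> l) (at 1)"
      using alternating_sum_limit_at_1[of \<psi> f F, OF per f assms(6) mult assms(7-9)] by blast
    have "\<forall>\<^sub>F s in at 1. (1 - \<psi> 2 * padic_pow (angle p 2) (1 - s)) * padic_L_formula p F \<psi> s =
        (1 - \<psi> 2 * padic_pow (angle p 2) (1 - s)) * padic_L p F \<psi> s"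
      by (rule eventually_mono[OF eventually_at_1_disc]) (simp add: padic_L_def)
    from Lim_transform_eventually[OF lim this] l
    show "\<exists>l. (\<lambda>n. alternating_sum p (f * p ^ n) (\<lambda>a. \<psi> a / teich p a) 1) \<longlonglongrightarrow> l \<and>
        ((\<lambda>s. (1 - \<psi> 2 * padic_pow (angle p 2) (1 - s)) * padic_L p F \<psi> s) \<longlongrightarrow> l) (at 1)"
      by blast
  next
    fix i and s :: 'a
    assume i: "i \<in> {1..p - 2}" and s: "s \<in> padic_disc p" "s \<noteq> 1 \<or> teich p 2 powi (1 - int i) \<noteq> (1 :: 'a)"
    note * = padic_zeta_limit[OF assms(7,8) i s]
    show "1 - teich p 2 powi (1 - int i) * padic_pow (angle p 2) (1 - s) \<noteq> 0" by (rule *(1))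
    show "convergent (\<lambda>n. alternating_sum p (p ^ n) (\<lambda>a. teich p a powi (- int i)) s)" by (rule *(2))
    show "padic_zeta p F i s =
             1 / (1 - teich p 2 powi (1 - int i) * padic_pow (angle p 2) (1 - s)) *
             lim (\<lambda>n. alternating_sum p (p ^ n) (\<lambda>a. teich p a powi (- int i)) s)" by (rule *(3))
  next
    fix i assume i: "i \<in> {1..p - 2}" "i \<noteq> 1"
    \<comment> \<open>For i \<noteq> 1 the character is nontrivial, so the L-function is continuous
      at 1 even where the Euler factor vanishes. Off 1 the quotient equals the L-function and
      therefore has the same limit.\<close>
    have "\<not> int (p - 1) dvd 1 - int i"
      using i dvd_imp_le_int[of "1 - int i" "int (p - 1)"] by auto
    then have "(padic_L_formula p F (teich_char p (1 - int i)) \<longlongrightarrow> padic_zeta p F i (1 :: 'a)) (at 1)"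
      unfolding padic_zeta_def using p_ge_3 assms(7,8)
      by (intro padic_L_tendsto_at_1[where f = p] teich_char_periodic teich_char_mult teich_char_nontrivial) auto
    moreover have "\<forall>\<^sub>F s :: 'a in at 1. padic_L_formula p F (teich_char p (1 - int i)) s =
        1 / (1 - teich p 2 powi (1 - int i) * padic_pow (angle p 2) (1 - s)) *
        lim (\<lambda>n. alternating_sum p (p ^ n) (\<lambda>a. teich p a powi (- int i)) s)"
    proof (rule eventually_mono[OF eventually_at_1_disc])
      fix s :: 'a assume s: "pabs s \<le> 1 \<and> s \<in> padic_disc p \<and> s \<noteq> 1"
      then have "padic_L_formula p F (teich_char p (1 - int i)) s = padic_zeta p F i s"
        by (simp add: padic_zeta_def padic_L_def)
      then show "padic_L_formula p F (teich_char p (1 - int i)) s =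
          1 / (1 - teich p 2 powi (1 - int i) * padic_pow (angle p 2) (1 - s)) *
          lim (\<lambda>n. alternating_sum p (p ^ n) (\<lambda>a. teich p a powi (- int i)) s)"
        using padic_zeta_limit(3)[OF assms(7,8) i(1), of s] s by simp
    qed
    ultimately show "((\<lambda>s. 1 / (1 - teich p 2 powi (1 - int i) * padic_pow (angle p 2) (1 - s)) *
                lim (\<lambda>n. alternating_sum p (p ^ n) (\<lambda>a. teich p a powi (- int i)) s))
             \<longlongrightarrow> padic_zeta p F i (1 :: 'a)) (at 1)"
      by (rule Lim_transform_eventually)
  qed
qed

end
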